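(* Let $n\geq 2$ and let $G_n$ be an extraspecial $2$-group of order $2^{2n+1}$. Then $$\pi_1(B(2,G_n))\;\cong\;\operatorname{colim}_{A\in\mathcal N(2,G_n)}A\;\cong\; G_n\times \mathbb Z/2 .$$
   Context: For a finite group $G$, $B(2,G)$ is the geometric realization of the simplicial subset of the nerve of $G$ whose set of $n$-simplices is $\mathrm{Hom}(F_n/[F_n,F_n],G)\subset \mathrm{Hom}(F_n,G)=G^n$ ($F_n$ the free group of rank $n$), i.e. the set of $n$-tuples of pairwise commuting elements of $G$. $\mathcal N(2,G)$ is the poset, under inclusion, of all abelian subgroups of $G$, and the colimit is taken in the category of groups, over the diagram of inclusions. An extraspecial $2$-group $G_n$ of order $2^{2n+1}$ is a group fitting into an extension $1\to\mathbb Z/2\to G_n\to(\mathbb Z/2)^{2n}\to 1$ in which $\mathbb Z/2$ is the center $Z(G_n)$. Up to isomorphism there are two for each $n$: the central product of $n$ copies of $D_8$, and the central product of $n-1$ copies of $D_8$ and one copy of $Q_8$. The statement applies to both. *)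

theory Defs
  imports "HOL-Homology.Homology" "HOL-Algebra.Product_Groups"
begin

section \<open>Quotient spaces and the fundamental group\<close>

text \<open>The points of the quotient space are the classes \<open>r `` {y}\<close>.\<close>

definition quotient_space :: "'a topology \<Rightarrow> ('a \<times> 'a) set \<Rightarrow> 'a set topology" where
  "quotient_space Y r =
     topology (\<lambda>U. U \<subseteq> topspace Y // r \<and> openin Y {y \<in> topspace Y. r `` {y} \<in> U})"

lemma openin_quotient_space:
  "openin (quotient_space Y r) U \<longleftrightarrow>
     U \<subseteq> topspace Y // r \<and> openin Y {y \<in> topspace Y. r `` {y} \<in> U}"
proof -
  have "istopology (\<lambda>U. U \<subseteq> topspace Y // r \<and> openin Y {y \<in> topspace Y. r `` {y} \<in> U})"
    unfolding istopology_def
  proof (intro conjI allI impI)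
    fix S T
    assume S: "S \<subseteq> topspace Y // r \<and> openin Y {y \<in> topspace Y. r `` {y} \<in> S}"
      and T: "T \<subseteq> topspace Y // r \<and> openin Y {y \<in> topspace Y. r `` {y} \<in> T}"
    have "{y \<in> topspace Y. r `` {y} \<in> S \<inter> T} =
            {y \<in> topspace Y. r `` {y} \<in> S} \<inter> {y \<in> topspace Y. r `` {y} \<in> T}" by auto
    then show "openin Y {y \<in> topspace Y. r `` {y} \<in> S \<inter> T}" using S T by auto
    show "S \<inter> T \<subseteq> topspace Y // r" using S by auto
  next
    fix \<K> assume K: "\<forall>K\<in>\<K>. K \<subseteq> topspace Y // r \<and> openin Y {y \<in> topspace Y. r `` {y} \<in> K}"
    have "{y \<in> topspace Y. r `` {y} \<in> \<Union>\<K>} = (\<Union>K\<in>\<K>. {y \<in> topspace Y. r `` {y} \<in> K})" by auto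
    then show "openin Y {y \<in> topspace Y. r `` {y} \<in> \<Union>\<K>}" using K by auto
    show "\<Union>\<K> \<subseteq> topspace Y // r" using K by auto
  qed
  then show ?thesis by (simp add: quotient_space_def)
qed

lemma topspace_quotient_space [simp]: "topspace (quotient_space Y r) = topspace Y // r"
proof
  show "topspace (quotient_space Y r) \<subseteq> topspace Y // r"
    using openin_quotient_space[of Y r] by auto
  have "{y \<in> topspace Y. r `` {y} \<in> topspace Y // r} = topspace Y"
    by (auto simp: quotient_def)
  then have "openin (quotient_space Y r) (topspace Y // r)"
    by (simp add: openin_quotient_space)
  then show "topspace Y // r \<subseteq> topspace (quotient_space Y r)"
    by (rule openin_subset)
qed

lemma quotient_map_quotient_space: "quotient_map Y (quotient_space Y r) (\<lambda>y. r `` {y})"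
  by (auto simp: quotient_map_def openin_quotient_space quotient_def)

definition loop_in :: "'a topology \<Rightarrow> 'a \<Rightarrow> (real \<Rightarrow> 'a) \<Rightarrow> bool" where
  "loop_in X x0 p \<longleftrightarrow> pathin X p \<and> p 0 = x0 \<and> p 1 = x0"

text \<open>Homotopy of loops relative to the end points. Values of a loop outside \<open>{0..1}\<close> are
  irrelevant for \<^const>\<open>homotopic_with\<close> and hence are identified in the class.\<close>

definition loop_class :: "'a topology \<Rightarrow> 'a \<Rightarrow> (real \<Rightarrow> 'a) \<Rightarrow> (real \<Rightarrow> 'a) set" where
  "loop_class X x0 p =
     {q. homotopic_with (\<lambda>r. r 0 = x0 \<and> r 1 = x0) (top_of_set {0..1}) X p q}"

text \<open>The library's \<^const>\<open>joinpaths\<close> is restricted to types of class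
  \<^class>\<open>topological_space\<close>.\<close>

definition path_concat :: "(real \<Rightarrow> 'a) \<Rightarrow> (real \<Rightarrow> 'a) \<Rightarrow> real \<Rightarrow> 'a" where
  "path_concat p q = (\<lambda>t. if t \<le> 1/2 then p (2 * t) else q (2 * t - 1))"

definition fundamental_group :: "'a topology \<Rightarrow> 'a \<Rightarrow> (real \<Rightarrow> 'a) set monoid" where
  "fundamental_group X x0 =
     \<lparr>carrier = loop_class X x0 ` {p. loop_in X x0 p},
      monoid.mult = (\<lambda>P Q. \<Union>p\<in>P. \<Union>q\<in>Q. loop_class X x0 (path_concat p q)),
      one = loop_class X x0 (\<lambda>_. x0)\<rparr>"

section \<open>Simplicial sets and geometric realization\<close>

text \<open>A map \<open>[m] \<rightarrow> [n]\<close> of the simplex category is represented by a function on \<^typ>\<open>nat\<close>,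
  of which only the values on \<open>{..m}\<close> matter. A simplicial set consists of its sets of
  simplices and, for such a map \<open>\<theta>\<close>, the induced map \<open>sact K m n \<theta>\<close> from \<open>n\<close>-simplices to
  \<open>m\<close>-simplices.\<close>

definition simplex_maps :: "nat \<Rightarrow> nat \<Rightarrow> (nat \<Rightarrow> nat) set" where
  "simplex_maps m n = {\<theta>. mono_on {..m} \<theta> \<and> \<theta> ` {..m} \<subseteq> {..n}}"

record 'a sset =
  simplices :: "nat \<Rightarrow> 'a set"
  sact :: "nat \<Rightarrow> nat \<Rightarrow> (nat \<Rightarrow> nat) \<Rightarrow> 'a \<Rightarrow> 'a"

locale simplicial_set =
  fixes K :: "'a sset"
  assumes act_closed: "\<theta> \<in> simplex_maps m n \<Longrightarrow> x \<in> simplices K n \<Longrightarrow> sact K m n \<theta> x \<in> simplices K m"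
    and act_cong: "\<theta> \<in> simplex_maps m n \<Longrightarrow> x \<in> simplices K n \<Longrightarrow> (\<And>i. i \<le> m \<Longrightarrow> \<theta> i = \<theta>' i)
                     \<Longrightarrow> sact K m n \<theta> x = sact K m n \<theta>' x"
    and act_id: "x \<in> simplices K n \<Longrightarrow> sact K n n id x = x"
    and act_comp: "\<phi> \<in> simplex_maps l m \<Longrightarrow> \<theta> \<in> simplex_maps m n \<Longrightarrow> x \<in> simplices K n
                     \<Longrightarrow> sact K l m \<phi> (sact K m n \<theta> x) = sact K l n (\<theta> \<circ> \<phi>) x"

text \<open>The affine map of standard simplices induced by \<open>\<theta>\<close>, in barycentric coordinates.\<close>

definition simplex_push :: "nat \<Rightarrow> (nat \<Rightarrow> nat) \<Rightarrow> (nat \<Rightarrow> real) \<Rightarrow> nat \<Rightarrow> real" where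
  "simplex_push m \<theta> t = (\<lambda>j. \<Sum>i | i \<le> m \<and> \<theta> i = j. t i)"

text \<open>The disjoint union of a copy \<open>{(n, x)} \<times> \<Delta>\<^sup>n\<close> of the standard simplex for each
  \<open>n\<close>-simplex \<open>x\<close>.\<close>

definition cell_space :: "'a sset \<Rightarrow> ((nat \<times> 'a) \<times> (nat \<Rightarrow> real)) topology" where
  "cell_space K =
     sum_topology (\<lambda>(n, x). subtopology (powertop_real UNIV) (standard_simplex n))
       (SIGMA n:UNIV. simplices K n)"

inductive cell_glue ::
  "'a sset \<Rightarrow> (nat \<times> 'a) \<times> (nat \<Rightarrow> real) \<Rightarrow> (nat \<times> 'a) \<times> (nat \<Rightarrow> real) \<Rightarrow> bool"
  for K where
  "\<theta> \<in> simplex_maps m n \<Longrightarrow> x \<in> simplices K n \<Longrightarrow> t \<in> standard_simplex m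
     \<Longrightarrow> cell_glue K ((m, sact K m n \<theta> x), t) ((n, x), simplex_push m \<theta> t)"

definition cell_rel ::
  "'a sset \<Rightarrow> (((nat \<times> 'a) \<times> (nat \<Rightarrow> real)) \<times> ((nat \<times> 'a) \<times> (nat \<Rightarrow> real))) set" where
  "cell_rel K = {(p, q). equivclp (cell_glue K) p q}"

definition geometric_realization ::
  "'a sset \<Rightarrow> ((nat \<times> 'a) \<times> (nat \<Rightarrow> real)) set topology" where
  "geometric_realization K = quotient_space (cell_space K) (cell_rel K)"

definition realization_vertex :: "'a sset \<Rightarrow> 'a \<Rightarrow> ((nat \<times> 'a) \<times> (nat \<Rightarrow> real)) set" where
  "realization_vertex K v = cell_rel K `` {((0, v), \<lambda>i. if i = 0 then 1 else 0)}"

section \<open>The space \<open>B(2, G)\<close>\<close>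

text \<open>An \<open>n\<close>-simplex of the nerve is a list \<open>[g\<^sub>1, \<dots>, g\<^sub>n]\<close>, the list entry with index \<open>k\<close>
  being the edge from vertex \<open>k\<close> to vertex \<open>k + 1\<close>. The entry with index \<open>i\<close> of the pullback
  along \<open>\<theta>\<close> is the product of the edges from vertex \<open>\<theta> i\<close> to vertex \<open>\<theta> (i + 1)\<close>, so inner
  faces multiply adjacent entries, outer faces drop an entry, and degeneracies insert \<open>\<one>\<close>.\<close>

definition list_mult :: "('a, 'b) monoid_scheme \<Rightarrow> 'a list \<Rightarrow> 'a" where
  "list_mult G xs = foldr (monoid.mult G) xs \<one>\<^bsub>G\<^esub>"

definition nerve :: "('a, 'b) monoid_scheme \<Rightarrow> 'a list sset" where
  "nerve G =
     \<lparr>simplices = (\<lambda>n. {xs. length xs = n \<and> set xs \<subseteq> carrier G}),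
      sact = (\<lambda>m n \<theta> xs. map (\<lambda>i. list_mult G (map (nth xs) [\<theta> i..<\<theta> (Suc i)])) [0..<m])\<rparr>"

definition commuting_nerve :: "('a, 'b) monoid_scheme \<Rightarrow> 'a list sset" where
  "commuting_nerve G =
     (nerve G)\<lparr>simplices := (\<lambda>n. {xs \<in> simplices (nerve G) n.
        \<forall>x\<in>set xs. \<forall>y\<in>set xs. x \<otimes>\<^bsub>G\<^esub> y = y \<otimes>\<^bsub>G\<^esub> x})\<rparr>"

definition B2 :: "('a, 'b) monoid_scheme \<Rightarrow> ((nat \<times> 'a list) \<times> (nat \<Rightarrow> real)) set topology" where
  "B2 G = geometric_realization (commuting_nerve G)"

text \<open>The only vertex of \<open>B(2, G)\<close> is given by the empty tuple.\<close>

definition B2_point :: "('a, 'b) monoid_scheme \<Rightarrow> ((nat \<times> 'a list) \<times> (nat \<Rightarrow> real)) set" where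
  "B2_point G = realization_vertex (commuting_nerve G) []"

context monoid
begin

lemma list_mult_closed: "set xs \<subseteq> carrier G \<Longrightarrow> list_mult G xs \<in> carrier G"
  by (induction xs) (auto simp: list_mult_def)

lemma list_mult_append:
  "set xs \<subseteq> carrier G \<Longrightarrow> set ys \<subseteq> carrier G
     \<Longrightarrow> list_mult G (xs @ ys) = list_mult G xs \<otimes> list_mult G ys"
proof (induction xs)
  case Nil
  then show ?case using list_mult_closed[of ys] by (simp add: list_mult_def)
next
  case (Cons a xs)
  then show ?case
    using list_mult_closed[of ys] list_mult_closed[of xs] by (simp add: list_mult_def m_assoc)
qed

lemma list_mult_commute:
  assumes "set xs \<subseteq> carrier G" "c \<in> carrier G" "\<And>x. x \<in> set xs \<Longrightarrow> x \<otimes> c = c \<otimes> x"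
  shows "list_mult G xs \<otimes> c = c \<otimes> list_mult G xs"
  using assms
proof (induction xs)
  case Nil
  then show ?case by (simp add: list_mult_def)
next
  case (Cons a xs)
  have l: "list_mult G (a # xs) = a \<otimes> list_mult G xs" by (simp add: list_mult_def)
  have c: "a \<in> carrier G" "list_mult G xs \<in> carrier G"
    using Cons.prems list_mult_closed[of xs] by auto
  have "a \<otimes> list_mult G xs \<otimes> c = a \<otimes> (c \<otimes> list_mult G xs)"
    using Cons c by (simp add: m_assoc)
  also have "\<dots> = c \<otimes> (a \<otimes> list_mult G xs)"
    using Cons.prems c by (simp flip: m_assoc)
  finally show ?case using l by simp
qed

lemma list_mult_segments:
  assumes "mono_on {..b} \<theta>" "a \<le> b" "\<And>k. \<theta> a \<le> k \<Longrightarrow> k < \<theta> b \<Longrightarrow> f k \<in> carrier G"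
  shows "list_mult G (map (\<lambda>i. list_mult G (map f [\<theta> i..<\<theta> (Suc i)])) [a..<b]) =
         list_mult G (map f [\<theta> a..<\<theta> b])"
  using assms(2,1,3)
proof (induction b rule: dec_induct)
  case base
  then show ?case by (simp add: list_mult_def)
next
  case (step b)
  have m: "\<theta> i \<le> \<theta> j" if "i \<le> j" "j \<le> Suc b" for i j
    using step.prems(1) that by (auto simp: mono_on_def)
  have ab: "\<theta> a \<le> \<theta> b" "\<theta> b \<le> \<theta> (Suc b)" using m step.hyps by auto
  have IH: "list_mult G (map (\<lambda>i. list_mult G (map f [\<theta> i..<\<theta> (Suc i)])) [a..<b]) =
         list_mult G (map f [\<theta> a..<\<theta> b])"
    using step.IH step.prems ab by (auto simp: mono_on_def)
  have sub: "set (map f [\<theta> i..<\<theta> j]) \<subseteq> carrier G" if "a \<le> i" "i \<le> j" "j \<le> Suc b" for i j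
    using step.prems(2) m[of a i] m[of j "Suc b"] that by auto
  have 1: "set (map (\<lambda>i. list_mult G (map f [\<theta> i..<\<theta> (Suc i)])) [a..<b]) \<subseteq> carrier G"
    using list_mult_closed[OF sub] by auto
  have 2: "list_mult G (map f [\<theta> b..<\<theta> (Suc b)]) \<in> carrier G"
    using list_mult_closed[OF sub[of b "Suc b"]] step.hyps by auto
  have "list_mult G (map (\<lambda>i. list_mult G (map f [\<theta> i..<\<theta> (Suc i)])) [a..<Suc b]) =
     list_mult G (map f [\<theta> a..<\<theta> b]) \<otimes> list_mult G (map f [\<theta> b..<\<theta> (Suc b)])"
    using step.hyps 1 2 IH by (simp add: list_mult_append) (simp add: list_mult_def)
  also have "\<dots> = list_mult G (map f ([\<theta> a..<\<theta> b] @ [\<theta> b..<\<theta> (Suc b)]))"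
    using sub[of a b] sub[of b "Suc b"] step.hyps by (simp add: list_mult_append)
  also have "[\<theta> a..<\<theta> b] @ [\<theta> b..<\<theta> (Suc b)] = [\<theta> a..<\<theta> (Suc b)]"
    using ab upt_add_eq_append[of "\<theta> a" "\<theta> b" "\<theta> (Suc b) - \<theta> b"] by simp
  finally show ?case .
qed

lemma simplicial_set_commuting_nerve: "simplicial_set (commuting_nerve G)"
proof
  fix \<theta> m n x
  assume t: "\<theta> \<in> simplex_maps m n" and x: "x \<in> simplices (commuting_nerve G) n"
  have len: "length x = n" and xc: "set x \<subseteq> carrier G"
    and com: "\<And>a b. a \<in> set x \<Longrightarrow> b \<in> set x \<Longrightarrow> a \<otimes> b = b \<otimes> a"
    using x by (auto simp: commuting_nerve_def nerve_def)
  have tn: "\<theta> i \<le> n" if "i \<le> m" for i using t that by (auto simp: simplex_maps_def)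
  have sub: "set (map (nth x) [\<theta> i..<\<theta> (Suc i)]) \<subseteq> set x" if "i < m" for i
    using tn[of "Suc i"] that len by auto
  have cl: "list_mult G (map (nth x) [\<theta> i..<\<theta> (Suc i)]) \<in> carrier G" if "i < m" for i
    using sub[OF that] xc by (intro list_mult_closed) blast
  have c1: "list_mult G (map (nth x) [\<theta> i..<\<theta> (Suc i)]) \<otimes> c =
     c \<otimes> list_mult G (map (nth x) [\<theta> i..<\<theta> (Suc i)])" if "i < m" "c \<in> set x" for i c
    using sub[OF that(1)] that xc com by (intro list_mult_commute) blast+
  have "list_mult G (map (nth x) [\<theta> i..<\<theta> (Suc i)]) \<otimes> list_mult G (map (nth x) [\<theta> j..<\<theta> (Suc j)]) =
     list_mult G (map (nth x) [\<theta> j..<\<theta> (Suc j)]) \<otimes> list_mult G (map (nth x) [\<theta> i..<\<theta> (Suc i)])"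
    if "i < m" "j < m" for i j
    using sub[OF that(1)] sub[OF that(2)] cl[OF that(2)] c1[OF that(2)] xc
    by (intro list_mult_commute) (blast, blast, metis subsetD)
  then show "sact (commuting_nerve G) m n \<theta> x \<in> simplices (commuting_nerve G) m"
    using cl by (auto simp: commuting_nerve_def nerve_def)
next
  fix \<theta> \<theta>' :: "nat \<Rightarrow> nat" and m n :: nat and x
  assume "\<And>i. i \<le> m \<Longrightarrow> \<theta> i = \<theta>' i"
  then show "sact (commuting_nerve G) m n \<theta> x = sact (commuting_nerve G) m n \<theta>' x"
    by (auto simp: commuting_nerve_def nerve_def)
next
  fix x n assume x: "x \<in> simplices (commuting_nerve G) n"
  have len: "length x = n" and xc: "set x \<subseteq> carrier G"
    using x by (auto simp: commuting_nerve_def nerve_def)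
  have "list_mult G [x ! i] = x ! i" if "i < n" for i
    using that len xc nth_mem[of i x] by (simp add: list_mult_def subset_iff)
  then show "sact (commuting_nerve G) n n id x = x"
    using len by (auto simp: commuting_nerve_def nerve_def intro!: nth_equalityI)
next
  fix \<phi> l m \<theta> n x
  assume p: "\<phi> \<in> simplex_maps l m" and t: "\<theta> \<in> simplex_maps m n"
    and x: "x \<in> simplices (commuting_nerve G) n"
  have len: "length x = n" and xc: "set x \<subseteq> carrier G"
    using x by (auto simp: commuting_nerve_def nerve_def)
  let ?g = "\<lambda>i. list_mult G (map (nth x) [\<theta> i..<\<theta> (Suc i)])"
  have "list_mult G (map (nth (map ?g [0..<m])) [\<phi> i..<\<phi> (Suc i)]) =
        list_mult G (map (nth x) [\<theta> (\<phi> i)..<\<theta> (\<phi> (Suc i))])" if "i < l" for i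
  proof -
    have pm: "\<phi> (Suc i) \<le> m" using p that by (auto simp: simplex_maps_def image_subset_iff)
    have pi: "\<phi> i \<le> \<phi> (Suc i)" using p that by (auto simp: simplex_maps_def mono_on_def)
    have e: "map (nth (map ?g [0..<m])) [\<phi> i..<\<phi> (Suc i)] = map ?g [\<phi> i..<\<phi> (Suc i)]"
      using pm by auto
    have m: "mono_on {..\<phi> (Suc i)} \<theta>"
      using t pm by (auto simp: simplex_maps_def mono_on_def)
    have "\<theta> (\<phi> (Suc i)) \<le> n" using t pm by (auto simp: simplex_maps_def image_subset_iff)
    then have "x ! k \<in> carrier G" if "k < \<theta> (\<phi> (Suc i))" for k
      using xc len that by (simp add: subset_iff)
    then show ?thesis
      unfolding e by (intro list_mult_segments[OF m pi]) blast
  qed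
  then show "sact (commuting_nerve G) l m \<phi> (sact (commuting_nerve G) m n \<theta> x) =
             sact (commuting_nerve G) l n (\<theta> \<circ> \<phi>) x"
    by (auto simp: commuting_nerve_def nerve_def)
qed

end

section \<open>Colimits of groups\<close>

text \<open>The colimit of the groups \<open>F i\<close>, \<open>i \<in> I\<close>, along homomorphisms \<open>f i j\<close> for \<open>dle i j\<close>:
  words in the letters \<open>(i, x)\<close> with \<open>x \<in> F i\<close>, modulo the congruence generated by the
  multiplication of each \<open>F i\<close> and by \<open>(i, x) \<sim> (j, f i j x)\<close>. The universal property is
  \<open>group_colimit_universal\<close> below.\<close>

inductive colimit_step ::
  "'i set \<Rightarrow> ('i \<Rightarrow> 'i \<Rightarrow> bool) \<Rightarrow> ('i \<Rightarrow> ('a, 'b) monoid_scheme) \<Rightarrow> ('i \<Rightarrow> 'i \<Rightarrow> 'a \<Rightarrow> 'a)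
     \<Rightarrow> ('i \<times> 'a) list \<Rightarrow> ('i \<times> 'a) list \<Rightarrow> bool"
  for I dle F f where
  step_mult: "i \<in> I \<Longrightarrow> x \<in> carrier (F i) \<Longrightarrow> y \<in> carrier (F i)
     \<Longrightarrow> colimit_step I dle F f (u @ [(i, x), (i, y)] @ v) (u @ [(i, x \<otimes>\<^bsub>F i\<^esub> y)] @ v)"
| step_one: "i \<in> I \<Longrightarrow> colimit_step I dle F f (u @ [(i, \<one>\<^bsub>F i\<^esub>)] @ v) (u @ v)"
| step_map: "i \<in> I \<Longrightarrow> j \<in> I \<Longrightarrow> dle i j \<Longrightarrow> x \<in> carrier (F i)
     \<Longrightarrow> colimit_step I dle F f (u @ [(i, x)] @ v) (u @ [(j, f i j x)] @ v)"

definition colimit_rel where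
  "colimit_rel I dle F f = {(u, v). equivclp (colimit_step I dle F f) u v}"

definition group_colimit ::
  "'i set \<Rightarrow> ('i \<Rightarrow> 'i \<Rightarrow> bool) \<Rightarrow> ('i \<Rightarrow> ('a, 'b) monoid_scheme) \<Rightarrow> ('i \<Rightarrow> 'i \<Rightarrow> 'a \<Rightarrow> 'a)
     \<Rightarrow> ('i \<times> 'a) list set monoid" where
  "group_colimit I dle F f =
     \<lparr>carrier = lists (SIGMA i:I. carrier (F i)) // colimit_rel I dle F f,
      monoid.mult = (\<lambda>P Q. \<Union>u\<in>P. \<Union>v\<in>Q. colimit_rel I dle F f `` {u @ v}),
      one = colimit_rel I dle F f `` {[]}\<rparr>"

definition colimit_inj ::
  "'i set \<Rightarrow> ('i \<Rightarrow> 'i \<Rightarrow> bool) \<Rightarrow> ('i \<Rightarrow> ('a, 'b) monoid_scheme) \<Rightarrow> ('i \<Rightarrow> 'i \<Rightarrow> 'a \<Rightarrow> 'a)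
     \<Rightarrow> 'i \<Rightarrow> 'a \<Rightarrow> ('i \<times> 'a) list set" where
  "colimit_inj I dle F f i x = colimit_rel I dle F f `` {[(i, x)]}"

locale group_diagram =
  fixes I :: "'i set" and dle :: "'i \<Rightarrow> 'i \<Rightarrow> bool"
    and F :: "'i \<Rightarrow> ('a, 'b) monoid_scheme" and f :: "'i \<Rightarrow> 'i \<Rightarrow> 'a \<Rightarrow> 'a"
  assumes group_F: "i \<in> I \<Longrightarrow> group (F i)"
    and hom_f: "i \<in> I \<Longrightarrow> j \<in> I \<Longrightarrow> dle i j \<Longrightarrow> f i j \<in> hom (F i) (F j)"
begin

abbreviation words where "words \<equiv> lists (SIGMA i:I. carrier (F i))"
abbreviation R where "R \<equiv> colimit_rel I dle F f"
abbreviation C where "C \<equiv> group_colimit I dle F f"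

lemma equiv_R: "equiv UNIV R"
  unfolding colimit_rel_def
  by (intro equivI) (auto simp: refl_on_def sym_def trans_def
      intro: equivclp_refl equivclp_sym equivclp_trans)

lemma R_eq: "R `` {u} = R `` {v} \<longleftrightarrow> (u, v) \<in> R"
  using equiv_class_eq_iff[OF equiv_R] by auto

lemma R_induct [consumes 1, case_names refl step sym trans]:
  assumes "(u, v) \<in> R" "\<And>u. P u u" "\<And>u v. colimit_step I dle F f u v \<Longrightarrow> P u v"
    "\<And>u v. P u v \<Longrightarrow> P v u" "\<And>u v w. P u v \<Longrightarrow> P v w \<Longrightarrow> P u w"
  shows "P u v"
proof -
  have "equivclp (colimit_step I dle F f) u v" using assms(1) by (simp add: colimit_rel_def)
  then show ?thesis
    by (induction rule: equivclp_induct) (use assms in blast)+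
qed

lemma step_R: "colimit_step I dle F f u v \<Longrightarrow> (u, v) \<in> R"
  by (auto simp: colimit_rel_def intro: r_into_equivclp)

lemma R_sym: "(u, v) \<in> R \<Longrightarrow> (v, u) \<in> R"
  using equiv_R by (auto simp: equiv_def sym_def)

lemma R_trans: "(u, v) \<in> R \<Longrightarrow> (v, w) \<in> R \<Longrightarrow> (u, w) \<in> R"
  using equiv_R by (auto simp: equiv_def trans_def)

lemma R_refl: "(u, u) \<in> R"
  using equiv_R by (auto simp: equiv_def refl_on_def)

lemma step_words: "colimit_step I dle F f u v \<Longrightarrow> u \<in> words \<longleftrightarrow> v \<in> words"
proof (induction rule: colimit_step.induct)
  case (step_mult i x y u v)
  then show ?case using monoid.m_closed[OF group.is_monoid[OF group_F]] by auto
next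
  case (step_one i u v)
  then show ?case using monoid.one_closed[OF group.is_monoid[OF group_F]] by auto
next
  case (step_map i j x u v)
  then show ?case using hom_f[of i j] by (auto simp: hom_def)
qed

lemma R_words: "(u, v) \<in> R \<Longrightarrow> u \<in> words \<longleftrightarrow> v \<in> words"
  by (induction rule: R_induct) (use step_words in blast)+

lemma step_context: "colimit_step I dle F f u v \<Longrightarrow> colimit_step I dle F f (a @ u @ b) (a @ v @ b)"
proof (induction rule: colimit_step.induct)
  case (step_mult i x y u v)
  then show ?case
    using colimit_step.step_mult[of i I x F y dle f "a @ u" "v @ b"] by simp
next
  case (step_one i u v)
  then show ?case using colimit_step.step_one[of i I dle F f "a @ u" "v @ b"] by simp
next
  case (step_map i j x u v)
  then show ?case using colimit_step.step_map[of i I j dle x F f "a @ u" "v @ b"] by simp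
qed

lemma R_context: "(u, v) \<in> R \<Longrightarrow> (a @ u @ b, a @ v @ b) \<in> R"
  by (induction rule: R_induct) (use R_refl R_sym R_trans step_R step_context in blast)+

lemma R_append: "(u, u') \<in> R \<Longrightarrow> (v, v') \<in> R \<Longrightarrow> (u @ v, u' @ v') \<in> R"
  using R_context[of u u' "[]" v] R_context[of v v' u' "[]"] by (auto intro: R_trans)

lemma mult_C: "R `` {u} \<otimes>\<^bsub>C\<^esub> R `` {v} = R `` {u @ v}"
proof -
  have "R `` {u' @ v'} = R `` {u @ v}" if "u' \<in> R `` {u}" "v' \<in> R `` {v}" for u' v'
  proof -
    have "(u' @ v', u @ v) \<in> R" using that by (intro R_sym[OF R_append]) simp_all
    then show ?thesis by (simp only: R_eq)
  qed
  then have "(\<Union>u'\<in>R `` {u}. \<Union>v'\<in>R `` {v}. R `` {u' @ v'}) =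
      (\<Union>u'\<in>R `` {u}. \<Union>v'\<in>R `` {v}. R `` {u @ v})"
    by (intro SUP_cong refl) blast
  also have "\<dots> = R `` {u @ v}"
    using R_refl[of u] R_refl[of v] by blast
  finally show ?thesis by (simp add: group_colimit_def)
qed

lemma carrier_C: "w \<in> carrier C \<longleftrightarrow> (\<exists>u\<in>words. w = R `` {u})"
  by (auto simp: group_colimit_def quotient_def)

lemma class_in_C: "u \<in> words \<Longrightarrow> R `` {u} \<in> carrier C"
  unfolding carrier_C by blast

lemma one_C: "\<one>\<^bsub>C\<^esub> = R `` {[]}"
  by (simp add: group_colimit_def)

lemma word_inverse: "u \<in> words \<Longrightarrow> \<exists>v\<in>words. (v @ u, []) \<in> R"
proof (induction u)
  case Nil
  then show ?case using R_refl by auto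
next
  case (Cons a u)
  obtain i x where a: "a = (i, x)" by fastforce
  have ix: "i \<in> I" "x \<in> carrier (F i)" using Cons.prems a by auto
  interpret Fi: group "F i" using group_F ix by auto
  obtain v where v: "v \<in> words" "(v @ u, []) \<in> R" using Cons by auto
  let ?y = "(i, inv\<^bsub>F i\<^esub> x)"
  have "(v @ [?y, (i, x)] @ u, v @ [(i, \<one>\<^bsub>F i\<^esub>)] @ u) \<in> R"
    using step_R[OF step_mult[of i I "inv\<^bsub>F i\<^esub> x" F x dle f v u]] ix by simp
  moreover have "(v @ [(i, \<one>\<^bsub>F i\<^esub>)] @ u, v @ u) \<in> R" using step_R[OF step_one[of i I dle F f v u]] ix by simp
  ultimately have "((v @ [?y]) @ a # u, []) \<in> R" using v(2) by (auto simp: a intro: R_trans)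
  moreover have "v @ [?y] \<in> words" using v ix by auto
  ultimately show ?case by blast
qed

lemma group_group_colimit: "group C"
proof (rule groupI)
  fix x y assume "x \<in> carrier C" "y \<in> carrier C"
  then obtain u v where "u \<in> words" "x = R `` {u}" "v \<in> words" "y = R `` {v}"
    unfolding carrier_C by blast
  moreover from this have "u @ v \<in> words" by simp
  ultimately show "x \<otimes>\<^bsub>C\<^esub> y \<in> carrier C" unfolding carrier_C by (metis mult_C)
next
  show "\<one>\<^bsub>C\<^esub> \<in> carrier C" by (auto simp: carrier_C one_C)
next
  fix x y z assume "x \<in> carrier C" "y \<in> carrier C" "z \<in> carrier C"
  then show "x \<otimes>\<^bsub>C\<^esub> y \<otimes>\<^bsub>C\<^esub> z = x \<otimes>\<^bsub>C\<^esub> (y \<otimes>\<^bsub>C\<^esub> z)" by (auto simp: carrier_C mult_C)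
next
  fix x assume "x \<in> carrier C"
  then show "\<one>\<^bsub>C\<^esub> \<otimes>\<^bsub>C\<^esub> x = x" by (auto simp: carrier_C mult_C one_C)
next
  fix x assume "x \<in> carrier C"
  then obtain u where u: "u \<in> words" "x = R `` {u}" by (auto simp: carrier_C)
  obtain v where v: "v \<in> words" "(v @ u, []) \<in> R" using word_inverse[OF u(1)] by auto
  have "R `` {v} \<otimes>\<^bsub>C\<^esub> x = \<one>\<^bsub>C\<^esub>" using u v by (simp add: mult_C one_C R_eq)
  then show "\<exists>y\<in>carrier C. y \<otimes>\<^bsub>C\<^esub> x = \<one>\<^bsub>C\<^esub>" using class_in_C[OF v(1)] by (rule bexI)
qed

lemma colimit_inj_hom: "i \<in> I \<Longrightarrow> colimit_inj I dle F f i \<in> hom (F i) C"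
  using step_R[OF step_mult[of i I _ F _ dle f "[]" "[]"]] R_sym
  by (auto simp: hom_def colimit_inj_def mult_C R_eq intro!: class_in_C)

lemma colimit_inj_compat:
  "i \<in> I \<Longrightarrow> j \<in> I \<Longrightarrow> dle i j \<Longrightarrow> x \<in> carrier (F i)
     \<Longrightarrow> colimit_inj I dle F f j (f i j x) = colimit_inj I dle F f i x"
  using step_R[OF step_map[of i I j dle x F f "[]" "[]"]] R_sym
  by (auto simp: colimit_inj_def R_eq)

theorem group_colimit_universal:
  fixes H :: "('c, 'd) monoid_scheme"
  assumes H: "group H" and g: "\<And>i. i \<in> I \<Longrightarrow> g i \<in> hom (F i) H"
    and compat: "\<And>i j x. i \<in> I \<Longrightarrow> j \<in> I \<Longrightarrow> dle i j \<Longrightarrow> x \<in> carrier (F i) \<Longrightarrow> g j (f i j x) = g i x"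
  shows "\<exists>h\<in>hom C H. (\<forall>i\<in>I. \<forall>x\<in>carrier (F i). h (colimit_inj I dle F f i x) = g i x) \<and>
     (\<forall>h'\<in>hom C H. (\<forall>i\<in>I. \<forall>x\<in>carrier (F i). h' (colimit_inj I dle F f i x) = g i x)
        \<longrightarrow> (\<forall>w\<in>carrier C. h' w = h w))"
proof -
  interpret H: group H by (rule H)
  define ev where "ev u = list_mult H (map (\<lambda>(i, x). g i x) u)" for u
  have letter: "g i x \<in> carrier H" if "i \<in> I" "x \<in> carrier (F i)" for i x
    using g[OF that(1)] that(2) by (auto simp: hom_def)
  have sub: "set (map (\<lambda>(i, x). g i x) u) \<subseteq> carrier H" if "u \<in> words" for u
    using that letter by auto
  have ev_app: "ev (u @ v) = ev u \<otimes>\<^bsub>H\<^esub> ev v" if "u \<in> words" "v \<in> words" for u v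
    using H.list_mult_append[OF sub[OF that(1)] sub[OF that(2)]] by (simp add: ev_def)
  have ev_cl: "ev u \<in> carrier H" if "u \<in> words" for u
    using H.list_mult_closed[OF sub[OF that]] by (simp add: ev_def)
  have ev1: "ev [(i, x)] = g i x" if "i \<in> I" "x \<in> carrier (F i)" for i x
    using letter[OF that] by (simp add: ev_def list_mult_def)
  have ev_step: "ev u = ev v" if "colimit_step I dle F f u v" "u \<in> words" for u v
    using that
  proof (induction rule: colimit_step.induct)
    case (step_mult i x y u v)
    interpret Fi: group "F i" using group_F step_mult by auto
    have w: "u \<in> words" "v \<in> words" "[(i, x), (i, y)] \<in> words" "[(i, x \<otimes>\<^bsub>F i\<^esub> y)] \<in> words"
      using step_mult by auto
    have "ev [(i, x), (i, y)] = ev [(i, x \<otimes>\<^bsub>F i\<^esub> y)]"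
      using step_mult g[of i] letter ev1
      by (simp add: hom_mult) (simp add: ev_def list_mult_def)
    then show ?case using w by (simp only: ev_app append_in_lists_conv)
  next
    case (step_one i u v)
    interpret Fi: group "F i" using group_F step_one by auto
    have w: "u \<in> words" "v \<in> words" "[(i, \<one>\<^bsub>F i\<^esub>)] \<in> words" using step_one by auto
    have "ev [(i, \<one>\<^bsub>F i\<^esub>)] = \<one>\<^bsub>H\<^esub>"
      using step_one g[of i] ev1 hom_one[OF g[of i] Fi.is_group H] by simp
    then show ?case using w ev_cl by (simp only: ev_app append_in_lists_conv H.l_one)
  next
    case (step_map i j x u v)
    have c: "f i j x \<in> carrier (F j)" using hom_f[of i j] step_map by (auto simp: hom_def)
    have w: "u \<in> words" "v \<in> words" "[(i, x)] \<in> words" "[(j, f i j x)] \<in> words"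
      using step_map c by auto
    have "ev [(i, x)] = ev [(j, f i j x)]" using step_map c ev1 compat by simp
    then show ?case using w by (simp only: ev_app append_in_lists_conv)
  qed
  have ev_R: "u \<in> words \<longrightarrow> ev u = ev v" if "(u, v) \<in> R" for u v
  proof -
    have "(u \<in> words \<longleftrightarrow> v \<in> words) \<and> (u \<in> words \<longrightarrow> ev u = ev v)"
      using that
    proof (induction rule: R_induct)
      case (step u v)
      then show ?case using ev_step step_words by blast
    qed auto
    then show ?thesis by blast
  qed
  define h where "h w = ev (SOME u. u \<in> w)" for w
  have h: "h (R `` {u}) = ev u" if "u \<in> words" for u
  proof -
    have "u \<in> R `` {u}" using R_refl by auto
    then have "(SOME v. v \<in> R `` {u}) \<in> R `` {u}" by (rule someI)
    then show ?thesis using ev_R that by (auto simp: h_def)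
  qed
  have app: "u @ v \<in> words" if "u \<in> words" "v \<in> words" for u v using that by auto
  have hh: "h \<in> hom C H"
  proof (rule homI)
    fix x assume "x \<in> carrier C"
    then obtain u where "u \<in> words" "x = R `` {u}" unfolding carrier_C by blast
    then show "h x \<in> carrier H" using h ev_cl by simp
  next
    fix x y assume "x \<in> carrier C" "y \<in> carrier C"
    then obtain u v where "u \<in> words" "x = R `` {u}" "v \<in> words" "y = R `` {v}"
      unfolding carrier_C by blast
    then show "h (x \<otimes>\<^bsub>C\<^esub> y) = h x \<otimes>\<^bsub>H\<^esub> h y"
      using h[OF app] h ev_app by (simp only: mult_C)
  qed
  have hi: "\<forall>i\<in>I. \<forall>x\<in>carrier (F i). h (colimit_inj I dle F f i x) = g i x"
    using h ev1 by (auto simp: colimit_inj_def)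
  have uniq: "h' w = h w"
    if h': "h' \<in> hom C H" "\<forall>i\<in>I. \<forall>x\<in>carrier (F i). h' (colimit_inj I dle F f i x) = g i x"
      and w: "w \<in> carrier C" for h' w
  proof -
    obtain u where u: "u \<in> words" "w = R `` {u}" using w unfolding carrier_C by blast
    have "h' (R `` {u}) = ev u" using u(1)
    proof (induction u rule: list.induct)
      case Nil
      have "h' \<one>\<^bsub>C\<^esub> = \<one>\<^bsub>H\<^esub>" using hom_one[OF h'(1) group_group_colimit H] .
      then show ?case by (simp add: one_C ev_def list_mult_def)
    next
      case (Cons a u)
      obtain i x where a: "a = (i, x)" by fastforce
      have ix: "i \<in> I" "x \<in> carrier (F i)" "u \<in> words" "[a] \<in> words" using Cons.prems a by auto
      have cc: "R `` {[a]} \<in> carrier C" "R `` {u} \<in> carrier C" using ix class_in_C by blast+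
      have "h' (R `` {a # u}) = h' (R `` {[a]} \<otimes>\<^bsub>C\<^esub> R `` {u})" by (simp add: mult_C)
      also have "\<dots> = h' (R `` {[a]}) \<otimes>\<^bsub>H\<^esub> h' (R `` {u})" using hom_mult[OF h'(1)] cc by simp
      also have "\<dots> = ev [a] \<otimes>\<^bsub>H\<^esub> ev u"
        using h'(2) ix ev1 a Cons.IH by (simp add: colimit_inj_def)
      also have "\<dots> = ev (a # u)" using ev_app[OF ix(4,3)] by simp
      finally show ?case .
    qed
    then show ?thesis using u h by simp
  qed
  show ?thesis using hh hi uniq by blast
qed

end

definition abelian_subgroups :: "('a, 'b) monoid_scheme \<Rightarrow> 'a set set" where
  "abelian_subgroups G = {A. subgroup A G \<and> comm_group (G\<lparr>carrier := A\<rparr>)}"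

definition abelian_colimit :: "('a, 'b) monoid_scheme \<Rightarrow> ('a set \<times> 'a) list set monoid" where
  "abelian_colimit G =
     group_colimit (abelian_subgroups G) (\<subseteq>) (\<lambda>A. G\<lparr>carrier := A\<rparr>) (\<lambda>A B. id)"

lemma group_diagram_abelian_subgroups:
  "group_diagram (abelian_subgroups G) (\<subseteq>) (\<lambda>A. G\<lparr>carrier := A\<rparr>) (\<lambda>A B. id)"
proof (rule group_diagram.intro)
  fix A assume "A \<in> abelian_subgroups G"
  then show "group (G\<lparr>carrier := A\<rparr>)" by (simp add: abelian_subgroups_def comm_group_def)
qed (auto simp: hom_def)

section \<open>Extraspecial 2-groups\<close>

definition group_center :: "('a, 'b) monoid_scheme \<Rightarrow> 'a set" where
  "group_center G = {z \<in> carrier G. \<forall>x\<in>carrier G. z \<otimes>\<^bsub>G\<^esub> x = x \<otimes>\<^bsub>G\<^esub> z}"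

text \<open>An extension \<open>1 \<rightarrow> \<int>/2 \<rightarrow> G \<rightarrow> (\<int>/2)\<^sup>2\<^sup>n \<rightarrow> 1\<close> whose kernel is the center of \<open>G\<close>. (The
  library's \<^const>\<open>short_exact_sequence\<close> needs all three groups to have the same type.)\<close>

definition extraspecial_2_group :: "nat \<Rightarrow> ('a, 'b) monoid_scheme \<Rightarrow> bool" where
  "extraspecial_2_group n G \<longleftrightarrow>
     group G \<and>
     (\<exists>\<iota> \<pi>. \<iota> \<in> mon (integer_mod_group 2) G \<and>
            \<pi> \<in> epi G (product_group {..<2 * n} (\<lambda>_. integer_mod_group 2)) \<and>
            \<iota> ` carrier (integer_mod_group 2) =
              kernel G (product_group {..<2 * n} (\<lambda>_. integer_mod_group 2)) \<pi> \<and>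
            \<iota> ` carrier (integer_mod_group 2) = group_center G)"

lemma order_extraspecial_2_group:
  assumes "extraspecial_2_group n G"
  shows "order G = 2 ^ (2 * n + 1)"
proof -
  let ?Z = "integer_mod_group 2" and ?E = "product_group {..<2 * n} (\<lambda>_. integer_mod_group 2)"
  obtain \<iota> \<pi> where G: "group G" and i: "\<iota> \<in> mon ?Z G" and p: "\<pi> \<in> epi G ?E"
    and k: "\<iota> ` carrier ?Z = kernel G ?E \<pi>"
    using assms by (auto simp: extraspecial_2_group_def)
  interpret group_hom G ?E \<pi>
    using G p by (auto simp: group_hom_def group_hom_axioms_def epi_def intro!: product_group)
  have cZ: "card (carrier ?Z) = 2" by (simp add: carrier_integer_mod_group)
  have "card (kernel G ?E \<pi>) = 2"
    using i cZ card_image[of \<iota> "carrier ?Z"] k by (simp add: mon_def)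
  moreover have "order (G Mod kernel G ?E \<pi>) = order ?E"
    using FactGroup_iso[of] p iso_same_card unfolding order_def is_iso_def epi_def
    by (metis (mono_tags, lifting) mem_Collect_eq)
  moreover have "order ?E = 2 ^ (2 * n)"
    by (simp add: order_def card_PiE cZ)
  moreover have "order (G Mod kernel G ?E \<pi>) * card (kernel G ?E \<pi>) = order G"
    using G.lagrange[OF subgroup_kernel] by (simp add: order_def FactGroup_def)
  ultimately show ?thesis by simp
qed

end

theory Submission
  imports Defs "HOL-Analysis.Abstract_Topological_Spaces" "HOL-Analysis.Lebesgue_Measure"
begin

text \<open>
  For any group \<open>G\<close> the colimit of the abelian subgroups is the universal group \<open>H\<close> with a map
  \<open>\<iota> : G \<rightarrow> H\<close> that is multiplicative on commuting pairs, and it is \<open>\<pi>\<^sub>1(B(2, G))\<close>: the edge loop of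
  \<open>g\<close> corresponds to \<open>\<iota> g\<close>, the relations being the 2-simplices.

  To see that there are no further relations, a point of \<open>B(2, G)\<close> in the cell \<open>[g\<^sub>1, \<dots>, g\<^sub>n]\<close> with
  barycentric coordinates \<open>t\<close> is read as the step function on \<open>[0, 1)\<close> with the values
  \<open>\<iota> 1, \<iota> g\<^sub>1, \<iota> (g\<^sub>1 g\<^sub>2), \<dots>\<close> on consecutive intervals of lengths \<open>t\<^sub>0, t\<^sub>1, \<dots>\<close>; it is well defined up to
  left translation by \<open>H\<close>. In the metric given by the measure of the set of disagreement, two
  different translates of a step function have distance 1, so that loops lift uniquely and have a
  monodromy in \<open>H\<close>. To see that edge loops generate, note that near a step function taking the
  value \<open>a\<close> all step functions take the value \<open>a\<close> up to translation, and that shrinking the other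
  intervals contracts this neighbourhood to the base point.

  If \<open>G\<close> is extraspecial and \<open>q g \<in> \<int>/2\<close> records whether \<open>g\<^sup>2\<close> is trivial, then \<open>q\<close> is additive on
  commuting pairs and \<open>\<iota> g \<mapsto> (g, q g)\<close> maps \<open>H\<close> onto \<open>G \<times> \<int>/2\<close>. It is injective since the defect
  \<open>\<iota> g \<iota> h (\<iota> (g h))\<inverse>\<close> is the same central involution for all noncommuting \<open>g\<close> and \<open>h\<close>.
\<close>

section \<open>Paths in abstract topological spaces\<close>

text \<open>No covering space is constructed. Of the step functions only two facts are used: the
  points having a representative near a given step function form an open set, and different
  translates of one function are far apart. They give a homomorphism from the fundamental group to
  \<open>H\<close>; the universal property of \<open>H\<close> gives one in the other direction, and
  on the generators of \<open>H\<close> their composite is the identity. So the proof rests on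
  surjectivity, that is on edge loops generating. The obstacle there is that \<open>G\<close> may be
  infinite and that the realization carries a quotient topology, so that no small neighbourhood of a
  point is given in advance. A ball on which the step functions keep one value is contracted along
  straight lines of the cells into faces whose vertices have the same label in \<open>H\<close>. As
  \<iota> is injective, because the identity of \<open>G\<close> factors through the colimit, these
  labels agree in \<open>G\<close>, and such a face is a degenerate simplex sitting at the base
  point. The condition \<open>n \<ge> 2\<close> enters once: in an extraspecial group of order
  greater than 8 the common centraliser of two elements exceeds the centre.\<close>

lemma continuous_map_top_of_set_compose:
  assumes "continuous_map (top_of_set T) X f" "continuous_on S g" "g \<in> S \<rightarrow> T"
  shows "continuous_map (top_of_set S) X (\<lambda>x. f (g x))"
proof -
  have "continuous_map (top_of_set S) (top_of_set T) g" using assms by simp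
  from continuous_map_compose[OF this assms(1)] show ?thesis by (simp add: o_def)
qed

lemma continuous_map_top_of_set_paste:
  fixes p :: "'a::topological_space \<Rightarrow> real"
  assumes "continuous_on S p" "continuous_map (top_of_set {x \<in> S. p x \<le> c}) X f"
    "continuous_map (top_of_set {x \<in> S. c \<le> p x}) X g" "\<And>x. x \<in> S \<Longrightarrow> p x = c \<Longrightarrow> f x = g x"
  shows "continuous_map (top_of_set S) X (\<lambda>x. if p x \<le> c then f x else g x)"
  using assms
  by (intro continuous_map_cases_le) (auto simp: subtopology_subtopology Int_def)

definition path_homotopic :: "'a topology \<Rightarrow> (real \<Rightarrow> 'a) \<Rightarrow> (real \<Rightarrow> 'a) \<Rightarrow> bool" where
  "path_homotopic X p q \<longleftrightarrow>
     homotopic_with (\<lambda>r. r 0 = p 0 \<and> r 1 = p 1) (top_of_set {0..1}) X p q"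

definition path_rev :: "(real \<Rightarrow> 'a) \<Rightarrow> real \<Rightarrow> 'a" where
  "path_rev p = (\<lambda>t. p (1 - t))"

lemma path_rev_ends [simp]: "path_rev p 0 = p 1" "path_rev p 1 = p 0"
  by (simp_all add: path_rev_def)

lemma path_rev_rev [simp]: "path_rev (path_rev p) = p"
  unfolding path_rev_def by simp

lemma path_concat_ends [simp]: "path_concat p q 0 = p 0" "path_concat p q 1 = q 1"
  by (simp_all add: path_concat_def)

lemma path_homotopic_refl: "pathin X p \<Longrightarrow> path_homotopic X p p"
  by (simp add: path_homotopic_def pathin_def)

lemma path_homotopic_ends:
  assumes "path_homotopic X p q"
  shows "q 0 = p 0" "q 1 = p 1" "pathin X p" "pathin X q"
  using homotopic_with_imp_property[OF assms[unfolded path_homotopic_def]]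
    homotopic_with_imp_continuous_maps[OF assms[unfolded path_homotopic_def]]
  by (auto simp: pathin_def)

lemma path_homotopic_sym: "path_homotopic X p q \<Longrightarrow> path_homotopic X q p"
  using path_homotopic_ends[of X p q] by (simp add: path_homotopic_def homotopic_with_sym)

lemma path_homotopic_trans [trans]:
  "path_homotopic X p q \<Longrightarrow> path_homotopic X q r \<Longrightarrow> path_homotopic X p r"
  using path_homotopic_ends[of X p q] by (simp add: path_homotopic_def) (rule homotopic_with_trans)

lemma path_homotopic_eq:
  "pathin X p \<Longrightarrow> (\<And>t. 0 \<le> t \<Longrightarrow> t \<le> 1 \<Longrightarrow> p t = q t) \<Longrightarrow> path_homotopic X p q"
  unfolding path_homotopic_def pathin_def by (rule homotopic_with_equal) auto

lemma path_homotopic_iff: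
  "path_homotopic X p q \<longleftrightarrow>
     (\<exists>h. continuous_map (top_of_set ({0..1::real} \<times> {0..1::real})) X h \<and>
          (\<forall>s\<in>{0..1}. h (0, s) = p s \<and> h (1, s) = q s) \<and>
          (\<forall>t\<in>{0..1}. h (t, 0) = p 0 \<and> h (t, 1) = p 1))"
  unfolding path_homotopic_def by (subst homotopic_with) (force, simp add: ball_conj_distrib)

lemma path_homotopicE:
  assumes "path_homotopic X p q"
  obtains h where "continuous_map (top_of_set ({0..1::real} \<times> {0..1::real})) X h"
    "\<And>s. s \<in> {0..1} \<Longrightarrow> h (0, s) = p s \<and> h (1, s) = q s"
    "\<And>t. t \<in> {0..1} \<Longrightarrow> h (t, 0) = p 0 \<and> h (t, 1) = p 1"
  using assms unfolding path_homotopic_iff by blast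

lemma path_homotopic_image:
  assumes "path_homotopic Z p q" "continuous_map Z X f"
  shows "path_homotopic X (f \<circ> p) (f \<circ> q)"
  using assms(1) unfolding path_homotopic_def
  by (rule homotopic_with_compose_continuous_map_left[OF _ assms(2)]) simp

text \<open>The function \<open>m\<close> plays the role of the straight line between two points.\<close>

lemma path_homotopic_convex:
  assumes m: "continuous_map (prod_topology (top_of_set {0..1}) (prod_topology Z Z)) Z m"
    and m01: "\<And>a b. a \<in> topspace Z \<Longrightarrow> b \<in> topspace Z \<Longrightarrow> m (0, a, b) = a \<and> m (1, a, b) = b"
    and mm: "\<And>t a. a \<in> topspace Z \<Longrightarrow> t \<in> {0..1::real} \<Longrightarrow> m (t, a, a) = a"
    and p: "pathin Z p" and q: "pathin Z q" and e: "p 0 = q 0" "p 1 = q 1"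
  shows "path_homotopic Z p q"
proof -
  let ?I = "top_of_set {0..1::real}"
  have in_Z: "p s \<in> topspace Z" "q s \<in> topspace Z" if "s \<in> {0..1}" for s
    using p q that path_image_subset_topspace by fastforce+
  have c: "continuous_map (prod_topology ?I ?I) Z (m \<circ> (\<lambda>z. (fst z, p (snd z), q (snd z))))"
    using p q unfolding pathin_def
    by (intro continuous_map_compose[OF _ m] continuous_map_paired[THEN iffD2] conjI
        continuous_map_fst continuous_map_compose[OF continuous_map_snd, unfolded o_def])
  show ?thesis
    unfolding path_homotopic_iff
    using c[simplified] m01 mm in_Z e
    by (intro exI[of _ "m \<circ> (\<lambda>z. (fst z, p (snd z), q (snd z)))"]) auto
qed

text \<open>All reparametrisations used for the group laws, and the comparison of the two ways
  around a square, are images under \<open>f\<close> of straight-line homotopies in a convex set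
  \<open>C\<close>.\<close>

lemma path_homotopic_convex_set:
  fixes C :: "'b::real_normed_vector set"
  assumes "convex C" "continuous_map (top_of_set C) X f"
    "continuous_on {0..1} p" "p \<in> {0..1} \<rightarrow> C" "continuous_on {0..1} q" "q \<in> {0..1} \<rightarrow> C"
    "p 0 = q 0" "p 1 = q 1"
  shows "path_homotopic X (f \<circ> p) (f \<circ> q)"
proof (rule path_homotopic_image[OF _ assms(2)])
  have "(1 - t) *\<^sub>R a + t *\<^sub>R b \<in> C" if "a \<in> C" "b \<in> C" "0 \<le> t" "t \<le> 1" for a b and t :: real
    using that assms(1) by (simp add: convexD_alt)
  then show "path_homotopic (top_of_set C) p q"
    using assms
    by (intro path_homotopic_convex[where m="\<lambda>(t, a, b). (1 - t) *\<^sub>R a + t *\<^sub>R b"])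
      (auto simp: pathin_def case_prod_unfold intro!: continuous_intros simp flip: scaleR_left.add)
qed

lemma path_homotopic_reparam:
  assumes "pathin X p" "continuous_on {0..1} \<phi>" "\<phi> \<in> {0..1} \<rightarrow> {0..1}"
    "continuous_on {0..1} \<psi>" "\<psi> \<in> {0..1} \<rightarrow> {0..1}" "\<phi> 0 = \<psi> 0" "\<phi> 1 = \<psi> 1"
  shows "path_homotopic X (p \<circ> \<phi>) (p \<circ> \<psi>)"
  using assms by (intro path_homotopic_convex_set[where C="{0..1}"]) (auto simp: pathin_def)

lemma pathin_reparam:
  "pathin X p \<Longrightarrow> continuous_on {0..1} \<phi> \<Longrightarrow> \<phi> \<in> {0..1} \<rightarrow> {0..1} \<Longrightarrow> pathin X (\<lambda>t. p (\<phi> t))"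
  unfolding pathin_def by (rule continuous_map_top_of_set_compose)

lemma pathin_rev: "pathin X p \<Longrightarrow> pathin X (path_rev p)"
  unfolding path_rev_def by (rule pathin_reparam) (auto intro!: continuous_intros)

lemma pathin_concat:
  assumes "pathin X p" "pathin X q" "p 1 = q 0"
  shows "pathin X (path_concat p q)"
proof -
  have "p (2 * t) = q (2 * t - 1)" if "t * 2 = 1" for t
  proof -
    have "t = 1/2" using that by simp
    show ?thesis unfolding \<open>t = 1/2\<close> using assms(3) by simp
  qed
  then show ?thesis
    unfolding pathin_def path_concat_def using assms(1,2)
    by (intro continuous_map_top_of_set_paste)
      (auto simp: pathin_def field_simps intro!: continuous_intros
      continuous_map_top_of_set_compose[of "{0..1}" X p] continuous_map_top_of_set_compose[of "{0..1}" X q])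
qed

lemma path_homotopic_concat:
  assumes "path_homotopic X p p'" "path_homotopic X q q'" "p 1 = q 0"
  shows "path_homotopic X (path_concat p q) (path_concat p' q')"
proof -
  obtain h where h: "continuous_map (top_of_set ({0..1::real} \<times> {0..1::real})) X h"
    "\<And>s. s \<in> {0..1} \<Longrightarrow> h (0, s) = p s \<and> h (1, s) = p' s"
    "\<And>t. t \<in> {0..1} \<Longrightarrow> h (t, 0) = p 0 \<and> h (t, 1) = p 1"
    by (rule path_homotopicE[OF assms(1)]) (rule that)
  obtain k where k: "continuous_map (top_of_set ({0..1::real} \<times> {0..1::real})) X k"
    "\<And>s. s \<in> {0..1} \<Longrightarrow> k (0, s) = q s \<and> k (1, s) = q' s"
    "\<And>t. t \<in> {0..1} \<Longrightarrow> k (t, 0) = q 0 \<and> k (t, 1) = q 1"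
    by (rule path_homotopicE[OF assms(2)]) (rule that)
  have half: "2 * t = 1" "2 * t - 1 = 0" if "t * 2 = 1" for t :: real using that by auto
  let ?g = "\<lambda>z. if snd z \<le> 1/2 then h (fst z, 2 * snd z) else k (fst z, 2 * snd z - 1)"
  have "continuous_map (top_of_set ({0..1} \<times> {0..1})) X ?g"
    using h(3) k(3) assms(3)
    by (intro continuous_map_top_of_set_paste continuous_map_top_of_set_compose[OF h(1)]
        continuous_map_top_of_set_compose[OF k(1)]) (auto simp: half intro!: continuous_intros)
  then show ?thesis
    unfolding path_homotopic_iff using h(2,3) k(2,3)
    by (intro exI[of _ ?g]) (auto simp: path_concat_def)
qed

lemma path_homotopic_assoc:
  assumes "pathin X p" "pathin X q" "pathin X r" "p 1 = q 0" "q 1 = r 0"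
  shows "path_homotopic X (path_concat (path_concat p q) r) (path_concat p (path_concat q r))"
proof -
  let ?w = "path_concat p (path_concat q r)"
  \<comment> \<open>\<open>?f\<close> sends 0, 1/4, 1/2, 1 to 0, 1/2, 3/4, 1, so that
    \<open>?w \<circ> ?f\<close> is the product bracketed to the left.\<close>
  let ?f = "\<lambda>t::real. if t \<le> 1/4 then 2 * t else if t \<le> 1/2 then t + 1/4 else t / 2 + 1/2"
  have w: "pathin X ?w" using assms by (intro pathin_concat) auto
  have "continuous_on {0..1} ?f"
    by (intro continuous_on_cases_le[where h="\<lambda>x. x"])
      (auto intro!: continuous_intros)
  then have 1: "path_homotopic X (?w \<circ> (\<lambda>t. t)) (?w \<circ> ?f)"
    by (intro path_homotopic_reparam[OF w]) auto
  have 2: "path_homotopic X (?w \<circ> ?f) (path_concat (path_concat p q) r)"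
  proof (rule path_homotopic_eq)
    show "pathin X (?w \<circ> ?f)" using path_homotopic_ends[OF 1] by blast
    have *: "(t * 16 - 4) / 4 = t * 4 - 1" for t :: real by simp
    have "(?w \<circ> ?f) t = path_concat (path_concat p q) r t" for t
      using assms by (auto simp: path_concat_def field_simps *)
    then show "(?w \<circ> ?f) t = path_concat (path_concat p q) r t" for t by blast
  qed
  have "?w \<circ> (\<lambda>t. t) = ?w" by (simp add: o_def)
  then show ?thesis using path_homotopic_sym[OF path_homotopic_trans[OF 1 2]] by (simp only:)
qed

lemma path_homotopic_const_left:
  assumes "pathin X p"
  shows "path_homotopic X (path_concat (\<lambda>_. p 0) p) p"
proof -
  let ?f = "\<lambda>t::real. if t \<le> 1/2 then 0 else 2 * t - 1"
  have "continuous_on {0..1} ?f"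
    by (intro continuous_on_cases_le[where h="\<lambda>x. x"]) (auto intro!: continuous_intros)
  then have "path_homotopic X (p \<circ> ?f) (p \<circ> (\<lambda>t. t))"
    by (intro path_homotopic_reparam[OF assms]) auto
  moreover have "p \<circ> ?f = path_concat (\<lambda>_. p 0) p" by (auto simp: path_concat_def)
  ultimately show ?thesis by (simp add: o_def)
qed

text \<open>The path followed by its reverse is \<open>p\<close> composed with a folding of the
  interval that starts and ends at 0; the folding contracts to 0 within [0,1].\<close>

lemma path_homotopic_rev_right:
  assumes "pathin X p"
  shows "path_homotopic X (path_concat p (path_rev p)) (\<lambda>_. p 0)"
proof -
  let ?f = "\<lambda>t::real. if t \<le> 1/2 then 2 * t else 2 - 2 * t"
  have "continuous_on {0..1} ?f"
    by (intro continuous_on_cases_le[where h="\<lambda>x. x"]) (auto intro!: continuous_intros)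
  then have "path_homotopic X (p \<circ> ?f) (p \<circ> (\<lambda>_. 0))"
    by (intro path_homotopic_reparam[OF assms]) auto
  moreover have "p \<circ> ?f = path_concat p (path_rev p)" by (auto simp: path_concat_def path_rev_def)
  ultimately show ?thesis by (simp add: o_def)
qed

lemma path_homotopic_rev_left:
  assumes "pathin X p"
  shows "path_homotopic X (path_concat (path_rev p) p) (\<lambda>_. p 1)"
  using path_homotopic_rev_right[OF pathin_rev[OF assms]] by (simp only: path_rev_rev path_rev_ends)

section \<open>The fundamental group\<close>

lemma loop_class_eq:
  assumes "p 0 = x0" "p 1 = x0"
  shows "loop_class X x0 p = {q. path_homotopic X p q}"
  using assms by (simp add: loop_class_def path_homotopic_def)

lemma loop_class_eq_iff:
  assumes "loop_in X x0 p" "loop_in X x0 q"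
  shows "loop_class X x0 p = loop_class X x0 q \<longleftrightarrow> path_homotopic X p q"
proof
  assume e: "loop_class X x0 p = loop_class X x0 q"
  have "q \<in> loop_class X x0 q"
    using assms path_homotopic_refl[of X q] by (simp add: loop_class_eq loop_in_def)
  then have "q \<in> loop_class X x0 p" by (simp add: e)
  then show "path_homotopic X p q" using assms by (simp add: loop_class_eq loop_in_def)
next
  assume "path_homotopic X p q"
  then have "path_homotopic X p r \<longleftrightarrow> path_homotopic X q r" for r
    by (meson path_homotopic_sym path_homotopic_trans)
  then show "loop_class X x0 p = loop_class X x0 q"
    using assms by (simp add: loop_class_eq loop_in_def)
qed

lemma loop_in_concat: "loop_in X x0 p \<Longrightarrow> loop_in X x0 q \<Longrightarrow> loop_in X x0 (path_concat p q)"
  by (simp add: loop_in_def pathin_concat)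

lemma loop_in_const: "x0 \<in> topspace X \<Longrightarrow> loop_in X x0 (\<lambda>_. x0)"
  by (simp add: loop_in_def)

lemma carrier_fundamental_group:
  "w \<in> carrier (fundamental_group X x0) \<longleftrightarrow> (\<exists>p. loop_in X x0 p \<and> w = loop_class X x0 p)"
  by (auto simp: fundamental_group_def)

lemma one_fundamental_group: "\<one>\<^bsub>fundamental_group X x0\<^esub> = loop_class X x0 (\<lambda>_. x0)"
  by (simp add: fundamental_group_def)

text \<open>The product in \<open>fundamental_group\<close> is a union over all pairs of
  representatives; since concatenation respects homotopy, all sets in this union are the same
  class.\<close>

lemma mult_fundamental_group:
  assumes "loop_in X x0 p" "loop_in X x0 q"
  shows "loop_class X x0 p \<otimes>\<^bsub>fundamental_group X x0\<^esub> loop_class X x0 q =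
         loop_class X x0 (path_concat p q)"
proof -
  have "loop_class X x0 (path_concat p' q') = loop_class X x0 (path_concat p q)"
    if "p' \<in> loop_class X x0 p" "q' \<in> loop_class X x0 q" for p' q'
  proof -
    have h: "path_homotopic X p p'" "path_homotopic X q q'"
      using that assms by (auto simp: loop_class_eq loop_in_def)
    have l: "loop_in X x0 p'" "loop_in X x0 q'"
      using path_homotopic_ends[OF h(1)] path_homotopic_ends[OF h(2)] assms by (auto simp: loop_in_def)
    have "path_homotopic X (path_concat p q) (path_concat p' q')"
      using h assms by (intro path_homotopic_concat) (auto simp: loop_in_def)
    then show ?thesis
      using loop_class_eq_iff[OF loop_in_concat[OF assms] loop_in_concat[OF l]] by simp
  qed
  moreover have "p \<in> loop_class X x0 p" "q \<in> loop_class X x0 q"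
    using assms path_homotopic_refl[of X] by (auto simp: loop_class_eq loop_in_def)
  ultimately have "(\<Union>p'\<in>loop_class X x0 p. \<Union>q'\<in>loop_class X x0 q. loop_class X x0 (path_concat p' q'))
     = loop_class X x0 (path_concat p q)" by blast
  then show ?thesis by (simp add: fundamental_group_def)
qed

lemma group_fundamental_group:
  assumes x0: "x0 \<in> topspace X"
  shows "group (fundamental_group X x0)" (is "group ?P")
proof (rule groupI)
  fix x y assume "x \<in> carrier ?P" "y \<in> carrier ?P"
  then show "x \<otimes>\<^bsub>?P\<^esub> y \<in> carrier ?P"
    using mult_fundamental_group loop_in_concat unfolding carrier_fundamental_group by metis
next
  show "\<one>\<^bsub>?P\<^esub> \<in> carrier ?P"
    using loop_in_const[OF x0] by (auto simp: carrier_fundamental_group one_fundamental_group)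
next
  fix x y z assume "x \<in> carrier ?P" "y \<in> carrier ?P" "z \<in> carrier ?P"
  then obtain p q r where "loop_in X x0 p" "x = loop_class X x0 p" "loop_in X x0 q" "y = loop_class X x0 q"
    "loop_in X x0 r" "z = loop_class X x0 r" unfolding carrier_fundamental_group by blast
  then show "x \<otimes>\<^bsub>?P\<^esub> y \<otimes>\<^bsub>?P\<^esub> z = x \<otimes>\<^bsub>?P\<^esub> (y \<otimes>\<^bsub>?P\<^esub> z)"
    using path_homotopic_assoc[of X p q r]
    by (simp add: mult_fundamental_group loop_in_concat loop_class_eq_iff) (simp add: loop_in_def)
next
  fix x assume "x \<in> carrier ?P"
  then obtain p where "loop_in X x0 p" "x = loop_class X x0 p"
    unfolding carrier_fundamental_group by blast
  then show "\<one>\<^bsub>?P\<^esub> \<otimes>\<^bsub>?P\<^esub> x = x"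
    using path_homotopic_const_left[of X p] loop_in_const[OF x0]
    by (simp add: one_fundamental_group mult_fundamental_group loop_in_concat loop_class_eq_iff)
      (simp add: loop_in_def)
next
  fix x assume "x \<in> carrier ?P"
  then obtain p where p: "loop_in X x0 p" "x = loop_class X x0 p"
    unfolding carrier_fundamental_group by blast
  then have r: "loop_in X x0 (path_rev p)" by (simp add: loop_in_def pathin_rev)
  have "loop_class X x0 (path_rev p) \<otimes>\<^bsub>?P\<^esub> x = \<one>\<^bsub>?P\<^esub>"
    using path_homotopic_rev_left[of X p] loop_in_const[OF x0] r p
    by (simp add: one_fundamental_group mult_fundamental_group loop_in_concat loop_class_eq_iff)
      (simp add: loop_in_def)
  then show "\<exists>y\<in>carrier ?P. y \<otimes>\<^bsub>?P\<^esub> x = \<one>\<^bsub>?P\<^esub>"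
    using r by (intro bexI[of _ "loop_class X x0 (path_rev p)"]) (auto simp: carrier_fundamental_group)
qed

section \<open>Classes of paths with arbitrary end points\<close>

locale path_tree =
  fixes X :: "'a topology" and x0 :: 'a and c :: "'a \<Rightarrow> real \<Rightarrow> 'a"
  assumes x0: "x0 \<in> topspace X"
    and c: "y \<in> topspace X \<Longrightarrow> pathin X (c y) \<and> c y 0 = x0 \<and> c y 1 = y"
    and c_x0: "c x0 = (\<lambda>_. x0)"
begin

sublocale P: group "fundamental_group X x0"
  using x0 by (rule group_fundamental_group)

abbreviation P where "P \<equiv> fundamental_group X x0"

definition path_loop :: "(real \<Rightarrow> 'a) \<Rightarrow> real \<Rightarrow> 'a" where
  "path_loop p = path_concat (c (p 0)) (path_concat p (path_rev (c (p 1))))"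

text \<open>Closing up along the chosen paths \<open>c\<close> extends classes of loops to a functor
  on all paths, so that a loop can be cut anywhere and its pieces treated separately.\<close>

definition path_class :: "(real \<Rightarrow> 'a) \<Rightarrow> (real \<Rightarrow> 'a) set" where
  "path_class p = loop_class X x0 (path_loop p)"

lemma c_path: "pathin X p \<Longrightarrow> pathin X (c (p 0)) \<and> c (p 0) 0 = x0 \<and> c (p 0) 1 = p 0"
    "pathin X p \<Longrightarrow> pathin X (c (p 1)) \<and> c (p 1) 0 = x0 \<and> c (p 1) 1 = p 1"
  using c path_start_in_topspace path_finish_in_topspace by fastforce+

lemma loop_in_path_loop: "pathin X p \<Longrightarrow> loop_in X x0 (path_loop p)"
  using c_path[of p] by (auto simp: path_loop_def loop_in_def intro!: pathin_concat pathin_rev)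

lemma path_class_closed: "pathin X p \<Longrightarrow> path_class p \<in> carrier P"
  using loop_in_path_loop by (auto simp: path_class_def carrier_fundamental_group)

lemma path_class_homotopic:
  assumes "path_homotopic X p q"
  shows "path_class p = path_class q"
proof -
  note e = path_homotopic_ends[OF assms]
  have "path_homotopic X (path_loop p) (path_loop q)"
    unfolding path_loop_def e(1,2) using assms c_path[OF e(3)]
    by (intro path_homotopic_concat path_homotopic_refl pathin_rev) auto
  then show ?thesis
    using e loop_in_path_loop by (simp add: path_class_def loop_class_eq_iff)
qed

text \<open>In the product of the two closed-up loops, the way back from the common point and the
  way out to it are inverse to each other and cancel.\<close>

lemma path_class_concat:
  assumes p: "pathin X p" and q: "pathin X q" and pq: "p 1 = q 0"
  shows "path_class (path_concat p q) = path_class p \<otimes>\<^bsub>P\<^esub> path_class q"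
proof -
  define a b e where "a = c (p 0)" and "b = c (p 1)" and "e = path_rev (c (q 1))"
  have paths: "pathin X a" "pathin X b" "pathin X e" "pathin X (path_rev b)"
    and ends: "a 1 = p 0" "b 1 = p 1" "b 0 = x0" "e 0 = q 1" "e 1 = x0"
    using c_path[OF p] c_path[OF q] by (auto simp: a_def b_def e_def pathin_rev)
  note P = pathin_concat path_homotopic_concat path_homotopic_refl
  have qe: "pathin X (path_concat q e)" using paths ends q by (auto intro: P)
  have "path_homotopic X (path_concat (path_rev b) (path_concat b (path_concat q e)))
     (path_concat (path_concat (path_rev b) b) (path_concat q e))"
    using paths ends q pq by (intro path_homotopic_sym[OF path_homotopic_assoc] P) auto
  also have "path_homotopic X \<dots> (path_concat (\<lambda>_. b 1) (path_concat q e))"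
    using paths ends q pq by (intro P path_homotopic_rev_left) auto
  also have "path_homotopic X \<dots> (path_concat q e)"
    using path_homotopic_const_left[OF qe] ends pq by simp
  finally have 1: "path_homotopic X (path_concat (path_rev b) (path_concat b (path_concat q e)))
     (path_concat q e)" .
  have "path_homotopic X (path_concat (path_concat p (path_rev b)) (path_concat b (path_concat q e)))
     (path_concat p (path_concat (path_rev b) (path_concat b (path_concat q e))))"
    using paths ends p q pq by (intro path_homotopic_assoc P) auto
  also have "path_homotopic X \<dots> (path_concat p (path_concat q e))"
    using p ends by (intro P 1) auto
  also have "path_homotopic X \<dots> (path_concat (path_concat p q) e)"
    using paths ends p q pq by (intro path_homotopic_sym[OF path_homotopic_assoc]) auto
  finally have 2: "path_homotopic X
     (path_concat (path_concat p (path_rev b)) (path_concat b (path_concat q e)))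
     (path_concat (path_concat p q) e)" .
  have "path_homotopic X
     (path_concat (path_concat a (path_concat p (path_rev b))) (path_concat b (path_concat q e)))
     (path_concat a (path_concat (path_concat p (path_rev b)) (path_concat b (path_concat q e))))"
    using paths ends p q pq by (intro path_homotopic_assoc P) auto
  also have "path_homotopic X \<dots> (path_concat a (path_concat (path_concat p q) e))"
    using paths ends by (intro P 2) auto
  finally have "path_homotopic X (path_concat (path_loop p) (path_loop q)) (path_loop (path_concat p q))"
    by (simp add: path_loop_def a_def b_def e_def pq)
  then show ?thesis
    using p q pq loop_in_path_loop pathin_concat[OF p q pq] path_homotopic_sym
    by (simp add: path_class_def mult_fundamental_group loop_class_eq_iff loop_in_concat)
qed

lemma path_class_loop:
  assumes "loop_in X x0 p"
  shows "path_class p = loop_class X x0 p"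
proof -
  have p: "pathin X p" "p 0 = x0" "p 1 = x0" using assms by (auto simp: loop_in_def)
  let ?k = "\<lambda>_. x0"
  have k: "pathin X ?k" using x0 by simp
  have "path_homotopic X (path_concat ?k (path_concat p ?k)) (path_concat p ?k)"
    using path_homotopic_const_left[of X "path_concat p ?k"] p k by (simp add: pathin_concat)
  \<comment> \<open>A constant on the right is removed by writing it as \<open>path_rev p\<close>
    followed by \<open>p\<close> and regrouping, which leaves a constant on the left.\<close>
  also have "path_homotopic X \<dots> (path_concat p (path_concat (path_rev p) p))"
    using p path_homotopic_rev_left[OF p(1)]
    by (intro path_homotopic_concat path_homotopic_refl) (auto intro: path_homotopic_sym)
  also have "path_homotopic X \<dots> (path_concat (path_concat p (path_rev p)) p)"
    using p by (intro path_homotopic_sym[OF path_homotopic_assoc] pathin_rev) auto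
  also have "path_homotopic X \<dots> (path_concat (\<lambda>_. p 0) p)"
    using p by (intro path_homotopic_concat path_homotopic_refl path_homotopic_rev_right) auto
  also have "path_homotopic X \<dots> p" using p by (intro path_homotopic_const_left)
  finally show ?thesis
    using p c_x0 assms loop_in_path_loop[OF p(1)]
    by (simp add: path_class_def loop_class_eq_iff) (simp add: path_loop_def path_rev_def)
qed

text \<open>The concatenation of a constant path with itself is the same function, so its class is
  idempotent.\<close>

lemma path_class_const: "y \<in> topspace X \<Longrightarrow> path_class (\<lambda>_. y) = \<one>\<^bsub>P\<^esub>"
  using path_class_concat[of "\<lambda>_. y" "\<lambda>_. y"] path_class_closed[of "\<lambda>_. y"]
  by (simp add: path_concat_def)

text \<open>Both sides are classes of boundary paths from (0,0) to (1,1), which are homotopic in the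
  convex square. This handles homotopies with moving end points, whose tracks are the vertical
  sides.\<close>

lemma path_class_square:
  assumes F: "continuous_map (top_of_set ({0..1} \<times> {0..1})) X F"
  shows "path_class (\<lambda>s. F (s, 0)) \<otimes>\<^bsub>P\<^esub> path_class (\<lambda>u. F (1, u)) =
         path_class (\<lambda>u. F (0, u)) \<otimes>\<^bsub>P\<^esub> path_class (\<lambda>s. F (s, 1))"
proof -
  have side: "pathin X (\<lambda>s. F (f s))" if "continuous_on {0..1} f" "f \<in> {0..1} \<rightarrow> {0..1} \<times> {0..1}" for f
    using continuous_map_top_of_set_compose[OF F that] by (simp add: pathin_def)
  have s: "pathin X (\<lambda>s. F (s, 0))" "pathin X (\<lambda>u. F (1, u))" "pathin X (\<lambda>u. F (0, u))"
    "pathin X (\<lambda>s. F (s, 1))" by (rule side; auto intro!: continuous_intros)+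
  let ?f = "\<lambda>t::real. if t \<le> 1/2 then (2 * t, 0) else (1, 2 * t - 1)"
  let ?g = "\<lambda>t::real. if t \<le> 1/2 then (0, 2 * t) else (2 * t - 1, 1)"
  have "continuous_on {0..1} ?f" "continuous_on {0..1} ?g"
    by (intro continuous_on_cases_le[where h="\<lambda>x. x"]; auto intro!: continuous_intros)+
  moreover have "convex ({0..1::real} \<times> {0..1::real})" by (intro convex_Times) auto
  ultimately have "path_homotopic X (F \<circ> ?f) (F \<circ> ?g)"
    by (intro path_homotopic_convex_set[OF _ F]) auto
  moreover have "F \<circ> ?f = path_concat (\<lambda>s. F (s, 0)) (\<lambda>u. F (1, u))"
    "F \<circ> ?g = path_concat (\<lambda>u. F (0, u)) (\<lambda>s. F (s, 1))" by (auto simp: path_concat_def)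
  ultimately have "path_class (path_concat (\<lambda>s. F (s, 0)) (\<lambda>u. F (1, u))) =
      path_class (path_concat (\<lambda>u. F (0, u)) (\<lambda>s. F (s, 1)))"
    using path_class_homotopic by simp
  then show ?thesis using s by (simp add: path_class_concat)
qed

end

section \<open>Geometric realization\<close>

type_synonym 'a cell_set = "((nat \<times> 'a) \<times> (nat \<Rightarrow> real)) set"

definition cell_point :: "'a sset \<Rightarrow> nat \<Rightarrow> 'a \<Rightarrow> (nat \<Rightarrow> real) \<Rightarrow> 'a cell_set" where
  "cell_point K n x t = cell_rel K `` {((n, x), t)}"

abbreviation simplex_topology :: "nat \<Rightarrow> (nat \<Rightarrow> real) topology" where
  "simplex_topology n \<equiv> subtopology (powertop_real UNIV) (standard_simplex n)"

lemma standard_simplexD: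
  assumes "t \<in> standard_simplex n"
  shows "0 \<le> t i" "t i \<le> 1" "i > n \<Longrightarrow> t i = 0" "sum t {..n} = 1"
  using assms by (auto simp: standard_simplex_def)

text \<open>Barycentric coordinates are added along the fibres of \<theta>. For initial segments
  \<open>J\<close> this compares division points in \<open>position_push\<close>, for level sets it
  compares masses in \<open>simplex_push_face_point\<close>.\<close>

lemma sum_simplex_push:
  assumes "finite J"
  shows "sum (simplex_push m \<theta> t) J = sum t {l. l \<le> m \<and> \<theta> l \<in> J}"
proof -
  have "{x \<in> {l. l \<le> m \<and> \<theta> l \<in> J}. \<theta> x = y} = {i. i \<le> m \<and> \<theta> i = y}" if "y \<in> J" for y
    using that by auto
  then have "sum (simplex_push m \<theta> t) J = (\<Sum>y\<in>J. sum t {x \<in> {l. l \<le> m \<and> \<theta> l \<in> J}. \<theta> x = y})"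
    by (simp add: simplex_push_def)
  also have "\<dots> = sum t {l. l \<le> m \<and> \<theta> l \<in> J}"
    using assms by (intro sum.group) auto
  finally show ?thesis .
qed

lemma simplex_push_in:
  assumes "\<theta> \<in> simplex_maps m n" "t \<in> standard_simplex m"
  shows "simplex_push m \<theta> t \<in> standard_simplex n"
proof -
  note t = standard_simplexD[OF assms(2)]
  have th: "\<theta> l \<le> n" if "l \<le> m" for l using assms(1) that by (auto simp: simplex_maps_def)
  have nn: "simplex_push m \<theta> t i \<ge> 0" for i by (simp add: simplex_push_def t(1) sum_nonneg)
  moreover have "{l. l \<le> m \<and> \<theta> l \<in> {..n}} = {..m}" using th by auto
  then have s: "sum (simplex_push m \<theta> t) {..n} = 1"
    using t(4) by (simp add: sum_simplex_push)
  moreover have out: "simplex_push m \<theta> t i = 0" if "i > n" for i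
  proof -
    have "{l. l \<le> m \<and> \<theta> l = i} = {}" using th that by fastforce
    then show ?thesis by (simp only: simplex_push_def sum.empty)
  qed
  moreover have "simplex_push m \<theta> t i \<le> 1" for i
  proof (cases "i \<le> n")
    case True
    then show ?thesis using member_le_sum[of i "{..n}" "simplex_push m \<theta> t"] nn s by auto
  qed (use out in auto)
  ultimately show ?thesis by (simp add: standard_simplex_def)
qed

lemma topspace_cell_space:
  "((n, x), t) \<in> topspace (cell_space K) \<longleftrightarrow> x \<in> simplices K n \<and> t \<in> standard_simplex n"
  by (auto simp: cell_space_def)

lemma equiv_cell_rel: "equiv UNIV (cell_rel K)"
  unfolding cell_rel_def
  by (intro equivI) (auto simp: refl_on_def sym_def trans_def
      intro: equivclp_refl equivclp_sym equivclp_trans)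

lemma cell_point_eq_iff:
  "cell_point K n x t = cell_point K m y u \<longleftrightarrow> (((n, x), t), ((m, y), u)) \<in> cell_rel K"
  unfolding cell_point_def using equiv_class_eq_iff[OF equiv_cell_rel] by fastforce

lemma cell_point_glue:
  "\<theta> \<in> simplex_maps m n \<Longrightarrow> x \<in> simplices K n \<Longrightarrow> t \<in> standard_simplex m
     \<Longrightarrow> cell_point K m (sact K m n \<theta> x) t = cell_point K n x (simplex_push m \<theta> t)"
  unfolding cell_point_eq_iff cell_rel_def by (auto intro: cell_glue.intros)

lemma topspace_realization:
  "y \<in> topspace (geometric_realization K) \<longleftrightarrow>
     (\<exists>n x t. x \<in> simplices K n \<and> t \<in> standard_simplex n \<and> y = cell_point K n x t)"
  by (auto simp: geometric_realization_def quotient_def cell_point_def topspace_cell_space) blast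

lemma quotient_map_realization:
  "quotient_map (cell_space K) (geometric_realization K) (\<lambda>((n, x), t). cell_point K n x t)"
  using quotient_map_quotient_space[of "cell_space K" "cell_rel K"]
  by (simp add: geometric_realization_def cell_point_def case_prod_unfold)

lemma continuous_map_cell_point:
  assumes "x \<in> simplices K n"
  shows "continuous_map (simplex_topology n) (geometric_realization K) (cell_point K n x)"
proof -
  have "continuous_map (simplex_topology n) (cell_space K) (\<lambda>t. ((n, x), t))"
    using assms continuous_map_component_injection[of "(n, x)" "SIGMA n:UNIV. simplices K n"
      "\<lambda>(n, x). simplex_topology n"] by (simp add: cell_space_def)
  from continuous_map_compose[OF this quotient_imp_continuous_map[OF quotient_map_realization]]
  show ?thesis by (simp add: o_def)
qed

context simplicial_set
begin

text \<open>\<open>cell_rel\<close> is an equivalence relation on the whole type, but gluing only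
  relates points of the cell space, so a chain that starts there stays there and membership may be
  assumed in the cases.\<close>

lemma cell_rel_induct [consumes 2, case_names refl glue sym trans]:
  assumes "(p, q) \<in> cell_rel K" "p \<in> topspace (cell_space K)"
    and r: "\<And>p. p \<in> topspace (cell_space K) \<Longrightarrow> P p p"
    and g: "\<And>m n \<theta> x t. \<theta> \<in> simplex_maps m n \<Longrightarrow> x \<in> simplices K n \<Longrightarrow> t \<in> standard_simplex m
       \<Longrightarrow> P ((m, sact K m n \<theta> x), t) ((n, x), simplex_push m \<theta> t)"
    and s: "\<And>p q. p \<in> topspace (cell_space K) \<Longrightarrow> q \<in> topspace (cell_space K) \<Longrightarrow> P p q \<Longrightarrow> P q p"
    and t: "\<And>p q r. p \<in> topspace (cell_space K) \<Longrightarrow> q \<in> topspace (cell_space K) \<Longrightarrow>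
       r \<in> topspace (cell_space K) \<Longrightarrow> P p q \<Longrightarrow> P q r \<Longrightarrow> P p r"
  shows "q \<in> topspace (cell_space K) \<and> P p q"
proof -
  have glue: "p \<in> topspace (cell_space K) \<and> q \<in> topspace (cell_space K) \<and> P p q \<and> P q p"
    if "cell_glue K p q" for p q
    using that
  proof cases
    case (1 \<theta> m n x t)
    then have "p \<in> topspace (cell_space K)" "q \<in> topspace (cell_space K)"
      by (auto simp: topspace_cell_space act_closed simplex_push_in)
    then show ?thesis using 1 g s by blast
  qed
  have "equivclp (cell_glue K) p q" using assms(1) by (simp add: cell_rel_def)
  then show ?thesis
  proof (induction rule: equivclp_induct)
    case base
    then show ?case using assms(2) r by blast
  next
    case (step y z)
    then show ?case using glue t assms(2) by blast
  qed
qed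

end

section \<open>Positions in a simplex\<close>

text \<open>A point of the standard simplex divides the unit interval into consecutive intervals of
  lengths \<open>t 0, t 1, \<dots>\<close>; this is the index of the interval containing \<open>s\<close>.\<close>

definition position :: "(nat \<Rightarrow> real) \<Rightarrow> real \<Rightarrow> nat" where
  "position t s = (LEAST i. s < sum t {..i})"

lemma position_eqI:
  assumes "\<And>i. 0 \<le> t i" "sum t {..<i} \<le> s" "s < sum t {..i}"
  shows "position t s = i"
  unfolding position_def
proof (rule Least_equality)
  fix j assume j: "s < sum t {..j}"
  show "i \<le> j"
  proof (rule ccontr)
    assume "\<not> i \<le> j"
    then have "sum t {..j} \<le> sum t {..<i}" using assms(1) by (intro sum_mono2) auto
    then show False using j assms(2) by simp
  qed
qed (use assms in auto)

lemma position_props: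
  assumes "t \<in> standard_simplex n" "0 \<le> s" "s < 1"
  shows "position t s \<le> n" "s < sum t {..position t s}" "sum t {..<position t s} \<le> s"
proof -
  have n: "s < sum t {..n}" using assms standard_simplexD by simp
  show "position t s \<le> n" using n by (simp add: position_def Least_le)
  show "s < sum t {..position t s}" using LeastI[of "\<lambda>i. s < sum t {..i}", OF n] by (simp add: position_def)
  show "sum t {..<position t s} \<le> s"
  proof (cases "position t s")
    case 0
    then show ?thesis using assms by simp
  next
    case (Suc j)
    then have "\<not> s < sum t {..j}" using not_less_Least[of j "\<lambda>i. s < sum t {..i}"] by (simp add: position_def)
    then show ?thesis using Suc by (simp add: lessThan_Suc_atMost)
  qed
qed

text \<open>A monotone \<theta> only merges neighbouring intervals and inserts empty ones. The
  strict inequality in \<open>position\<close> skips empty intervals, so vanishing coordinates cause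
  no ambiguity.\<close>

lemma position_push:
  assumes "\<theta> \<in> simplex_maps m n" "t \<in> standard_simplex m" "0 \<le> s" "s < 1"
  shows "position (simplex_push m \<theta> t) s = \<theta> (position t s)"
proof (rule position_eqI)
  note p = position_props[OF assms(2-4)] and t = standard_simplexD[OF assms(2)]
  let ?i = "position t s"
  have mono: "\<theta> a \<le> \<theta> b" if "a \<le> b" "b \<le> m" for a b
    using assms(1) that by (auto simp: simplex_maps_def mono_on_def)
  show "0 \<le> simplex_push m \<theta> t i" for i
    using standard_simplexD[OF simplex_push_in[OF assms(1,2)]] by blast
  have "sum t {l. l \<le> m \<and> \<theta> l \<in> {..<\<theta> ?i}} \<le> sum t {..<?i}"
    using mono p(1) t(1) by (intro sum_mono2) (auto simp: not_le[symmetric])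
  then show "sum (simplex_push m \<theta> t) {..<\<theta> ?i} \<le> s" using p(3) by (simp add: sum_simplex_push)
  have "sum t {..?i} \<le> sum t {l. l \<le> m \<and> \<theta> l \<in> {..\<theta> ?i}}"
    using mono p(1) t(1) by (intro sum_mono2) auto
  then show "s < sum (simplex_push m \<theta> t) {..\<theta> ?i}" using p(2) by (simp add: sum_simplex_push)
qed

lemma position_sets: "{s. position t s = i} \<in> sets lborel"
  unfolding position_def by measurable

text \<open>When the two positions differ, the division point numbered by the smaller position lies
  above \<open>s\<close> for one of the points and at or below \<open>s\<close> for the
  other.\<close>

lemma position_neq_subset:
  assumes "t \<in> standard_simplex n" "u \<in> standard_simplex n"
  shows "{s \<in> {0..<1}. position t s \<noteq> position u s} \<subseteq>
     (\<Union>i\<le>n. {min (sum t {..i}) (sum u {..i})..max (sum t {..i}) (sum u {..i})})"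
proof -
  have *: "\<exists>i\<le>n. sum u {..i} \<le> s \<and> s < sum t {..i}"
    if "t \<in> standard_simplex n" "u \<in> standard_simplex n" "s \<in> {0..<1}" "position t s < position u s" for t u s
  proof (intro exI conjI)
    note p = position_props[OF that(1)] and q = position_props[OF that(2)]
    show "position t s \<le> n" using that p by simp
    show "s < sum t {..position t s}" using that p by simp
    have "sum u {..position t s} \<le> sum u {..<position u s}"
      using that standard_simplexD(1)[OF that(2)] by (intro sum_mono2) auto
    then show "sum u {..position t s} \<le> s" using q[of s] that by simp
  qed
  show ?thesis
  proof
    fix s assume "s \<in> {s \<in> {0..<1}. position t s \<noteq> position u s}"
    then have "\<exists>i\<le>n. sum u {..i} \<le> s \<and> s < sum t {..i} \<or> sum t {..i} \<le> s \<and> s < sum u {..i}"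
      using *[OF assms, of s] *[OF assms(2,1), of s] by (cases "position t s < position u s") auto
    then obtain i where "i \<le> n"
      "sum u {..i} \<le> s \<and> s < sum t {..i} \<or> sum t {..i} \<le> s \<and> s < sum u {..i}" by blast
    then show "s \<in> (\<Union>i\<le>n. {min (sum t {..i}) (sum u {..i})..max (sum t {..i}) (sum u {..i})})"
      by (intro UN_I[of i]) (auto simp: min_def max_def)
  qed
qed

section \<open>Step functions\<close>

definition step_dist :: "(real \<Rightarrow> 'h) \<Rightarrow> (real \<Rightarrow> 'h) \<Rightarrow> real" where
  "step_dist E E' = measure lborel {s \<in> {0..<1}. E s \<noteq> E' s}"

lemma step_dist_commute: "step_dist E E' = step_dist E' E"
  by (simp add: step_dist_def eq_commute)

lemma step_dist_refl [simp]: "step_dist E E = 0"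
  by (simp add: step_dist_def)

text \<open>With the first vertex placed at the identity, this is the group element reached after
  \<open>i\<close> edges.\<close>

definition vertex :: "('a, 'b) monoid_scheme \<Rightarrow> 'a list \<Rightarrow> nat \<Rightarrow> 'a" where
  "vertex G x i = list_mult G (take i x)"

text \<open>In the application \<open>H\<close> is the colimit. Injectivity of \<iota> serves to
  conclude that vertices of a simplex agree in \<open>G\<close> when their images in
  \<open>H\<close> do.\<close>

locale commuting_map = G: group G + H: group H
  for G :: "('a, 'b) monoid_scheme" and H :: "('h, 'c) monoid_scheme" +
  fixes \<iota> :: "'a \<Rightarrow> 'h"
  assumes iota_closed [simp]: "g \<in> carrier G \<Longrightarrow> \<iota> g \<in> carrier H"
    and iota_mult: "g \<in> carrier G \<Longrightarrow> h \<in> carrier G \<Longrightarrow> g \<otimes>\<^bsub>G\<^esub> h = h \<otimes>\<^bsub>G\<^esub> g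
       \<Longrightarrow> \<iota> (g \<otimes>\<^bsub>G\<^esub> h) = \<iota> g \<otimes>\<^bsub>H\<^esub> \<iota> h"
    and iota_inj: "inj_on \<iota> (carrier G)"
begin

abbreviation H_mult (infixl "\<cdot>" 70) where "x \<cdot> y \<equiv> x \<otimes>\<^bsub>H\<^esub> y"

abbreviation K where "K \<equiv> commuting_nerve G"

sublocale K: simplicial_set K
  by (rule G.simplicial_set_commuting_nerve)

lemma iota_one: "\<iota> \<one>\<^bsub>G\<^esub> = \<one>\<^bsub>H\<^esub>"
  using iota_mult[of "\<one>\<^bsub>G\<^esub>" "\<one>\<^bsub>G\<^esub>"] H.l_cancel_one[of "\<iota> \<one>\<^bsub>G\<^esub>" "\<iota> \<one>\<^bsub>G\<^esub>"] by simp

lemma simplicesD: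
  assumes "x \<in> simplices K n"
  shows "length x = n" "set x \<subseteq> carrier G" "\<And>a b. a \<in> set x \<Longrightarrow> b \<in> set x \<Longrightarrow> a \<otimes>\<^bsub>G\<^esub> b = b \<otimes>\<^bsub>G\<^esub> a"
  using assms by (auto simp: commuting_nerve_def nerve_def)

lemma vertex_closed: "x \<in> simplices K n \<Longrightarrow> vertex G x i \<in> carrier G"
  unfolding vertex_def using simplicesD set_take_subset by (intro G.list_mult_closed) fast

lemma vertex_0 [simp]: "vertex G x 0 = \<one>\<^bsub>G\<^esub>"
  by (simp add: vertex_def list_mult_def)

lemma segment_commute:
  assumes "x \<in> simplices K n" "set u \<subseteq> set x" "set v \<subseteq> set x"
  shows "list_mult G u \<otimes>\<^bsub>G\<^esub> list_mult G v = list_mult G v \<otimes>\<^bsub>G\<^esub> list_mult G u"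
proof -
  note x = simplicesD[OF assms(1)]
  have v: "set v \<subseteq> carrier G" "set u \<subseteq> carrier G" using assms x by auto
  have "a \<otimes>\<^bsub>G\<^esub> list_mult G v = list_mult G v \<otimes>\<^bsub>G\<^esub> a" if "a \<in> set x" for a
    using G.list_mult_commute[OF v(1)] x assms(3) that by (metis subsetD)
  then show ?thesis
    using assms v by (intro G.list_mult_commute G.list_mult_closed) auto
qed

text \<open>Pulling back along \<theta> makes vertex \<open>\<theta> 0\<close> the new origin. For
  the second equation \<iota> must respect the product, and it does because both factors are
  products of entries of one commuting tuple.\<close>

lemma vertex_act:
  assumes th: "\<theta> \<in> simplex_maps m n" and x: "x \<in> simplices K n" and i: "i \<le> m"
  shows "vertex G x (\<theta> 0) \<otimes>\<^bsub>G\<^esub> vertex G (sact K m n \<theta> x) i = vertex G x (\<theta> i)"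
    and "\<iota> (vertex G x (\<theta> 0)) \<cdot> \<iota> (vertex G (sact K m n \<theta> x) i) = \<iota> (vertex G x (\<theta> i))"
proof -
  note xx = simplicesD[OF x]
  have mono: "\<theta> 0 \<le> \<theta> i" "\<theta> i \<le> n" "mono_on {..i} \<theta>"
    using th i by (auto simp: simplex_maps_def mono_on_def)
  have nth: "x ! k \<in> set x" "x ! k \<in> carrier G" if "k < \<theta> i" for k
    using that xx mono nth_mem[of k x] by auto
  have "take i (map f [0..<m]) = map f [0..<i]" for f :: "nat \<Rightarrow> 'a"
    using i by (simp add: take_map)
  then have "vertex G (sact K m n \<theta> x) i = list_mult G (map (\<lambda>i. list_mult G (map (nth x) [\<theta> i..<\<theta> (Suc i)])) [0..<i])"
    by (simp add: vertex_def commuting_nerve_def nerve_def)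
  also have "\<dots> = list_mult G (map (nth x) [\<theta> 0..<\<theta> i])"
    using mono nth by (intro G.list_mult_segments) auto
  finally have 1: "vertex G (sact K m n \<theta> x) i = list_mult G (map (nth x) [\<theta> 0..<\<theta> i])" .
  have tk: "take j x = map (nth x) [0..<j]" if "j \<le> n" for j
    using that xx by (intro nth_equalityI) auto
  have 2: "vertex G x (\<theta> 0) = list_mult G (map (nth x) [0..<\<theta> 0])"
    using tk[of "\<theta> 0"] mono by (simp add: vertex_def)
  have "vertex G x (\<theta> i) = list_mult G (map (nth x) ([0..<\<theta> 0] @ [\<theta> 0..<\<theta> i]))"
    using tk[of "\<theta> i"] mono upt_add_eq_append[of 0 "\<theta> 0" "\<theta> i - \<theta> 0"] by (simp add: vertex_def)
  also have "\<dots> = vertex G x (\<theta> 0) \<otimes>\<^bsub>G\<^esub> vertex G (sact K m n \<theta> x) i"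
    unfolding 1 2 map_append using nth mono by (intro G.list_mult_append) auto
  finally show 3: "vertex G x (\<theta> 0) \<otimes>\<^bsub>G\<^esub> vertex G (sact K m n \<theta> x) i = vertex G x (\<theta> i)" by simp
  have "vertex G x (\<theta> 0) \<otimes>\<^bsub>G\<^esub> vertex G (sact K m n \<theta> x) i = vertex G (sact K m n \<theta> x) i \<otimes>\<^bsub>G\<^esub> vertex G x (\<theta> 0)"
    unfolding 1 2 using x nth mono by (intro segment_commute[OF x]) auto
  then show "\<iota> (vertex G x (\<theta> 0)) \<cdot> \<iota> (vertex G (sact K m n \<theta> x) i) = \<iota> (vertex G x (\<theta> i))"
    using iota_mult[of "vertex G x (\<theta> 0)" "vertex G (sact K m n \<theta> x) i"] 3
      vertex_closed[OF x] vertex_closed[OF K.act_closed[OF th x]] by simp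
qed

definition translate :: "'h \<Rightarrow> (real \<Rightarrow> 'h) \<Rightarrow> real \<Rightarrow> 'h" where
  "translate k E = (\<lambda>s\<in>{0..<1}. k \<cdot> E s)"

text \<open>Step functions are extensional on \<open>{0..<1}\<close>, so that functions with the
  same values there are equal; at \<open>s = 1\<close> no partial sum exceeds \<open>s\<close> and
  there is no position.\<close>

definition step_fun :: "'a list \<Rightarrow> (nat \<Rightarrow> real) \<Rightarrow> real \<Rightarrow> 'h" where
  "step_fun x t = (\<lambda>s\<in>{0..<1}. \<iota> (vertex G x (position t s)))"

definition steps :: "(real \<Rightarrow> 'h) set" where
  "steps = {translate k (step_fun x t) | k n x t.
     k \<in> carrier H \<and> x \<in> simplices K n \<and> t \<in> standard_simplex n}"

lemma step_fun_closed: "x \<in> simplices K n \<Longrightarrow> step_fun x t \<in> {0..<1} \<rightarrow>\<^sub>E carrier H"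
  by (auto simp: step_fun_def vertex_closed)

lemma translate_closed: "k \<in> carrier H \<Longrightarrow> E \<in> {0..<1} \<rightarrow>\<^sub>E carrier H \<Longrightarrow> translate k E \<in> {0..<1} \<rightarrow>\<^sub>E carrier H"
  by (auto simp: translate_def)

lemma translate_translate:
  "k \<in> carrier H \<Longrightarrow> l \<in> carrier H \<Longrightarrow> E \<in> {0..<1} \<rightarrow>\<^sub>E carrier H \<Longrightarrow> translate k (translate l E) = translate (k \<cdot> l) E"
  by (auto simp: translate_def H.m_assoc PiE_iff)

lemma translate_one: "E \<in> {0..<1} \<rightarrow>\<^sub>E carrier H \<Longrightarrow> translate \<one>\<^bsub>H\<^esub> E = E"
  unfolding translate_def by (rule ext) (auto simp: PiE_def Pi_def extensional_def)

lemma stepsI: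
  "k \<in> carrier H \<Longrightarrow> x \<in> simplices K n \<Longrightarrow> t \<in> standard_simplex n \<Longrightarrow> translate k (step_fun x t) \<in> steps"
  unfolding steps_def by blast

lemma stepsE:
  assumes "E \<in> steps"
  obtains k n x t where "k \<in> carrier H" "x \<in> simplices K n" "t \<in> standard_simplex n"
    "E = translate k (step_fun x t)"
  using assms unfolding steps_def by blast

lemma steps_closed: "E \<in> steps \<Longrightarrow> E \<in> {0..<1} \<rightarrow>\<^sub>E carrier H"
  by (erule stepsE) (simp only: translate_closed step_fun_closed)

lemma translate_steps: "k \<in> carrier H \<Longrightarrow> E \<in> steps \<Longrightarrow> translate k E \<in> steps"
  by (erule stepsE) (simp only: translate_translate[OF _ _ step_fun_closed] stepsI H.m_closed)

lemma step_fun_steps: "x \<in> simplices K n \<Longrightarrow> t \<in> standard_simplex n \<Longrightarrow> step_fun x t \<in> steps"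
  using stepsI[OF H.one_closed] by (simp only: translate_one[OF step_fun_closed])

lemma step_fun_push:
  assumes "\<theta> \<in> simplex_maps m n" "x \<in> simplices K n" "t \<in> standard_simplex m"
  shows "step_fun x (simplex_push m \<theta> t) = translate (\<iota> (vertex G x (\<theta> 0))) (step_fun (sact K m n \<theta> x) t)"
proof
  fix s
  show "step_fun x (simplex_push m \<theta> t) s = translate (\<iota> (vertex G x (\<theta> 0))) (step_fun (sact K m n \<theta> x) t) s"
    using position_push[OF assms(1,3)] position_props(1)[OF assms(3)] vertex_act(2)[OF assms(1,2)]
    by (simp add: step_fun_def translate_def)
qed

text \<open>Sets of constant position are measurable, and disagreement depends only on the pair of
  positions; hence a countable union.\<close>

lemma steps_neq_sets:
  assumes "E \<in> steps" "E' \<in> steps"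
  shows "{s \<in> {0..<1}. E s \<noteq> E' s} \<in> fmeasurable lborel"
proof -
  obtain k x t l y u where E: "E = translate k (step_fun x t)" "E' = translate l (step_fun y u)"
    using assms by (metis stepsE)
  let ?P = "\<lambda>i j. k \<cdot> \<iota> (vertex G x i) \<noteq> l \<cdot> \<iota> (vertex G y j)"
  have "{s \<in> {0..<1}. E s \<noteq> E' s} =
      {0..<1} \<inter> (\<Union>i. \<Union>j\<in>{j. ?P i j}. {s. position t s = i} \<inter> {s. position u s = j})"
    by (auto simp: E translate_def step_fun_def)
  also have "\<dots> \<in> sets lborel"
    using position_sets by (intro sets.Int sets.countable_UN' ) auto
  finally have s: "{s \<in> {0..<1}. E s \<noteq> E' s} \<in> sets lborel" .
  have "emeasure lborel {s \<in> {0..<1}. E s \<noteq> E' s} \<le> emeasure lborel {0..<1::real}"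
    using s by (intro emeasure_mono) auto
  also have "\<dots> < \<infinity>" by simp
  finally show ?thesis using s by (intro fmeasurableI) auto
qed

lemma step_dist_triangle:
  assumes "E \<in> steps" "E' \<in> steps" "E'' \<in> steps"
  shows "step_dist E E'' \<le> step_dist E E' + step_dist E' E''"
proof -
  have "step_dist E E'' \<le> measure lborel ({s \<in> {0..<1}. E s \<noteq> E' s} \<union> {s \<in> {0..<1}. E' s \<noteq> E'' s})"
    unfolding step_dist_def using steps_neq_sets assms
    by (intro measure_mono_fmeasurable fmeasurable.Un fmeasurableD) auto
  also have "\<dots> \<le> step_dist E E' + step_dist E' E''"
    unfolding step_dist_def using steps_neq_sets assms by (intro measure_Un_le fmeasurableD) auto
  finally show ?thesis .
qed

lemma step_dist_translate:
  assumes "k \<in> carrier H" "E \<in> steps" "E' \<in> steps"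
  shows "step_dist (translate k E) (translate k E') = step_dist E E'"
proof -
  have "translate k E s = translate k E' s \<longleftrightarrow> E s = E' s" if "s \<in> {0..<1}" for s
    using that assms steps_closed[of E] steps_closed[of E'] by (auto simp: translate_def PiE_iff)
  then show ?thesis unfolding step_dist_def by (intro arg_cong[where f="measure lborel"]) auto
qed

lemma step_dist_translate_self:
  assumes "k \<in> carrier H" "l \<in> carrier H" "E \<in> steps" "step_dist (translate k E) (translate l E) < 1"
  shows "k = l"
proof (rule ccontr)
  assume "k \<noteq> l"
  then have "translate k E s \<noteq> translate l E s" if "s \<in> {0..<1}" for s
    using that assms steps_closed[of E] by (auto simp: translate_def PiE_iff)
  then have "{s \<in> {0..<1}. translate k E s \<noteq> translate l E s} = {0..<1}" by auto
  then show False using assms(4) by (simp add: step_dist_def)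
qed

lemma step_dist_step_fun_le:
  assumes "x \<in> simplices K n" "t \<in> standard_simplex n" "u \<in> standard_simplex n"
  shows "step_dist (step_fun x t) (step_fun x u) \<le> (\<Sum>i\<le>n. \<bar>sum t {..i} - sum u {..i}\<bar>)"
proof -
  let ?I = "\<lambda>i. {min (sum t {..i}) (sum u {..i})..max (sum t {..i}) (sum u {..i})}"
  have "{s \<in> {0..<1}. step_fun x t s \<noteq> step_fun x u s} \<subseteq> {s \<in> {0..<1}. position t s \<noteq> position u s}"
    by (auto simp: step_fun_def)
  also note position_neq_subset[OF assms(2,3)]
  finally have sub: "{s \<in> {0..<1}. step_fun x t s \<noteq> step_fun x u s} \<subseteq> (\<Union>i\<le>n. ?I i)" .
  have "{a..b} \<in> fmeasurable lborel" for a b :: real by (intro fmeasurableI) (auto simp: emeasure_lborel_Icc_eq)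
  then have "step_dist (step_fun x t) (step_fun x u) \<le> measure lborel (\<Union>i\<le>n. ?I i)"
    unfolding step_dist_def using sub steps_neq_sets step_fun_steps assms
    by (intro measure_mono_fmeasurable fmeasurableD fmeasurable.finite_UN) auto
  also have "\<dots> \<le> (\<Sum>i\<le>n. measure lborel (?I i))"
    by (intro measure_UNION_le) auto
  also have "\<dots> = (\<Sum>i\<le>n. \<bar>sum t {..i} - sum u {..i}\<bar>)"
    by (intro sum.cong) auto
  finally show ?thesis .
qed

text \<open>The distance between step functions of one cell is bounded by the movement of the
  finitely many division points, which depend continuously on the coordinates.\<close>

lemma openin_step_ball:
  assumes "x \<in> simplices K n" "k \<in> carrier H" "E \<in> steps"
  shows "openin (simplex_topology n) {t \<in> standard_simplex n. step_dist (translate k (step_fun x t)) E < r}"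
proof (subst openin_subopen, intro ballI)
  fix t assume "t \<in> {t \<in> standard_simplex n. step_dist (translate k (step_fun x t)) E < r}"
  then have t: "t \<in> standard_simplex n" "step_dist (translate k (step_fun x t)) E < r" by auto
  let ?f = "\<lambda>u. \<Sum>i\<le>n. \<bar>sum u {..i} - sum t {..i}\<bar>"
  let ?U = "{u \<in> topspace (simplex_topology n). ?f u \<in> {..<r - step_dist (translate k (step_fun x t)) E}}"
  have "continuous_map (simplex_topology n) euclideanreal ?f"
    by (intro continuous_intros continuous_map_from_subtopology continuous_map_product_projection) auto
  then have "openin (simplex_topology n) ?U"
    by (rule openin_continuous_map_preimage) auto
  moreover have "t \<in> ?U" using t by auto
  moreover have "?U \<subseteq> {t \<in> standard_simplex n. step_dist (translate k (step_fun x t)) E < r}"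
  proof
    fix u assume u: "u \<in> ?U"
    then have uD: "u \<in> standard_simplex n" by auto
    have "step_dist (translate k (step_fun x u)) E \<le>
        step_dist (translate k (step_fun x u)) (translate k (step_fun x t)) + step_dist (translate k (step_fun x t)) E"
      using assms t uD step_fun_steps translate_steps by (intro step_dist_triangle) auto
    also have "step_dist (translate k (step_fun x u)) (translate k (step_fun x t)) \<le> ?f u"
      using step_dist_translate step_dist_step_fun_le assms step_fun_steps t uD by simp
    finally show "u \<in> {t \<in> standard_simplex n. step_dist (translate k (step_fun x t)) E < r}"
      using u uD by auto
  qed
  ultimately show "\<exists>T. openin (simplex_topology n) T \<and> t \<in> T \<and>
      T \<subseteq> {t \<in> standard_simplex n. step_dist (translate k (step_fun x t)) E < r}" by blast
qed

end

section \<open>Fibres of step functions over the realization\<close>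

context commuting_map begin

abbreviation X where "X \<equiv> geometric_realization K"

text \<open>This plays the role of a fibre of a covering: over a point of the realization it is one
  free orbit of left translations, by \<open>orbit_transitive\<close> and
  \<open>step_dist_translate_self\<close>.\<close>

definition orbit :: "'a list cell_set \<Rightarrow> (real \<Rightarrow> 'h) set" where
  "orbit y = {translate k (step_fun x t) | k n x t.
     k \<in> carrier H \<and> x \<in> simplices K n \<and> t \<in> standard_simplex n \<and> y = cell_point K n x t}"

lemma orbitI:
  "k \<in> carrier H \<Longrightarrow> x \<in> simplices K n \<Longrightarrow> t \<in> standard_simplex n \<Longrightarrow>
     translate k (step_fun x t) \<in> orbit (cell_point K n x t)"
  unfolding orbit_def by blast

lemma orbitE:
  assumes "E \<in> orbit y"
  obtains k n x t where "k \<in> carrier H" "x \<in> simplices K n" "t \<in> standard_simplex n"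
    "y = cell_point K n x t" "E = translate k (step_fun x t)"
  using assms unfolding orbit_def by blast

lemma step_fun_orbit:
  "x \<in> simplices K n \<Longrightarrow> t \<in> standard_simplex n \<Longrightarrow> step_fun x t \<in> orbit (cell_point K n x t)"
  using orbitI[OF H.one_closed] by (simp only: translate_one[OF step_fun_closed])

lemma orbit_steps: "E \<in> orbit y \<Longrightarrow> E \<in> steps"
  by (erule orbitE) (simp only: stepsI)

lemma orbit_nonempty: "y \<in> topspace X \<Longrightarrow> \<exists>E. E \<in> orbit y"
  using step_fun_orbit unfolding topspace_realization by blast

lemma translate_orbit: "k \<in> carrier H \<Longrightarrow> E \<in> orbit y \<Longrightarrow> translate k E \<in> orbit y"
  by (erule orbitE) (simp only: translate_translate[OF _ _ step_fun_closed] orbitI H.m_closed)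

lemma translate_inv:
  assumes "k \<in> carrier H" "E \<in> {0..<1} \<rightarrow>\<^sub>E carrier H" "F = translate k E"
  shows "E = translate (inv\<^bsub>H\<^esub> k) F"
  unfolding assms(3) by (simp only: translate_translate[OF H.inv_closed[OF assms(1)] assms(1,2)]
    H.l_inv[OF assms(1)] translate_one[OF assms(2)])

text \<open>Each gluing translates the step function by the image of the label of vertex
  \<open>\<theta> 0\<close>, see \<open>step_fun_push\<close>; along a chain of gluings these
  translations are composed and inverted.\<close>

lemma cell_point_step_fun:
  assumes "cell_point K n x t = cell_point K m y u" "x \<in> simplices K n" "t \<in> standard_simplex n"
  shows "\<exists>k\<in>carrier H. step_fun y u = translate k (step_fun x t)"
proof -
  define sf where "sf p = step_fun (snd (fst p)) (snd p)" for p :: "(nat \<times> 'a list) \<times> (nat \<Rightarrow> real)"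
  have sf: "sf p \<in> {0..<1} \<rightarrow>\<^sub>E carrier H" if "p \<in> topspace (cell_space K)" for p
  proof -
    obtain n x t where p: "p = ((n, x), t)" by (metis surj_pair)
    then have "x \<in> simplices K n" using that by (simp add: topspace_cell_space)
    then show ?thesis by (simp only: p sf_def fst_conv snd_conv step_fun_closed)
  qed
  have "(((n, x), t), ((m, y), u)) \<in> cell_rel K" "((n, x), t) \<in> topspace (cell_space K)"
    using assms by (simp_all add: cell_point_eq_iff topspace_cell_space)
  then have "((m, y), u) \<in> topspace (cell_space K) \<and>
      (\<exists>k\<in>carrier H. sf ((m, y), u) = translate k (sf ((n, x), t)))"
  proof (induction rule: K.cell_rel_induct)
    case (refl p)
    then show ?case using translate_one[OF sf] by (intro bexI[of _ "\<one>\<^bsub>H\<^esub>"]) simp_all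
  next
    case (glue m n \<theta> x t)
    then show ?case
      by (intro bexI[of _ "\<iota> (vertex G x (\<theta> 0))"]) (simp_all add: sf_def step_fun_push vertex_closed)
  next
    case (sym p q)
    then obtain k where k: "k \<in> carrier H" "sf q = translate k (sf p)" by blast
    show ?case
      using translate_inv[OF k(1) sf[OF sym(1)] k(2)] k by (intro bexI[of _ "inv\<^bsub>H\<^esub> k"]) simp_all
  next
    case (trans p q r)
    then obtain k l where "k \<in> carrier H" "l \<in> carrier H" "sf q = translate k (sf p)" "sf r = translate l (sf q)"
      by blast
    then show ?case using translate_translate[of l k "sf p"] sf trans(1) by (intro bexI[of _ "l \<cdot> k"]) simp_all
  qed
  then show ?thesis by (simp add: sf_def)
qed

lemma orbit_transitive:
  assumes "E \<in> orbit y" "F \<in> orbit y"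
  shows "\<exists>k\<in>carrier H. F = translate k E"
proof -
  obtain k n x t where E: "k \<in> carrier H" "x \<in> simplices K n" "t \<in> standard_simplex n"
    "y = cell_point K n x t" "E = translate k (step_fun x t)" using assms(1) by (rule orbitE)
  obtain l m w u where F: "l \<in> carrier H" "w \<in> simplices K m" "u \<in> standard_simplex m"
    "y = cell_point K m w u" "F = translate l (step_fun w u)" using assms(2) by (rule orbitE)
  obtain j where j: "j \<in> carrier H" "step_fun w u = translate j (step_fun x t)"
    using cell_point_step_fun[of n x t m w u] E F by auto
  have "F = translate (l \<cdot> j) (step_fun x t)"
    by (simp only: F(5) j(2) translate_translate[OF F(1) j(1) step_fun_closed[OF E(2)]])
  also have "step_fun x t = translate (inv\<^bsub>H\<^esub> k) E"
    by (rule translate_inv[OF E(1) step_fun_closed[OF E(2)] E(5)])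
  also have "translate (l \<cdot> j) (translate (inv\<^bsub>H\<^esub> k) E) = translate (l \<cdot> j \<cdot> inv\<^bsub>H\<^esub> k) E"
    using E F j steps_closed[OF orbit_steps[OF assms(1)]] by (intro translate_translate) simp_all
  finally show ?thesis using E F j by (intro bexI[of _ "l \<cdot> j \<cdot> inv\<^bsub>H\<^esub> k"]) simp_all
qed

definition orbit_ball :: "(real \<Rightarrow> 'h) \<Rightarrow> real \<Rightarrow> 'a list cell_set set" where
  "orbit_ball E r = {y \<in> topspace X. \<exists>F\<in>orbit y. step_dist F E < r}"

lemma cell_point_orbit_ball:
  assumes "x \<in> simplices K n" "t \<in> standard_simplex n"
  shows "cell_point K n x t \<in> orbit_ball E r \<longleftrightarrow>
     (\<exists>k\<in>carrier H. step_dist (translate k (step_fun x t)) E < r)"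
proof
  assume "cell_point K n x t \<in> orbit_ball E r"
  then obtain F where "F \<in> orbit (cell_point K n x t)" "step_dist F E < r" by (auto simp: orbit_ball_def)
  then show "\<exists>k\<in>carrier H. step_dist (translate k (step_fun x t)) E < r"
    using orbit_transitive[OF step_fun_orbit[OF assms]] by blast
next
  assume "\<exists>k\<in>carrier H. step_dist (translate k (step_fun x t)) E < r"
  then show "cell_point K n x t \<in> orbit_ball E r"
    using orbitI[OF _ assms] assms unfolding orbit_ball_def topspace_realization by blast
qed

text \<open>In the quotient topology openness is tested in each cell. There the preimage is the
  union, over all translations \<open>k\<close>, of the balls of
  \<open>openin_step_ball\<close>.\<close>

lemma openin_orbit_ball:
  assumes "E \<in> steps"
  shows "openin X (orbit_ball E r)"
proof -
  let ?q = "\<lambda>((n, x), t). cell_point K n x t"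
  have "openin (cell_space K) {p \<in> topspace (cell_space K). ?q p \<in> orbit_ball E r}"
    unfolding cell_space_def openin_sum_topology
  proof (intro conjI ballI)
    fix i assume "i \<in> (SIGMA n:UNIV. simplices K n)"
    then obtain n x where i: "i = (n, x)" "x \<in> simplices K n" by auto
    have "{t. (i, t) \<in> {p \<in> topspace (cell_space K). ?q p \<in> orbit_ball E r}} =
        (\<Union>k\<in>carrier H. {t \<in> standard_simplex n. step_dist (translate k (step_fun x t)) E < r})"
      using i by (auto simp: topspace_cell_space cell_point_orbit_ball)
    moreover have "openin (simplex_topology n) \<dots>"
      using openin_step_ball[OF i(2) _ assms] by auto
    ultimately show "openin (case i of (n, x) \<Rightarrow> simplex_topology n) {t. (i, t) \<in> {p \<in> topspace (sum_topology
        (\<lambda>(n, x). simplex_topology n) (SIGMA n:UNIV. simplices K n)). ?q p \<in> orbit_ball E r}}"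
      using i by (simp add: cell_space_def)
  qed auto
  moreover have "orbit_ball E r \<subseteq> topspace X" by (auto simp: orbit_ball_def)
  ultimately show ?thesis
    using quotient_map_realization[of K] unfolding quotient_map_def by blast
qed

lemma path_orbit_ball:
  assumes p: "pathin X p" and s: "0 \<le> s" "s \<le> 1" and E: "E \<in> orbit (p s)" and r: "r > 0"
  shows "\<exists>d>0. \<forall>s'\<in>{0..1}. \<bar>s - s'\<bar> < d \<longrightarrow> (\<exists>F\<in>orbit (p s'). step_dist F E < r)"
proof -
  have "openin (top_of_set {0..1}) {s \<in> {0..1}. p s \<in> orbit_ball E r}"
    using openin_continuous_map_preimage[OF p[unfolded pathin_def] openin_orbit_ball[OF orbit_steps[OF E]]] by simp
  moreover have "s \<in> {s \<in> {0..1}. p s \<in> orbit_ball E r}"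
    using s E r path_image_subset_topspace[OF p] by (force simp: orbit_ball_def)
  ultimately obtain d where "d > 0" "\<And>s'. s' \<in> {0..1} \<Longrightarrow> dist s' s < d \<Longrightarrow> s' \<in> {s \<in> {0..1}. p s \<in> orbit_ball E r}"
    unfolding openin_euclidean_subtopology_iff by blast
  then show ?thesis
    by (intro exI[of _ d]) (auto simp: orbit_ball_def dist_real_def abs_minus_commute)
qed

section \<open>Monodromy\<close>

text \<open>Lifts need not be continuous, only to have small jumps. Since distinct translates of a step
  function have distance 1, this determines them up to translation for \<open>\<epsilon> \<le> 1/2\<close>.\<close>

definition lift :: "real \<Rightarrow> real \<Rightarrow> real \<Rightarrow> (real \<Rightarrow> 'a list cell_set) \<Rightarrow> (real \<Rightarrow> real \<Rightarrow> 'h) \<Rightarrow> bool"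
  where "lift \<epsilon> a b p E \<longleftrightarrow> (\<forall>s\<in>{a..b}. E s \<in> orbit (p s)) \<and>
     (\<forall>s\<in>{a..b}. \<exists>d>0. \<forall>s'\<in>{a..b}. \<bar>s - s'\<bar> < d \<longrightarrow> step_dist (E s) (E s') < \<epsilon>)"

lemma lift_orbit: "lift \<epsilon> a b p E \<Longrightarrow> a \<le> s \<Longrightarrow> s \<le> b \<Longrightarrow> E s \<in> orbit (p s)"
  by (simp add: lift_def)

lemma lift_close: "lift \<epsilon> a b p E \<Longrightarrow> a \<le> s \<Longrightarrow> s \<le> b \<Longrightarrow>
    \<exists>d>0. \<forall>s'. a \<le> s' \<longrightarrow> s' \<le> b \<longrightarrow> \<bar>s - s'\<bar> < d \<longrightarrow> step_dist (E s) (E s') < \<epsilon>"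
  unfolding lift_def by (metis atLeastAtMost_iff)

lemma lift_translate:
  assumes "lift \<epsilon> a b p E" "k \<in> carrier H"
  shows "lift \<epsilon> a b p (\<lambda>s. translate k (E s))"
proof -
  have "step_dist (translate k (E s)) (translate k (E s')) = step_dist (E s) (E s')"
    if "s \<in> {a..b}" "s' \<in> {a..b}" for s s'
    using that assms by (intro step_dist_translate orbit_steps[of _ "p _"]) (auto simp: lift_def)
  then show ?thesis using assms translate_orbit unfolding lift_def by simp
qed

lemma lift_affine:
  assumes "lift \<epsilon> a b p E" "c > 0" "\<And>s. s \<in> {a'..b'} \<Longrightarrow> c * s + e \<in> {a..b}"
  shows "lift \<epsilon> a' b' (\<lambda>s. p (c * s + e)) (\<lambda>s. E (c * s + e))"
  unfolding lift_def
proof (intro conjI ballI)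
  fix s assume s: "s \<in> {a'..b'}"
  then show "E (c * s + e) \<in> orbit (p (c * s + e))" using assms by (simp add: lift_def)
  obtain d where d: "d > 0" "\<And>s'. s' \<in> {a..b} \<Longrightarrow> \<bar>c * s + e - s'\<bar> < d \<Longrightarrow> step_dist (E (c * s + e)) (E s') < \<epsilon>"
    using assms(1) assms(3)[OF s] unfolding lift_def by blast
  have "\<bar>c * s + e - (c * s' + e)\<bar> < d" if "\<bar>s - s'\<bar> < d / c" for s'
  proof -
    have "\<bar>c * s + e - (c * s' + e)\<bar> = c * \<bar>s - s'\<bar>"
      using assms(2) by (simp add: abs_mult flip: right_diff_distrib)
    then show ?thesis using that assms(2) by (simp add: field_simps)
  qed
  then show "\<exists>d>0. \<forall>s'\<in>{a'..b'}. \<bar>s - s'\<bar> < d \<longrightarrow> step_dist (E (c * s + e)) (E (c * s' + e)) < \<epsilon>"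
    using d assms(2,3) by (intro exI[of _ "d / c"]) auto
qed

lemma lift_cong:
  assumes "lift \<epsilon> a b p E" "\<And>s. s \<in> {a..b} \<Longrightarrow> p s = q s \<and> E s = F s"
  shows "lift \<epsilon> a b q F"
  using assms unfolding lift_def by simp

lemma lift_glue:
  assumes E: "lift \<epsilon> a b p E" and F: "lift \<epsilon> b c p F" and b: "E b = F b"
  shows "lift \<epsilon> a c p (\<lambda>s. if s \<le> b then E s else F s)"
proof -
  let ?D = "\<lambda>s. if s \<le> b then E s else F s"
  have D: "?D s = F s" if "s \<ge> b" for s using that b by auto
  have "\<exists>d>0. \<forall>s'\<in>{a..c}. \<bar>s - s'\<bar> < d \<longrightarrow> step_dist (?D s) (?D s') < \<epsilon>" if s: "s \<in> {a..c}" for s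
  proof -
    have "\<exists>d>0. \<forall>s'\<in>{a..c}. s' \<le> b \<longrightarrow> \<bar>s - s'\<bar> < d \<longrightarrow> step_dist (?D s) (?D s') < \<epsilon>"
    proof (cases "s \<le> b")
      case True
      then obtain d where "d > 0" "\<And>s'. a \<le> s' \<Longrightarrow> s' \<le> b \<Longrightarrow> \<bar>s - s'\<bar> < d \<Longrightarrow> step_dist (E s) (E s') < \<epsilon>"
        using lift_close[OF E, of s] s by auto
      then show ?thesis using True by (intro exI[of _ d]) auto
    \<comment> \<open>For \<open>s > b\<close> the radius \<open>s - b\<close> excludes every
      \<open>s' \<le> b\<close>.\<close>
    qed (intro exI[of _ "s - b"], auto)
    moreover have "\<exists>d>0. \<forall>s'\<in>{a..c}. s' \<ge> b \<longrightarrow> \<bar>s - s'\<bar> < d \<longrightarrow> step_dist (?D s) (?D s') < \<epsilon>"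
    proof (cases "s \<ge> b")
      case True
      then obtain d where "d > 0" "\<And>s'. b \<le> s' \<Longrightarrow> s' \<le> c \<Longrightarrow> \<bar>s - s'\<bar> < d \<Longrightarrow> step_dist (F s) (F s') < \<epsilon>"
        using lift_close[OF F, of s] s by auto
      then show ?thesis using True D by (intro exI[of _ d]) simp
    qed (intro exI[of _ "b - s"], auto)
    ultimately obtain d1 d2 where "d1 > 0" "d2 > 0"
      "\<forall>s'\<in>{a..c}. s' \<le> b \<longrightarrow> \<bar>s - s'\<bar> < d1 \<longrightarrow> step_dist (?D s) (?D s') < \<epsilon>"
      "\<forall>s'\<in>{a..c}. s' \<ge> b \<longrightarrow> \<bar>s - s'\<bar> < d2 \<longrightarrow> step_dist (?D s) (?D s') < \<epsilon>" by blast
    then show ?thesis by (intro exI[of _ "min d1 d2"]) (metis linear min_less_iff_conj)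
  qed
  then show ?thesis using E F unfolding lift_def by auto
qed

text \<open>Near \<open>x\<close> any choice of functions within \<open>\<epsilon> / 2\<close> of a
  fixed one has jumps below \<epsilon>, and a translation adjusts the initial value. Bisection then
  joins such pieces.\<close>

lemma lift_exists:
  assumes p: "pathin X p" and "\<epsilon> > 0" "a \<le> b" "0 \<le> a" "b \<le> 1" "E0 \<in> orbit (p a)"
  shows "\<exists>E. lift \<epsilon> a b p E \<and> E a = E0"
proof -
  let ?P = "\<lambda>a b. 0 \<le> a \<longrightarrow> a \<le> b \<longrightarrow> b \<le> 1 \<longrightarrow> (\<forall>E0\<in>orbit (p a). \<exists>E. lift \<epsilon> a b p E \<and> E a = E0)"
  have "?P a b"
    using \<open>a \<le> b\<close>
  proof (induction rule: Bolzano[where P="?P"])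
    case (trans a b c)
    show ?case
    proof (intro impI ballI)
      fix E0 assume c: "0 \<le> a" "a \<le> c" "c \<le> 1" "E0 \<in> orbit (p a)"
      then obtain E where E: "lift \<epsilon> a b p E" "E a = E0" using trans by fastforce
      then have "E b \<in> orbit (p b)" using lift_orbit trans by blast
      then obtain F where F: "lift \<epsilon> b c p F" "F b = E b" using trans c by fastforce
      show "\<exists>E. lift \<epsilon> a c p E \<and> E a = E0"
        using lift_glue[OF E(1) F(1)] E(2) F(2) trans
        by (intro exI[of _ "\<lambda>s. if s \<le> b then E s else F s"]) auto
    qed
  next
    case (local x)
    then have x: "0 \<le> x" "x \<le> 1" using assms by auto
    then have "p x \<in> topspace X" using path_image_subset_topspace[OF p] by auto
    then obtain E1 where E1: "E1 \<in> orbit (p x)" using orbit_nonempty by blast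
    obtain d where d: "d > 0" "\<And>s. s \<in> {0..1} \<Longrightarrow> \<bar>x - s\<bar> < d \<Longrightarrow> \<exists>F\<in>orbit (p s). step_dist F E1 < \<epsilon> / 2"
      using path_orbit_ball[OF p x E1, of "\<epsilon> / 2"] assms by auto
    have "?P a b" if ab: "a \<le> x \<and> x \<le> b \<and> b - a < d" for a b
    proof (intro impI ballI)
      fix E0 assume c: "0 \<le> a" "a \<le> b" "b \<le> 1" "E0 \<in> orbit (p a)"
      have "\<exists>F. F \<in> orbit (p s) \<and> step_dist F E1 < \<epsilon> / 2" if "s \<in> {a..b}" for s
      proof -
        have "\<bar>x - s\<bar> < d" "s \<in> {0..1}" using that ab c by auto
        then show ?thesis using d(2) by blast
      qed
      then obtain F where F: "\<And>s. s \<in> {a..b} \<Longrightarrow> F s \<in> orbit (p s) \<and> step_dist (F s) E1 < \<epsilon> / 2"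
        by metis
      have "step_dist (F s) (F s') < \<epsilon>" if "s \<in> {a..b}" "s' \<in> {a..b}" for s s'
      proof -
        have "step_dist (F s) (F s') \<le> step_dist (F s) E1 + step_dist E1 (F s')"
          using F that E1 orbit_steps by (intro step_dist_triangle) blast+
        then show ?thesis using F[OF that(1)] F[OF that(2)] by (simp add: step_dist_commute)
      qed
      then have L: "lift \<epsilon> a b p F" using F by (auto simp: lift_def intro: exI[of _ 1])
      obtain k where k: "k \<in> carrier H" "E0 = translate k (F a)"
        using orbit_transitive[of "F a" "p a" E0] F c by auto
      then show "\<exists>E. lift \<epsilon> a b p E \<and> E a = E0" using lift_translate[OF L] by blast
    qed
    then show ?case using d(1) by blast
  qed
  then show ?thesis using assms by blast
qed

text \<open>If \<open>k\<close> and \<open>l\<close> relate the two lifts at \<open>x\<close> and at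
  a nearby \<open>s\<close>, then the translates of \<open>E s\<close> by \<open>k\<close> and
  \<open>l\<close> are less than 1/2 + 1/2 apart, which forces \<open>k = l\<close>. Adjacent
  intervals are compared at their common point.\<close>

lemma lift_unique:
  assumes E: "lift (1/2) a b p E" and F: "lift (1/2) a b p F" and ab: "a \<le> b"
  shows "\<exists>k\<in>carrier H. \<forall>s\<in>{a..b}. F s = translate k (E s)"
proof -
  let ?P = "\<lambda>c d. a \<le> c \<longrightarrow> c \<le> d \<longrightarrow> d \<le> b \<longrightarrow> (\<exists>k\<in>carrier H. \<forall>s\<in>{c..d}. F s = translate k (E s))"
  have "?P a b"
    using ab
  proof (induction rule: Bolzano[where P="?P"])
    case (trans c m d)
    show ?case
    proof (intro impI)
      assume c: "a \<le> c" "c \<le> d" "d \<le> b"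
      obtain k where k: "k \<in> carrier H" "\<And>s. s \<in> {c..m} \<Longrightarrow> F s = translate k (E s)" using trans c by fastforce
      obtain l where l: "l \<in> carrier H" "\<And>s. s \<in> {m..d} \<Longrightarrow> F s = translate l (E s)" using trans c by fastforce
      have "translate k (E m) = translate l (E m)" using k(2)[of m] l(2)[of m] trans by simp
      then have "k = l"
        using step_dist_translate_self[OF k(1) l(1) orbit_steps[OF lift_orbit[OF E, of m]]] trans c by simp
      then show "\<exists>k\<in>carrier H. \<forall>s\<in>{c..d}. F s = translate k (E s)"
        using k l by (intro bexI[of _ k] ballI) (metis atLeastAtMost_iff linear)
    qed
  next
    case (local x)
    obtain d1 where d1: "d1 > 0" "\<And>s'. a \<le> s' \<Longrightarrow> s' \<le> b \<Longrightarrow> \<bar>x - s'\<bar> < d1 \<Longrightarrow> step_dist (E x) (E s') < 1/2"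
      using lift_close[OF E local] by blast
    obtain d2 where d2: "d2 > 0" "\<And>s'. a \<le> s' \<Longrightarrow> s' \<le> b \<Longrightarrow> \<bar>x - s'\<bar> < d2 \<Longrightarrow> step_dist (F x) (F s') < 1/2"
      using lift_close[OF F local] by blast
    obtain k where k: "k \<in> carrier H" "F x = translate k (E x)"
      using orbit_transitive[OF lift_orbit[OF E local] lift_orbit[OF F local]] by blast
    have "F s = translate k (E s)" if s: "a \<le> s" "s \<le> b" "\<bar>x - s\<bar> < min d1 d2" for s
    proof -
      note st = orbit_steps[OF lift_orbit[OF E s(1,2)]] orbit_steps[OF lift_orbit[OF F s(1,2)]]
        orbit_steps[OF lift_orbit[OF E local]] orbit_steps[OF lift_orbit[OF F local]]
      obtain l where l: "l \<in> carrier H" "F s = translate l (E s)"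
        using orbit_transitive[OF lift_orbit[OF E s(1,2)] lift_orbit[OF F s(1,2)]] by blast
      have "step_dist (translate k (E s)) (translate l (E s)) \<le>
          step_dist (translate k (E s)) (translate k (E x)) + step_dist (translate k (E x)) (translate l (E s))"
        using st k l by (intro step_dist_triangle translate_steps)
      also have "step_dist (translate k (E s)) (translate k (E x)) = step_dist (E x) (E s)"
        using st k by (simp add: step_dist_translate step_dist_commute)
      also have "step_dist (translate k (E x)) (translate l (E s)) = step_dist (F x) (F s)"
        using k l by simp
      finally have "step_dist (translate k (E s)) (translate l (E s)) < 1"
        using d1(2)[of s] d2(2)[of s] s by simp
      then show ?thesis using step_dist_translate_self[OF k(1) l(1) st(1)] l by simp
    qed
    then have "?P c d" if "c \<le> x \<and> x \<le> d \<and> d - c < min d1 d2" for c d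
      using that k(1) by (intro impI bexI[of _ k] ballI) (simp, smt (verit))
    then show ?case using d1(1) d2(1) by (intro exI[of _ "min d1 d2"]) simp
  qed
  then show ?thesis using ab by blast
qed

abbreviation x0 where "x0 \<equiv> realization_vertex K []"

abbreviation const :: "'h \<Rightarrow> real \<Rightarrow> 'h" where "const k \<equiv> (\<lambda>s\<in>{0..<1}. k)"

lemma nil_simplex: "[] \<in> simplices K 0"
  by (simp add: commuting_nerve_def nerve_def)

lemma x0_cell: "x0 = cell_point K 0 [] (\<lambda>i. if i = 0 then 1 else 0)"
  by (simp add: realization_vertex_def cell_point_def)

lemma x0_topspace: "x0 \<in> topspace X"
  unfolding topspace_realization using nil_simplex x0_cell basis_in_standard_simplex[of 0 0] by blast

lemma const_orbit: "k \<in> carrier H \<Longrightarrow> const k \<in> orbit x0"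
proof -
  have "step_fun [] t = const \<one>\<^bsub>H\<^esub>" for t
    by (simp add: step_fun_def vertex_def list_mult_def iota_one)
  then show "k \<in> carrier H \<Longrightarrow> const k \<in> orbit x0"
    using orbitI[OF _ nil_simplex, of k "\<lambda>i. if i = 0 then 1 else 0"]
    by (simp add: x0_cell translate_def cong: restrict_cong)
qed

lemma const_eq_iff: "const k = const l \<longleftrightarrow> k = l"
  by (metis atLeastLessThan_iff less_numeral_extra(1) order_refl restrict_apply')

lemma translate_const: "translate k (const l) = const (k \<cdot> l)"
  by (auto simp: translate_def)

lemma orbit_x0: "E \<in> orbit x0 \<Longrightarrow> \<exists>k\<in>carrier H. E = const k"
  using orbit_transitive[OF const_orbit[OF H.one_closed], of E] by (auto simp: translate_const)

definition monodromy :: "(real \<Rightarrow> 'a list cell_set) \<Rightarrow> 'h \<Rightarrow> bool" where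
  "monodromy p k \<longleftrightarrow> k \<in> carrier H \<and> (\<exists>E. lift (1/2) 0 1 p E \<and> E 0 = const \<one>\<^bsub>H\<^esub> \<and> E 1 = const k)"

lemma monodromy_lift:
  assumes "loop_in X x0 p" "\<epsilon> > 0"
  shows "\<exists>E k. k \<in> carrier H \<and> lift \<epsilon> 0 1 p E \<and> E 0 = const \<one>\<^bsub>H\<^esub> \<and> E 1 = const k"
proof -
  have "\<exists>E. lift \<epsilon> 0 1 p E \<and> E 0 = const \<one>\<^bsub>H\<^esub>"
    using assms const_orbit by (intro lift_exists) (auto simp: loop_in_def)
  then obtain E where E: "lift \<epsilon> 0 1 p E" "E 0 = const \<one>\<^bsub>H\<^esub>" by blast
  then have "E 1 \<in> orbit x0" using lift_orbit[OF E(1), of 1] assms by (simp add: loop_in_def)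
  then show ?thesis using E orbit_x0 by blast
qed

lemma monodromy_exists: "loop_in X x0 p \<Longrightarrow> \<exists>k. monodromy p k"
  using monodromy_lift[of p "1/2"] unfolding monodromy_def by auto

lemma monodromy_unique:
  assumes "monodromy p k" "monodromy p l"
  shows "k = l"
proof -
  obtain E where E: "lift (1/2) 0 1 p E" "E 0 = const \<one>\<^bsub>H\<^esub>" "E 1 = const k" and k: "k \<in> carrier H"
    using assms(1) by (auto simp: monodromy_def)
  obtain F where F: "lift (1/2) 0 1 p F" "F 0 = const \<one>\<^bsub>H\<^esub>" "F 1 = const l"
    using assms(2) by (auto simp: monodromy_def)
  obtain j where j: "j \<in> carrier H" "\<And>s. s \<in> {0..1} \<Longrightarrow> F s = translate j (E s)"
    using lift_unique[OF E(1) F(1)] by auto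
  have "j = \<one>\<^bsub>H\<^esub>" using j(2)[of 0] j(1) E F by (simp add: translate_const const_eq_iff)
  then show ?thesis using j(2)[of 1] k E F by (simp add: translate_const const_eq_iff)
qed

text \<open>The lift of \<open>q\<close> is translated by \<open>k\<close> to begin where the lift
  of \<open>p\<close> ends. As translations act on the left, its end value is
  \<open>k \<cdot> l\<close> in the order of the paths.\<close>

lemma monodromy_concat:
  assumes "monodromy p k" "monodromy q l" "p 1 = q 0"
  shows "monodromy (path_concat p q) (k \<cdot> l)"
proof -
  obtain E where E: "lift (1/2) 0 1 p E" "E 0 = const \<one>\<^bsub>H\<^esub>" "E 1 = const k" and k: "k \<in> carrier H"
    using assms(1) by (auto simp: monodromy_def)
  obtain F where F: "lift (1/2) 0 1 q F" "F 0 = const \<one>\<^bsub>H\<^esub>" "F 1 = const l" and l: "l \<in> carrier H"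
    using assms(2) by (auto simp: monodromy_def)
  let ?F = "\<lambda>s. translate k (F s)"
  have "lift (1/2) 0 (1/2) (path_concat p q) (\<lambda>s. E (2 * s))"
    using lift_affine[OF E(1), of 2 0 "1/2" 0] by (rule lift_cong) (auto simp: path_concat_def)
  moreover have "lift (1/2) (1/2) 1 (\<lambda>s. q (2 * s + -1)) (\<lambda>s. ?F (2 * s + -1))"
    by (rule lift_affine[OF lift_translate[OF F(1) k]]) auto
  then have "lift (1/2) (1/2) 1 (path_concat p q) (\<lambda>s. ?F (2 * s - 1))"
  proof (rule lift_cong)
    fix s :: real assume s: "s \<in> {1/2..1}"
    show "q (2 * s + -1) = path_concat p q s \<and> ?F (2 * s + -1) = ?F (2 * s - 1)"
    proof (cases "s = 1/2")
      case True
      show ?thesis unfolding True using assms(3) by (simp add: path_concat_def)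
    qed (use s in \<open>auto simp: path_concat_def\<close>)
  qed
  ultimately have "lift (1/2) 0 1 (path_concat p q) (\<lambda>s. if s \<le> 1/2 then E (2 * s) else ?F (2 * s - 1))"
    using E F k by (intro lift_glue) (auto simp: translate_const)
  then show ?thesis
    unfolding monodromy_def using E F k l
    by (intro conjI exI[of _ "\<lambda>s. if s \<le> 1/2 then E (2 * s) else ?F (2 * s - 1)"]) (auto simp: translate_const)
qed

text \<open>The constants satisfy \<open>3/16 + 1/8 + 3/16 = 1/2\<close>, the bound on the jumps in \<open>monodromy\<close>.\<close>

lemma monodromy_perturb:
  assumes E: "lift (1/8) 0 1 p E" "E 0 = const \<one>\<^bsub>H\<^esub>" "E 1 = const k" "k \<in> carrier H"
    and q: "q 0 = x0" "q 1 = x0" "\<And>s. 0 \<le> s \<Longrightarrow> s \<le> 1 \<Longrightarrow> \<exists>F\<in>orbit (q s). step_dist F (E s) < 3/16"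
  shows "monodromy q k"
proof -
  obtain F where F: "\<And>s. 0 \<le> s \<Longrightarrow> s \<le> 1 \<Longrightarrow> F s \<in> orbit (q s) \<and> step_dist (F s) (E s) < 3/16"
    using q(3) by metis
  \<comment> \<open>At the two ends the values of \<open>E\<close> are kept, so that the end values
    of the new lift are the prescribed ones.\<close>
  define D where "D s = (if s = 0 \<or> s = 1 then E s else F s)" for s
  have D: "D s \<in> orbit (q s) \<and> step_dist (D s) (E s) < 3/16" if "0 \<le> s" "s \<le> 1" for s
    using F[OF that] E q const_orbit by (auto simp: D_def)
  have "step_dist (D s) (D s') < 1/2"
    if s: "0 \<le> s" "s \<le> 1" "0 \<le> s'" "s' \<le> 1" "step_dist (E s) (E s') < 1/8" for s s'
  proof -
    note st = orbit_steps[OF lift_orbit[OF E(1) s(1,2)]] orbit_steps[OF lift_orbit[OF E(1) s(3,4)]]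
      orbit_steps[of "D s" "q s"] orbit_steps[of "D s'" "q s'"]
    have "step_dist (D s) (D s') \<le> step_dist (D s) (E s) + step_dist (E s) (D s')"
      using st D s by (intro step_dist_triangle) auto
    also have "step_dist (E s) (D s') \<le> step_dist (E s) (E s') + step_dist (E s') (D s')"
      using st D s by (intro step_dist_triangle) auto
    finally show ?thesis using D[OF s(1,2)] D[OF s(3,4)] s(5) by (simp add: step_dist_commute)
  qed
  then have "lift (1/2) 0 1 q D"
    using D E(1) unfolding lift_def by (meson atLeastAtMost_iff)
  then show ?thesis unfolding monodromy_def using E by (auto simp: D_def intro!: exI[of _ D])
qed

text \<open>A tube lemma, with compactness of the interval entering through bisection in
  \<open>s\<close>. Near \<open>(u, s)\<close> there are functions within 1/16 of
  \<open>E s\<close>, and \<open>E s'\<close> is within 1/8 of \<open>E s\<close>; the sum is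
  3/16.\<close>

lemma lift_uniformly_close:
  assumes h: "continuous_map (top_of_set ({0..1::real} \<times> {0..1::real})) X h" and u: "u \<in> {0..1}"
    and E: "lift (1/8) 0 1 (\<lambda>s. h (u, s)) E"
  shows "\<exists>e>0. \<forall>v\<in>{0..1}. \<forall>s\<in>{0..1}. \<bar>u - v\<bar> < e \<longrightarrow> (\<exists>F\<in>orbit (h (v, s)). step_dist F (E s) < 3/16)"
proof -
  define near where "near v s \<longleftrightarrow> (\<exists>F\<in>orbit (h (v, s)). step_dist F (E s) < 3/16)" for v s
  let ?Q = "\<lambda>c d. \<exists>e>0. \<forall>v\<in>{0..1}. \<forall>s\<in>{0..1}. \<bar>u - v\<bar> < e \<longrightarrow> c \<le> s \<longrightarrow> s \<le> d \<longrightarrow> near v s"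
  have "?Q 0 1"
  proof (rule Bolzano[where P="?Q"])
    show "(0::real) \<le> 1" by simp
  next
    fix a b c :: real
    assume "?Q a b" "?Q b c" "a \<le> b" "b \<le> c"
    then obtain e1 e2 where "e1 > 0" "e2 > 0"
      "\<forall>v\<in>{0..1}. \<forall>s\<in>{0..1}. \<bar>u - v\<bar> < e1 \<longrightarrow> a \<le> s \<longrightarrow> s \<le> b \<longrightarrow> near v s"
      "\<forall>v\<in>{0..1}. \<forall>s\<in>{0..1}. \<bar>u - v\<bar> < e2 \<longrightarrow> b \<le> s \<longrightarrow> s \<le> c \<longrightarrow> near v s"
      by blast
    then show "?Q a c" by (intro exI[of _ "min e1 e2"]) (metis linear min_less_iff_conj)
  next
    fix s :: real assume s: "0 \<le> s" "s \<le> 1"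
    have Es: "E s \<in> orbit (h (u, s))" using lift_orbit[OF E s] .
    let ?U = "{z \<in> {0..1} \<times> {0..1}. h z \<in> orbit_ball (E s) (1/16)}"
    have op: "openin (top_of_set ({0..1} \<times> {0..1})) ?U"
      using openin_continuous_map_preimage[OF h openin_orbit_ball[OF orbit_steps[OF Es]]] by simp
    have "h (u, s) \<in> topspace X" using continuous_map_funspace[OF h] u s by auto
    then have us: "(u, s) \<in> ?U"
      using s u Es by (auto simp: orbit_ball_def intro!: bexI[of _ "E s"])
    obtain e where e: "e > 0" "\<forall>z\<in>{0..1} \<times> {0..1}. dist z (u, s) < e \<longrightarrow> z \<in> ?U"
      using op[unfolded openin_euclidean_subtopology_iff, THEN conjunct2, THEN bspec, OF us] by blast
    obtain d where d: "d > 0" "\<And>s'. 0 \<le> s' \<Longrightarrow> s' \<le> 1 \<Longrightarrow> \<bar>s - s'\<bar> < d \<Longrightarrow> step_dist (E s) (E s') < 1/8"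
      using lift_close[OF E s] by blast
    have main: "near v s'"
      if v: "v \<in> {0..1}" "s' \<in> {0..1}" "\<bar>u - v\<bar> < e/2" "\<bar>s - s'\<bar> < min (e/2) d" for v s'
    proof -
      have "dist (v, s') (u, s) \<le> \<bar>v - u\<bar> + \<bar>s' - s\<bar>"
        using sqrt_sum_squares_le_sum_abs[of "v - u" "s' - s"] by (simp add: dist_Pair_Pair dist_real_def)
      also have "\<dots> < e" using v(3,4) by linarith
      finally have "(v, s') \<in> ?U" using e(2) v(1,2) by blast
      then obtain F where F: "F \<in> orbit (h (v, s'))" "step_dist F (E s) < 1/16"
        by (auto simp: orbit_ball_def)
      have "step_dist F (E s') \<le> step_dist F (E s) + step_dist (E s) (E s')"
        using F(1) Es lift_orbit[OF E, of s'] v orbit_steps by (intro step_dist_triangle) auto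
      then have "step_dist F (E s') < 3/16" using F d(2)[of s'] v by auto
      then show ?thesis using F(1) by (auto simp: near_def)
    qed
    have "?Q a b" if "a \<le> s \<and> s \<le> b \<and> b - a < min (e/2) d" for a b
    proof -
      have "\<bar>s - s'\<bar> < min (e/2) d" if "a \<le> s'" "s' \<le> b" for s'
        using that \<open>a \<le> s \<and> s \<le> b \<and> b - a < min (e/2) d\<close> by linarith
      then show ?thesis using e(1) main by (intro exI[of _ "e/2"]) simp
    qed
    then show "\<exists>\<delta>>0. \<forall>a b. a \<le> s \<and> s \<le> b \<and> b - a < \<delta> \<longrightarrow> ?Q a b"
      using e(1) d(1) by (intro exI[of _ "min (e/2) d"]) simp
  qed
  then show ?thesis unfolding near_def by auto
qed

text \<open>A lift of the loop at time \<open>u\<close> with jumps below 1/8 also serves, after a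
  small change, for all loops at nearby times. So the monodromy is locally constant in the time,
  hence constant on [0,1].\<close>

lemma monodromy_homotopic:
  assumes hom: "path_homotopic X p q" and p: "p 0 = x0" "p 1 = x0"
  shows "monodromy p k \<longleftrightarrow> monodromy q k"
proof -
  obtain h where h: "continuous_map (top_of_set ({0..1::real} \<times> {0..1::real})) X h"
    "\<And>s. s \<in> {0..1} \<Longrightarrow> h (0, s) = p s \<and> h (1, s) = q s"
    "\<And>t. t \<in> {0..1} \<Longrightarrow> h (t, 0) = p 0 \<and> h (t, 1) = p 1"
    by (rule path_homotopicE[OF hom]) (rule that)
  define P where "P u = (\<lambda>s. h (u, s))" for u
  have pair: "continuous_on {0..1::real} (Pair u)" for u :: real by (intro continuous_intros)
  have loop: "loop_in X x0 (P u)" if "u \<in> {0..1}" for u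
    using that h(3)[OF that] p continuous_map_top_of_set_compose[OF h(1), of "{0..1}" "\<lambda>s. (u, s)"]
    by (auto simp: loop_in_def P_def pathin_def pair)
  let ?P = "\<lambda>a b. 0 \<le> a \<longrightarrow> a \<le> b \<longrightarrow> b \<le> 1 \<longrightarrow> (\<forall>k. monodromy (P a) k \<longleftrightarrow> monodromy (P b) k)"
  have "?P 0 1"
  proof (rule Bolzano[where P="?P"])
    show "(0::real) \<le> 1" by simp
  next
    fix a b c :: real
    assume "?P a b" "?P b c" "a \<le> b" "b \<le> c"
    then show "?P a c" by auto
  next
    fix u :: real assume "0 \<le> u" "u \<le> 1"
    then have u: "u \<in> {0..1}" by simp
    obtain E k where E: "lift (1/8) 0 1 (P u) E" "E 0 = const \<one>\<^bsub>H\<^esub>" "E 1 = const k" "k \<in> carrier H"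
      using monodromy_lift[OF loop[OF u], of "1/8"] by auto
    have "(\<lambda>s. h (u, s)) = P u" by (simp add: P_def)
    then obtain e where e: "e > 0" "\<And>v s. v \<in> {0..1} \<Longrightarrow> s \<in> {0..1} \<Longrightarrow> \<bar>u - v\<bar> < e \<Longrightarrow>
        (\<exists>F\<in>orbit (P v s). step_dist F (E s) < 3/16)"
      using lift_uniformly_close[OF h(1) u, of E] E(1) unfolding P_def by auto
    have k: "monodromy (P v) k" if "v \<in> {0..1}" "\<bar>u - v\<bar> < e" for v
      using monodromy_perturb[OF E, of "P v"] e(2) that loop[OF that(1)] by (auto simp: loop_in_def)
    have "?P a b" if "a \<le> u \<and> u \<le> b \<and> b - a < e" for a b
    proof (intro impI allI)
      fix l assume "0 \<le> a" "a \<le> b" "b \<le> 1"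
      then have "monodromy (P a) k" "monodromy (P b) k" using that by (auto intro!: k)
      then show "monodromy (P a) l \<longleftrightarrow> monodromy (P b) l" using monodromy_unique by blast
    qed
    then show "\<exists>d>0. \<forall>a b. a \<le> u \<and> u \<le> b \<and> b - a < d \<longrightarrow> ?P a b" using e(1) by blast
  qed
  then have *: "monodromy (P 0) k \<longleftrightarrow> monodromy (P 1) k" by simp
  have "lift \<epsilon> 0 1 (P 0) E \<longleftrightarrow> lift \<epsilon> 0 1 p E" "lift \<epsilon> 0 1 (P 1) E \<longleftrightarrow> lift \<epsilon> 0 1 q E" for \<epsilon> E
    using h(2) by (auto simp: lift_def P_def)
  then show ?thesis using * by (simp add: monodromy_def)
qed

end

section \<open>Straight lines in a cell\<close>

definition mix :: "real \<Rightarrow> (nat \<Rightarrow> real) \<Rightarrow> (nat \<Rightarrow> real) \<Rightarrow> nat \<Rightarrow> real" where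
  "mix s t u = (\<lambda>i. (1 - s) * t i + s * u i)"

definition corner :: "nat \<Rightarrow> nat \<Rightarrow> real" where
  "corner i = (\<lambda>j. if j = i then 1 else 0)"

definition line :: "'a sset \<Rightarrow> nat \<Rightarrow> 'a \<Rightarrow> (nat \<Rightarrow> real) \<Rightarrow> (nat \<Rightarrow> real) \<Rightarrow> real \<Rightarrow> 'a cell_set"
  where "line K n x t u s = cell_point K n x (mix s t u)"

lemma mix_0 [simp]: "mix 0 t u = t" and mix_1 [simp]: "mix 1 t u = u" and mix_same [simp]: "mix s t t = t"
  by (auto simp: mix_def algebra_simps)

lemma corner_in [simp]: "corner i \<in> standard_simplex n \<longleftrightarrow> i \<le> n"
  unfolding corner_def by simp

lemma mix_in:
  assumes "t \<in> standard_simplex n" "u \<in> standard_simplex n" "0 \<le> s" "s \<le> 1"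
  shows "mix s t u \<in> standard_simplex n"
proof -
  note t = standard_simplexD[OF assms(1)] and u = standard_simplexD[OF assms(2)]
  have "(1 - s) * t i + s * u i \<le> (1 - s) * 1 + s * 1" for i
    using t(2) u(2) assms by (intro add_mono mult_left_mono) auto
  then show ?thesis
    using t u assms by (auto simp: standard_simplex_def mix_def sum.distrib simp flip: sum_distrib_left)
qed

lemma simplex_push_alt: "simplex_push m \<theta> t j = (\<Sum>i\<le>m. if \<theta> i = j then t i else 0)"
  unfolding simplex_push_def by (simp add: sum.inter_filter[symmetric] Collect_conj_eq atMost_def)

lemma simplex_push_mix: "simplex_push m \<theta> (mix s t u) = mix s (simplex_push m \<theta> t) (simplex_push m \<theta> u)"
  by (rule ext) (simp add: simplex_push_def mix_def sum.distrib sum_distrib_left)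

lemma simplex_push_corner:
  assumes "i \<le> m"
  shows "simplex_push m \<theta> (corner i) = corner (\<theta> i)"
proof
  fix j
  have "simplex_push m \<theta> (corner i) j = (\<Sum>k\<le>m. if k = i then (if \<theta> i = j then 1 else 0) else 0)"
    unfolding simplex_push_alt by (intro sum.cong) (auto simp: corner_def)
  then show "simplex_push m \<theta> (corner i) j = corner (\<theta> i) j" using assms by (simp add: corner_def)
qed

lemma continuous_map_simplexI:
  assumes "\<And>i. continuous_map Y euclideanreal (\<lambda>y. f y i)" "\<And>y. y \<in> topspace Y \<Longrightarrow> f y \<in> standard_simplex n"
  shows "continuous_map Y (simplex_topology n) f"
  using assms by (auto simp: continuous_map_in_subtopology continuous_map_componentwise_UNIV)

lemma continuous_map_simplex_coordinate:
  assumes "continuous_map Y (simplex_topology n) f"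
  shows "continuous_map Y euclideanreal (\<lambda>y. f y i)"
  using assms by (auto simp: continuous_map_in_subtopology continuous_map_componentwise_UNIV)

lemma pathin_mix:
  assumes "t \<in> standard_simplex n" "u \<in> standard_simplex n"
  shows "pathin (simplex_topology n) (\<lambda>s. mix s t u)"
  unfolding pathin_def
  by (intro continuous_map_simplexI) (auto simp: mix_in assms, auto simp: mix_def intro!: continuous_intros)

lemma path_homotopic_cell:
  assumes x: "x \<in> simplices K n" and p: "pathin (simplex_topology n) p" and q: "pathin (simplex_topology n) q"
    and e: "p 0 = q 0" "p 1 = q 1"
  shows "path_homotopic (geometric_realization K) (\<lambda>s. cell_point K n x (p s)) (\<lambda>s. cell_point K n x (q s))"
proof -
  let ?Z = "simplex_topology n" and ?I = "top_of_set {0..1::real}"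
  let ?P = "prod_topology ?I (prod_topology ?Z ?Z)"
  have a: "continuous_map ?P ?Z (\<lambda>z. fst (snd z))" "continuous_map ?P ?Z (\<lambda>z. snd (snd z))"
    using continuous_map_compose[OF continuous_map_snd continuous_map_fst]
      continuous_map_compose[OF continuous_map_snd continuous_map_snd] by (simp_all add: o_def)
  have b: "continuous_map ?P euclideanreal fst"
    using continuous_map_fst[of ?I "prod_topology ?Z ?Z"] unfolding continuous_map_in_subtopology by blast
  have "continuous_map ?P ?Z (\<lambda>z. mix (fst z) (fst (snd z)) (snd (snd z)))"
  proof (rule continuous_map_simplexI)
    show "continuous_map ?P euclideanreal (\<lambda>z. mix (fst z) (fst (snd z)) (snd (snd z)) i)" for i
      unfolding mix_def
      using continuous_map_simplex_coordinate[OF a(1)] continuous_map_simplex_coordinate[OF a(2)] b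
      by (intro continuous_intros) auto
  qed (auto simp: mix_in)
  then have "path_homotopic ?Z p q"
    using assms
    by (intro path_homotopic_convex[where m="\<lambda>z. mix (fst z) (fst (snd z)) (snd (snd z))"]) auto
  from path_homotopic_image[OF this continuous_map_cell_point[OF x]] show ?thesis by (simp add: o_def)
qed

lemma pathin_cell:
  "x \<in> simplices K n \<Longrightarrow> pathin (simplex_topology n) p
     \<Longrightarrow> pathin (geometric_realization K) (\<lambda>s. cell_point K n x (p s))"
  using pathin_compose[OF _ continuous_map_cell_point] by (fastforce simp: o_def)

lemma pathin_line:
  "x \<in> simplices K n \<Longrightarrow> t \<in> standard_simplex n \<Longrightarrow> u \<in> standard_simplex n
     \<Longrightarrow> pathin (geometric_realization K) (line K n x t u)"
  unfolding line_def[abs_def] by (intro pathin_cell pathin_mix)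

lemma line_ends [simp]: "line K n x t u 0 = cell_point K n x t" "line K n x t u 1 = cell_point K n x u"
  by (simp_all add: line_def)

lemma line_concat:
  assumes "x \<in> simplices K n" "t \<in> standard_simplex n" "u \<in> standard_simplex n" "w \<in> standard_simplex n"
  shows "path_homotopic (geometric_realization K) (path_concat (line K n x t u) (line K n x u w)) (line K n x t w)"
proof -
  have "pathin (simplex_topology n) (path_concat (\<lambda>s. mix s t u) (\<lambda>s. mix s u w))"
    using assms by (intro pathin_concat pathin_mix) auto
  then have "path_homotopic (geometric_realization K)
     (\<lambda>s. cell_point K n x (path_concat (\<lambda>s. mix s t u) (\<lambda>s. mix s u w) s)) (line K n x t w)"
    unfolding line_def[abs_def] using assms by (intro path_homotopic_cell pathin_mix) auto
  moreover have "(\<lambda>s. cell_point K n x (path_concat (\<lambda>s. mix s t u) (\<lambda>s. mix s u w) s)) =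
     path_concat (line K n x t u) (line K n x u w)"
    by (simp add: path_concat_def line_def fun_eq_iff)
  ultimately show ?thesis by simp
qed

lemma line_push:
  assumes "\<theta> \<in> simplex_maps m n" "x \<in> simplices K n" "t \<in> standard_simplex m" "u \<in> standard_simplex m"
    "0 \<le> s" "s \<le> 1"
  shows "line K m (sact K m n \<theta> x) t u s = line K n x (simplex_push m \<theta> t) (simplex_push m \<theta> u) s"
  using assms by (simp add: line_def cell_point_glue mix_in simplex_push_mix)

context commuting_map begin

lemma segment_closed:
  "x \<in> simplices K n \<Longrightarrow> j \<le> n \<Longrightarrow> list_mult G (map (nth x) [i..<j]) \<in> carrier G"
  using simplicesD[of x n] by (intro G.list_mult_closed) (auto simp: subset_iff)

lemma vertex_segment:
  assumes x: "x \<in> simplices K n" and ij: "i \<le> j" "j \<le> n"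
  shows "vertex G x i \<otimes>\<^bsub>G\<^esub> list_mult G (map (nth x) [i..<j]) = vertex G x j"
proof -
  note xx = simplicesD[OF x]
  have tk: "take k x = map (nth x) [0..<k]" if "k \<le> n" for k
    using that xx by (intro nth_equalityI) auto
  have "vertex G x j = list_mult G (map (nth x) ([0..<i] @ [i..<j]))"
    using tk[of j] ij upt_add_eq_append[of 0 i "j - i"] by (simp add: vertex_def)
  also have "\<dots> = vertex G x i \<otimes>\<^bsub>G\<^esub> list_mult G (map (nth x) [i..<j])"
    using xx ij tk[of i] unfolding map_append by (subst G.list_mult_append) (auto simp: vertex_def subset_iff)
  finally show ?thesis by simp
qed

lemma sact_nerve: "sact K m n \<theta> x = map (\<lambda>i. list_mult G (map (nth x) [\<theta> i..<\<theta> (Suc i)])) [0..<m]"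
  by (simp add: commuting_nerve_def nerve_def)

text \<open>A face whose vertices all agree is collapsed: it is fixed by a monotone map \<open>\<rho>\<close> onto \<open>A\<close>,
  along which the simplex pulls back to a totally degenerate one.\<close>

lemma cell_point_constant_face:
  assumes x: "x \<in> simplices K n" and t: "t \<in> standard_simplex n" and A: "A \<subseteq> {..n}" "a \<in> A"
    and same: "\<And>i j. i \<in> A \<Longrightarrow> j \<in> A \<Longrightarrow> vertex G x i = vertex G x j" and supp: "\<And>i. i \<notin> A \<Longrightarrow> t i = 0"
  shows "cell_point K n x t = x0"
proof -
  \<comment> \<open>\<open>\<rho> i\<close> is the largest element of \<open>A\<close> up to
    \<open>i\<close>, or the least element of \<open>A\<close> when \<open>i\<close> precedes all of
    them: a monotone retraction onto \<open>A\<close>.\<close>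
  define \<rho> where "\<rho> i = Max (insert (Min A) {j \<in> A. j \<le> i})" for i
  have fA: "finite A" using A(1) finite_subset by blast
  have Min: "Min A \<in> A" using fA A(2) Min_in by blast
  have rho_A: "\<rho> i \<in> A" for i
    using Max_in[of "insert (Min A) {j \<in> A. j \<le> i}"] fA Min unfolding \<rho>_def by auto
  have rho_fix: "\<rho> i = i" if "i \<in> A" for i
    unfolding \<rho>_def using that fA Min_le[OF fA that] by (intro Max_eqI) auto
  have rho_mono: "\<rho> i \<le> \<rho> j" if "i \<le> j" for i j
    unfolding \<rho>_def using fA that by (intro Max_mono) auto
  have rho: "\<rho> \<in> simplex_maps n n"
    using rho_mono rho_A A(1) by (auto simp: simplex_maps_def mono_on_def)
  have moved: "t i = 0" if "\<rho> i \<noteq> i" for i using that rho_fix supp by blast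
  have push: "simplex_push n \<rho> t = t"
  proof
    fix j
    have "simplex_push n \<rho> t j = (\<Sum>i\<le>n. if i = j \<and> j \<in> A then t j else 0)"
      unfolding simplex_push_alt using moved rho_fix rho_A by (intro sum.cong) auto
    also have "\<dots> = t j" using supp A(1) by (cases "j \<in> A") auto
    finally show "simplex_push n \<rho> t j = t j" .
  qed
  let ?c = "\<lambda>_::nat. 0::nat"
  have "list_mult G (map (nth x) [\<rho> i..<\<rho> (Suc i)]) = \<one>\<^bsub>G\<^esub>" if "i < n" for i
  proof -
    have 1: "\<rho> i \<le> \<rho> (Suc i)" "\<rho> (Suc i) \<le> n" using rho_mono rho_A A(1) by auto
    have "vertex G x (\<rho> i) \<otimes>\<^bsub>G\<^esub> list_mult G (map (nth x) [\<rho> i..<\<rho> (Suc i)]) = vertex G x (\<rho> i)"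
      using vertex_segment[OF x 1] same rho_A by simp
    then show ?thesis using vertex_closed[OF x] segment_closed[OF x 1(2)] by simp
  qed
  \<comment> \<open>All edges of the pulled back simplex are trivial, so it is also the pullback of
    the empty tuple along the constant map \<open>?c\<close>.\<close>
  then have "sact K n n \<rho> x = sact K n 0 ?c []"
    unfolding sact_nerve by (simp add: list_mult_def)
  moreover have "cell_point K n (sact K n n \<rho> x) t = cell_point K n x t"
    using cell_point_glue[OF rho x t] push by simp
  moreover have c: "?c \<in> simplex_maps n 0" by (auto simp: simplex_maps_def mono_on_def)
  then have "cell_point K n (sact K n 0 ?c []) t = cell_point K 0 [] (simplex_push n ?c t)"
    by (rule cell_point_glue[OF _ nil_simplex t])
  moreover have "simplex_push n ?c t = (\<lambda>i. if i = 0 then 1 else 0)"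
    using simplex_push_in[OF c t] unfolding standard_simplex_0 by simp
  ultimately show ?thesis by (simp add: x0_cell)
qed

lemma cell_point_corner: "x \<in> simplices K n \<Longrightarrow> i \<le> n \<Longrightarrow> cell_point K n x (corner i) = x0"
  by (rule cell_point_constant_face[where A="{i}"]) (auto simp: corner_def)

section \<open>Edge loops\<close>

definition edge :: "'a \<Rightarrow> real \<Rightarrow> 'a list cell_set" where
  "edge g = line K 1 [g] (corner 0) (corner 1)"

lemma simplex_1: "g \<in> carrier G \<Longrightarrow> [g] \<in> simplices K 1"
  by (simp add: commuting_nerve_def nerve_def)

lemma edge_loop: "g \<in> carrier G \<Longrightarrow> loop_in X x0 (edge g)"
  using pathin_line[OF simplex_1] cell_point_corner[OF simplex_1] by (simp add: loop_in_def edge_def)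

lemma line_corner:
  assumes x: "x \<in> simplices K n" and ij: "i \<le> j" "j \<le> n" and s: "0 \<le> s" "s \<le> 1"
  shows "line K n x (corner i) (corner j) s = edge (list_mult G (map (nth x) [i..<j])) s"
proof -
  let ?d = "\<lambda>k::nat. if k = 0 then i else j"
  have d: "?d \<in> simplex_maps 1 n" using ij by (auto simp: simplex_maps_def mono_on_def)
  have "sact K 1 n ?d x = [list_mult G (map (nth x) [i..<j])]" by (simp add: sact_nerve)
  then show ?thesis
    using line_push[OF d x _ _ s, of "corner 0" "corner 1"] by (simp add: edge_def simplex_push_corner)
qed

text \<open>The explicit lift at time \<open>s\<close> has the value 1 on an initial interval of
  length \<open>1 - s\<close> and \<open>\<iota> g\<close> afterwards. It moves at unit speed from
  one constant to the other.\<close>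

lemma monodromy_edge:
  assumes g: "g \<in> carrier G"
  shows "monodromy (edge g) (\<iota> g)"
proof -
  let ?E = "\<lambda>s. step_fun [g] (mix s (corner 0) (corner 1))"
  have m: "mix s (corner 0) (corner 1) \<in> standard_simplex 1" if "s \<in> {0..1}" for s
    using that by (intro mix_in) auto
  have "step_dist (?E s) (?E s') < 1/2" if "s \<in> {0..1}" "s' \<in> {0..1}" "\<bar>s - s'\<bar> < 1/2" for s s'
  proof -
    have "step_dist (?E s) (?E s') \<le> \<bar>s' - s\<bar>"
      using step_dist_step_fun_le[OF simplex_1[OF g] m m, OF that(1,2)]
      by (simp add: mix_def corner_def atMost_Suc)
    moreover have "\<bar>s' - s\<bar> < 1/2" using that(3) by (simp add: abs_minus_commute)
    ultimately show ?thesis by linarith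
  qed
  then have "lift (1/2) 0 1 (edge g) ?E"
    using step_fun_orbit[OF simplex_1[OF g] m] by (auto simp: lift_def edge_def line_def intro!: exI[of _ "1/2"])
  moreover have "position (corner i) s = i" if "s \<in> {0..<1}" for s i
  proof -
    have "sum (corner i) {..<i} = 0" "sum (corner i) {..i} = 1" by (auto simp: corner_def)
    then show ?thesis using that by (intro position_eqI) (auto simp: corner_def)
  qed
  then have "?E 0 = const \<one>\<^bsub>H\<^esub>" "?E 1 = const (\<iota> g)"
    using g by (auto simp: step_fun_def vertex_def list_mult_def iota_one)
  ultimately show ?thesis unfolding monodromy_def using g by auto
qed

text \<open>For every point other than the base point one representing cell is fixed, and the path
  starts at its corner 0. The base point gets the constant path, as \<open>path_tree\<close>
  demands.\<close>

definition tree :: "'a list cell_set \<Rightarrow> real \<Rightarrow> 'a list cell_set" where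
  "tree y = (if y = x0 then \<lambda>_. x0 else SOME c. \<exists>n x t. x \<in> simplices K n \<and> t \<in> standard_simplex n \<and>
     y = cell_point K n x t \<and> c = line K n x (corner 0) t)"

lemma tree:
  assumes "y \<in> topspace X" "y \<noteq> x0"
  shows "\<exists>n x t. x \<in> simplices K n \<and> t \<in> standard_simplex n \<and>
     y = cell_point K n x t \<and> tree y = line K n x (corner 0) t"
proof -
  have "\<exists>c n x t. x \<in> simplices K n \<and> t \<in> standard_simplex n \<and>
     y = cell_point K n x t \<and> c = line K n x (corner 0) t"
    using assms(1) unfolding topspace_realization by blast
  from someI_ex[OF this] show ?thesis using assms(2) by (simp add: tree_def)
qed

sublocale path_tree X x0 tree
proof
  show "x0 \<in> topspace X" by (rule x0_topspace)
  show "tree x0 = (\<lambda>_. x0)" by (simp add: tree_def)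
  show "pathin X (tree y) \<and> tree y 0 = x0 \<and> tree y 1 = y" if y: "y \<in> topspace X" for y
  proof (cases "y = x0")
    case True
    then show ?thesis using x0_topspace by (simp add: tree_def)
  next
    case False
    then show ?thesis using tree[OF y] pathin_line cell_point_corner by fastforce
  qed
qed

definition edge_class :: "'a \<Rightarrow> (real \<Rightarrow> 'a list cell_set) set" where
  "edge_class g = loop_class X x0 (edge g)"

lemma edge_class_closed: "g \<in> carrier G \<Longrightarrow> edge_class g \<in> carrier P"
  using edge_loop unfolding edge_class_def carrier_fundamental_group by blast

lemma path_class_edge: "g \<in> carrier G \<Longrightarrow> path_class (edge g) = edge_class g"
  by (simp add: path_class_loop edge_loop edge_class_def)

lemma path_class_line_concat:
  "x \<in> simplices K n \<Longrightarrow> t \<in> standard_simplex n \<Longrightarrow> u \<in> standard_simplex n \<Longrightarrow> w \<in> standard_simplex n \<Longrightarrow>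
     path_class (line K n x t u) \<otimes>\<^bsub>P\<^esub> path_class (line K n x u w) = path_class (line K n x t w)"
  by (subst path_class_concat[symmetric]) (simp_all add: pathin_line path_class_homotopic[OF line_concat])

lemma path_class_line_closed:
  "x \<in> simplices K n \<Longrightarrow> t \<in> standard_simplex n \<Longrightarrow> u \<in> standard_simplex n \<Longrightarrow> path_class (line K n x t u) \<in> carrier P"
  by (intro path_class_closed pathin_line)

lemma path_class_line_refl:
  "x \<in> simplices K n \<Longrightarrow> t \<in> standard_simplex n \<Longrightarrow> path_class (line K n x t t) = \<one>\<^bsub>P\<^esub>"
  using path_class_line_concat[of x n t t t] path_class_line_closed[of x n t t] by simp

lemma path_class_line_rev:
  "x \<in> simplices K n \<Longrightarrow> t \<in> standard_simplex n \<Longrightarrow> u \<in> standard_simplex n \<Longrightarrow>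
     path_class (line K n x u t) = inv\<^bsub>P\<^esub> path_class (line K n x t u)"
  using path_class_line_concat[of x n u t u] path_class_line_closed path_class_line_refl
  by (intro P.inv_equality[symmetric]) auto

lemma path_class_line_corner:
  assumes "x \<in> simplices K n" "i \<le> j" "j \<le> n"
  shows "path_class (line K n x (corner i) (corner j)) = edge_class (list_mult G (map (nth x) [i..<j]))"
proof -
  have "path_homotopic X (line K n x (corner i) (corner j)) (edge (list_mult G (map (nth x) [i..<j])))"
    using assms line_corner[OF assms] by (intro path_homotopic_eq pathin_line) auto
  then show ?thesis using path_class_homotopic path_class_edge[OF segment_closed[OF assms(1,3)]] by simp
qed

text \<open>The commuting pair is a 2-simplex with edges \<open>g\<close>, \<open>h\<close> and
  their product, and within a cell straight lines compose.\<close>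

lemma edge_class_mult:
  assumes "g \<in> carrier G" "h \<in> carrier G" "g \<otimes>\<^bsub>G\<^esub> h = h \<otimes>\<^bsub>G\<^esub> g"
  shows "edge_class (g \<otimes>\<^bsub>G\<^esub> h) = edge_class g \<otimes>\<^bsub>P\<^esub> edge_class h"
proof -
  have x: "[g, h] \<in> simplices K 2" using assms by (auto simp: commuting_nerve_def nerve_def)
  have "list_mult G (map (nth [g, h]) [0..<1]) = g" "list_mult G (map (nth [g, h]) [1..<2]) = h"
    "list_mult G (map (nth [g, h]) [0..<2]) = g \<otimes>\<^bsub>G\<^esub> h"
    using assms by (simp_all add: list_mult_def upt_rec)
  then show ?thesis
    using path_class_line_concat[OF x, of "corner 0" "corner 1" "corner 2"]
      path_class_line_corner[OF x, of 0 1] path_class_line_corner[OF x, of 1 2]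
      path_class_line_corner[OF x, of 0 2] by simp
qed

section \<open>The subgroup generated by the edge loops\<close>

abbreviation N where "N \<equiv> generate P (edge_class ` carrier G)"

lemma subgroup_N: "subgroup N P"
  using edge_class_closed by (intro P.generate_is_subgroup) auto

lemma edge_class_N: "g \<in> carrier G \<Longrightarrow> edge_class g \<in> N"
  by (simp add: generate.incl)

lemma line_corner_N:
  assumes "x \<in> simplices K n" "i \<le> n" "j \<le> n"
  shows "path_class (line K n x (corner i) (corner j)) \<in> N"
proof (cases "i \<le> j")
  case True
  then show ?thesis using path_class_line_corner[of x n i j] edge_class_N segment_closed assms by simp
next
  case False
  then have "path_class (line K n x (corner j) (corner i)) \<in> N"
    using path_class_line_corner[of x n j i] edge_class_N segment_closed assms by simp
  then show ?thesis
    using path_class_line_rev[of x n "corner j" "corner i"] assms subgroup.m_inv_closed[OF subgroup_N] by simp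
qed

lemma line_N_change:
  assumes "x \<in> simplices K n" "t \<in> standard_simplex n" "i \<le> n" "j \<le> n" "path_class (line K n x (corner i) t) \<in> N"
  shows "path_class (line K n x (corner j) t) \<in> N"
  using path_class_line_concat[of x n "corner j" "corner i" t] line_corner_N[of x n j i] assms
    subgroup.m_closed[OF subgroup_N] by fastforce

lemma line_push_class:
  assumes "\<theta> \<in> simplex_maps m n" "x \<in> simplices K n" "t \<in> standard_simplex m" "i \<le> m"
  shows "path_class (line K m (sact K m n \<theta> x) (corner i) t) = path_class (line K n x (corner (\<theta> i)) (simplex_push m \<theta> t))"
proof (rule path_class_homotopic)
  show "path_homotopic X (line K m (sact K m n \<theta> x) (corner i) t) (line K n x (corner (\<theta> i)) (simplex_push m \<theta> t))"
    using assms line_push[OF assms(1,2), of "corner i" t]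
    by (intro path_homotopic_eq pathin_line K.act_closed) (auto simp: simplex_push_corner)
qed

lemma path_class_tree:
  assumes y: "y \<in> topspace X"
  shows "path_class (tree y) = \<one>\<^bsub>P\<^esub>"
proof -
  have c: "pathin X (tree y)" "tree y 0 = x0" "tree y 1 = y" using c[OF y] by auto
  have "path_homotopic X (path_loop (tree y)) (path_concat (\<lambda>_. x0) (\<lambda>_. x0))"
    unfolding path_loop_def c(2,3) c_x0 using c path_homotopic_rev_right[OF c(1)] x0_topspace
    by (intro path_homotopic_concat path_homotopic_refl) auto
  moreover have "path_concat (\<lambda>_. x0) (\<lambda>_. x0) = (\<lambda>_. x0)" by (simp add: path_concat_def)
  ultimately show ?thesis
    unfolding path_class_def one_fundamental_group
    using loop_class_eq_iff[OF loop_in_path_loop[OF c(1)] loop_in_const[OF x0_topspace]] by simp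
qed

text \<open>For the cell chosen by \<open>tree\<close> the line from corner 0 has trivial class by
  construction. Membership in \<open>N\<close> passes to the other corners and along gluings, since
  lines between corners are edges or reversed edges, and so reaches every cell that represents the
  same point.\<close>

lemma line_N:
  assumes "x \<in> simplices K n" "t \<in> standard_simplex n" "i \<le> n"
  shows "path_class (line K n x (corner i) t) \<in> N"
proof -
  define good where "good p \<longleftrightarrow> (case p of ((n, x), t) \<Rightarrow> \<forall>i\<le>n. path_class (line K n x (corner i) t) \<in> N)"
    for p :: "(nat \<times> 'a list) \<times> (nat \<Rightarrow> real)"
  have inv: "good q \<longleftrightarrow> good p" if "(p, q) \<in> cell_rel K" "p \<in> topspace (cell_space K)" for p q
  proof -
    have "q \<in> topspace (cell_space K) \<and> (good q \<longleftrightarrow> good p)"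
      using that
    proof (induction rule: K.cell_rel_induct)
      case (glue m n \<theta> x t)
      then have g: "\<theta> \<in> simplex_maps m n" "x \<in> simplices K n" "t \<in> standard_simplex m" by blast+
      have th: "\<theta> i \<le> n" if "i \<le> m" for i using g(1) that by (auto simp: simplex_maps_def)
      have "good ((n, x), simplex_push m \<theta> t)" if "path_class (line K n x (corner (\<theta> 0)) (simplex_push m \<theta> t)) \<in> N"
        using line_N_change[OF g(2) simplex_push_in[OF g(1,3)] th[of 0] _ that] by (simp add: good_def)
      then show ?case
        using line_push_class[OF g] th unfolding good_def by auto
    qed auto
    then show ?thesis by blast
  qed
  let ?y = "cell_point K n x t"
  have y: "?y \<in> topspace X" using assms unfolding topspace_realization by blast
  have "\<exists>m w u. w \<in> simplices K m \<and> u \<in> standard_simplex m \<and> ?y = cell_point K m w u \<and> good ((m, w), u)"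
  proof (cases "?y = x0")
    case True
    have "good ((0, []), corner 0)" using line_corner_N[OF nil_simplex] by (simp add: good_def)
    then show ?thesis using True nil_simplex cell_point_corner[OF nil_simplex, of 0]
      by (intro exI[of _ 0] exI[of _ "[]"] exI[of _ "corner 0"]) simp
  next
    case False
    obtain m w u where w: "w \<in> simplices K m" "u \<in> standard_simplex m" "?y = cell_point K m w u"
      "tree ?y = line K m w (corner 0) u" using tree[OF y False] by blast
    have "path_class (line K m w (corner 0) u) \<in> N"
      using path_class_tree[OF y] w(4) subgroup.one_closed[OF subgroup_N] by simp
    then have "good ((m, w), u)" using line_N_change[OF w(1,2), of 0] by (simp add: good_def)
    then show ?thesis using w by blast
  qed
  then obtain m w u where w: "w \<in> simplices K m" "u \<in> standard_simplex m" "cell_point K m w u = ?y" "good ((m, w), u)"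
    by metis
  then have "good ((n, x), t)"
    using inv[of "((m, w), u)" "((n, x), t)"] by (simp add: cell_point_eq_iff topspace_cell_space)
  then show ?thesis using assms(3) by (simp add: good_def)
qed

end

section \<open>Contracting a small open set to the base point\<close>

lemma continuous_map_cell_space_snd: "continuous_map (cell_space K) (powertop_real UNIV) snd"
  unfolding continuous_map_def
proof (intro conjI allI impI)
  fix U assume U: "openin (powertop_real (UNIV :: nat set)) U"
  have "openin (simplex_topology n) {t. ((n, x), t) \<in> {p \<in> topspace (cell_space K). snd p \<in> U}}"
    if "x \<in> simplices K n" for n x
  proof -
    have "{t. ((n, x), t) \<in> {p \<in> topspace (cell_space K). snd p \<in> U}} = U \<inter> standard_simplex n"
      using that by (auto simp: topspace_cell_space)
    then show ?thesis using U by (auto simp: openin_subtopology)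
  qed
  moreover have "{p \<in> topspace (cell_space K). snd p \<in> U} \<subseteq> topspace (cell_space K)" by blast
  ultimately show "openin (cell_space K) {p \<in> topspace (cell_space K). snd p \<in> U}"
    unfolding cell_space_def openin_sum_topology by auto
qed auto

lemma openin_cell_space_piece:
  assumes "x \<in> simplices K n" "openin (simplex_topology n) U"
  shows "openin (cell_space K) ({(n, x)} \<times> U)"
  using open_map_component_injection[of "(n, x)" "SIGMA n:UNIV. simplices K n" "\<lambda>(n, x). simplex_topology n"] assms
  unfolding open_map_def cell_space_def by (auto simp: image_Pair_const Times_insert_left)

text \<open>Projection onto the face spanned by \<open>A\<close>, renormalising the coordinates
  there; it is meaningful only where \<open>sum t A\<close> is positive.\<close>

definition face_point :: "nat set \<Rightarrow> (nat \<Rightarrow> real) \<Rightarrow> nat \<Rightarrow> real" where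
  "face_point A t = (\<lambda>i. if i \<in> A then t i / sum t A else 0)"

lemma face_point_in:
  assumes "t \<in> standard_simplex n" "A \<subseteq> {..n}" "sum t A > 0"
  shows "face_point A t \<in> standard_simplex n"
proof -
  note t = standard_simplexD[OF assms(1)]
  have fA: "finite A" using assms(2) finite_subset by blast
  have "t i \<le> sum t A" if "i \<in> A" for i using that fA t(1) by (intro member_le_sum) auto
  moreover have "(\<Sum>i\<le>n. face_point A t i) = (\<Sum>i\<in>A. t i / sum t A)"
    unfolding face_point_def using assms(2) by (simp add: sum.If_cases Int_absorb1)
  ultimately show ?thesis
    using assms t(1) by (auto simp: standard_simplex_def face_point_def simp flip: sum_divide_distrib)
qed

lemma simplex_push_face_point:
  assumes "A = {i. i \<le> m \<and> \<theta> i \<in> B}" "finite B"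
  shows "simplex_push m \<theta> (face_point A t) = face_point B (simplex_push m \<theta> t)"
proof
  fix j
  have w: "sum (simplex_push m \<theta> t) B = sum t A" by (simp add: sum_simplex_push assms)
  have "simplex_push m \<theta> (face_point A t) j =
      (\<Sum>i\<le>m. (if j \<in> B then 1 / sum t A else 0) * (if \<theta> i = j then t i else 0))"
    unfolding simplex_push_alt using assms(1) by (intro sum.cong) (auto simp: face_point_def)
  also have "\<dots> = (if j \<in> B then 1 / sum t A else 0) * simplex_push m \<theta> t j"
    by (simp only: simplex_push_alt sum_distrib_left)
  finally show "simplex_push m \<theta> (face_point A t) j = face_point B (simplex_push m \<theta> t) j"
    by (simp add: face_point_def w)
qed

section \<open>The deformation towards a collapsed face\<close>

context commuting_map begin

definition level_set :: "'h \<Rightarrow> 'h \<Rightarrow> nat \<Rightarrow> 'a list \<Rightarrow> nat set" where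
  "level_set a k n x = {i. i \<le> n \<and> k \<cdot> \<iota> (vertex G x i) = a}"

text \<open>Together with \<open>simplex_push_face_point\<close> this makes the point towards which
  a point moves independent of the representing cell.\<close>

lemma level_set_push:
  assumes "\<theta> \<in> simplex_maps m n" "x \<in> simplices K n" "k \<in> carrier H"
  shows "level_set a (k \<cdot> \<iota> (vertex G x (\<theta> 0))) m (sact K m n \<theta> x) = {i. i \<le> m \<and> \<theta> i \<in> level_set a k n x}"
proof -
  have "k \<cdot> \<iota> (vertex G x (\<theta> 0)) \<cdot> \<iota> (vertex G (sact K m n \<theta> x) i) = k \<cdot> \<iota> (vertex G x (\<theta> i))"
    if "i \<le> m" for i
    using vertex_act(2)[OF assms(1,2) that] vertex_closed[OF assms(2)] vertex_closed[OF K.act_closed[OF assms(1,2)]]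
      assms(3) by (simp add: H.m_assoc)
  then show ?thesis using assms(1) by (auto simp: level_set_def simplex_maps_def)
qed

text \<open>Injectivity of \<iota> turns equal values in \<open>H\<close> into equal vertices in
  \<open>G\<close>, so the whole face spanned by the level set is collapsed to the base
  point.\<close>

lemma level_set_line_const:
  assumes x: "x \<in> simplices K n" and k: "k \<in> carrier H"
    and t: "t \<in> standard_simplex n" "u \<in> standard_simplex n"
    and supp: "\<And>i. i \<notin> level_set a k n x \<Longrightarrow> t i = 0 \<and> u i = 0" and ne: "level_set a k n x \<noteq> {}" and s: "0 \<le> s" "s \<le> 1"
  shows "line K n x t u s = x0"
proof -
  obtain j where j: "j \<in> level_set a k n x" using ne by blast
  have "vertex G x i = vertex G x i'" if "i \<in> level_set a k n x" "i' \<in> level_set a k n x" for i i'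
  proof -
    have "k \<cdot> \<iota> (vertex G x i) = k \<cdot> \<iota> (vertex G x i')" using that by (simp add: level_set_def)
    then have "\<iota> (vertex G x i) = \<iota> (vertex G x i')" using k vertex_closed[OF x] by simp
    then show ?thesis using inj_onD[OF iota_inj] vertex_closed[OF x] by blast
  qed
  then show ?thesis unfolding line_def using supp s t
    by (intro cell_point_constant_face[OF x _ _ j] mix_in) (auto simp: level_set_def mix_def)
qed

text \<open>In the application, \<open>E0\<close> takes the value \<open>a\<close> on a set of measure at least \<open>r\<close>. The bound
  \<open>1/2\<close> makes the translate of a step function that is \<open>r\<close>-close to \<open>E0\<close> unique.\<close>

context
  fixes E0 :: "real \<Rightarrow> 'h" and a :: 'h and r :: real
  assumes E0: "E0 \<in> steps" and r: "r \<le> 1/2"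
    and a: "\<And>F. F \<in> steps \<Longrightarrow> step_dist F E0 < r \<Longrightarrow> \<exists>s\<in>{0..<1}. F s = a"
begin

definition shift :: "(nat \<times> 'a list) \<times> (nat \<Rightarrow> real) \<Rightarrow> 'h" where
  "shift = (\<lambda>((n, x), t). THE k. k \<in> carrier H \<and> step_dist (translate k (step_fun x t)) E0 < r)"

definition star :: "(nat \<times> 'a list) \<times> (nat \<Rightarrow> real) \<Rightarrow> nat set" where
  "star p = (case p of ((n, x), t) \<Rightarrow> level_set a (shift p) n x)"

definition contract :: "((nat \<times> 'a list) \<times> (nat \<Rightarrow> real)) \<times> real \<Rightarrow> 'a list cell_set" where
  "contract = (\<lambda>(((n, x), t), u). line K n x t (face_point (star ((n, x), t)) t) u)"

lemma shift_unique:
  assumes "x \<in> simplices K n" "t \<in> standard_simplex n"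
    "k \<in> carrier H" "step_dist (translate k (step_fun x t)) E0 < r"
  shows "shift ((n, x), t) = k"
  unfolding shift_def prod.case
proof (rule the_equality)
  fix l assume l: "l \<in> carrier H \<and> step_dist (translate l (step_fun x t)) E0 < r"
  note st = step_fun_steps[OF assms(1,2)]
  have "step_dist (translate l (step_fun x t)) (translate k (step_fun x t)) \<le>
     step_dist (translate l (step_fun x t)) E0 + step_dist E0 (translate k (step_fun x t))"
    using assms st l E0 by (intro step_dist_triangle translate_steps) auto
  then have "step_dist (translate l (step_fun x t)) (translate k (step_fun x t)) < 1"
    using assms(4) l r by (simp add: step_dist_commute)
  then show "l = k" using step_dist_translate_self st assms l by blast
qed (use assms in blast)

lemma shift_props:
  assumes "x \<in> simplices K n" "t \<in> standard_simplex n" "cell_point K n x t \<in> orbit_ball E0 r"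
  shows "shift ((n, x), t) \<in> carrier H" "step_dist (translate (shift ((n, x), t)) (step_fun x t)) E0 < r"
    "sum t (star ((n, x), t)) > 0" "star ((n, x), t) \<subseteq> {..n}" "star ((n, x), t) \<noteq> {}"
proof -
  obtain k where k: "k \<in> carrier H" "step_dist (translate k (step_fun x t)) E0 < r"
    using assms cell_point_orbit_ball by blast
  have e: "shift ((n, x), t) = k" using shift_unique assms k by blast
  show "shift ((n, x), t) \<in> carrier H" "step_dist (translate (shift ((n, x), t)) (step_fun x t)) E0 < r"
    using e k by auto
  show sub: "star ((n, x), t) \<subseteq> {..n}" by (auto simp: star_def level_set_def)
  obtain s where s: "s \<in> {0..<1}" "translate k (step_fun x t) s = a"
    using a[OF translate_steps[OF k(1) step_fun_steps[OF assms(1,2)]] k(2)] by blast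
  let ?i = "position t s"
  have p: "?i \<le> n" "s < sum t {..?i}" "sum t {..<?i} \<le> s" using position_props[OF assms(2)] s(1) by auto
  have i: "?i \<in> star ((n, x), t)"
    using s p(1) e by (simp add: star_def level_set_def translate_def step_fun_def)
  \<comment> \<open>The interval numbered \<open>?i\<close> contains \<open>s\<close>, hence has
    positive length; so the denominator in \<open>face_point\<close> will be positive.\<close>
  have "t ?i > 0" using p(2,3) by (simp add: lessThan_Suc_atMost[symmetric])
  moreover have "t ?i \<le> sum t (star ((n, x), t))"
    using i standard_simplexD(1)[OF assms(2)] finite_subset[OF sub] by (intro member_le_sum) auto
  ultimately show "sum t (star ((n, x), t)) > 0" by linarith
  show "star ((n, x), t) \<noteq> {}" using i by blast
qed

text \<open>Gluing multiplies the shift on the right by the image of the label of vertex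
  \<open>\<theta> 0\<close>; the star is then the preimage of the star under \<theta>, and pushing
  forward maps lines to lines.\<close>

lemma contract_glue:
  assumes th: "\<theta> \<in> simplex_maps m n" and x: "x \<in> simplices K n" and t: "t \<in> standard_simplex m"
    and V: "cell_point K n x (simplex_push m \<theta> t) \<in> orbit_ball E0 r" and u: "0 \<le> u" "u \<le> 1"
  shows "contract (((m, sact K m n \<theta> x), t), u) = contract (((n, x), simplex_push m \<theta> t), u)"
proof -
  let ?x = "sact K m n \<theta> x" and ?t = "simplex_push m \<theta> t"
  note x' = K.act_closed[OF th x] and t' = simplex_push_in[OF th t]
  note V' = V[folded cell_point_glue[OF th x t]]
  note s = shift_props[OF x t' V] and s' = shift_props[OF x' t V']
  let ?k = "shift ((n, x), ?t)" and ?v = "\<iota> (vertex G x (\<theta> 0))"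
  have v: "?v \<in> carrier H" using vertex_closed[OF x] by simp
  have "shift ((m, ?x), t) = ?k \<cdot> ?v"
  proof (rule shift_unique[OF x' t])
    have "translate ?k (step_fun x ?t) = translate (?k \<cdot> ?v) (step_fun ?x t)"
      unfolding step_fun_push[OF th x t] using s(1) v step_fun_closed[OF x'] by (rule translate_translate)
    then show "step_dist (translate (?k \<cdot> ?v) (step_fun ?x t)) E0 < r" using s(2) by simp
  qed (use s(1) v in simp)
  then have "star ((m, ?x), t) = {i. i \<le> m \<and> \<theta> i \<in> star ((n, x), ?t)}"
    using level_set_push[OF th x s(1)] by (simp add: star_def)
  then have "simplex_push m \<theta> (face_point (star ((m, ?x), t)) t) = face_point (star ((n, x), ?t)) ?t"
    using finite_subset[OF s(4)] by (intro simplex_push_face_point) auto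
  then show ?thesis
    unfolding contract_def prod.case
    using line_push[OF th x t face_point_in[OF t s'(4,3)] u] by simp
qed

abbreviation cell_map where "cell_map \<equiv> \<lambda>((n, x), t). cell_point K n x t"

abbreviation star_space where
  "star_space \<equiv> {p \<in> topspace (cell_space K). cell_map p \<in> orbit_ball E0 r}"

lemma contract_respects:
  assumes "p \<in> star_space" "q \<in> star_space" "cell_map p = cell_map q" "0 \<le> u" "u \<le> 1"
  shows "contract (p, u) = contract (q, u)"
proof -
  have "(p, q) \<in> cell_rel K" "p \<in> topspace (cell_space K)"
    using assms by (auto simp: cell_point_eq_iff split: prod.splits)
  then have "q \<in> topspace (cell_space K) \<and>
      (cell_map p = cell_map q \<and> (cell_map p \<in> orbit_ball E0 r \<longrightarrow> contract (p, u) = contract (q, u)))"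
  proof (induction rule: K.cell_rel_induct)
    case (glue m n \<theta> x t)
    then show ?case using contract_glue[of \<theta> m n x t u] assms(4,5) by (simp add: cell_point_glue)
  qed auto
  then show ?thesis using assms(1) by blast
qed

lemma openin_star_space: "openin (cell_space K) star_space"
  using quotient_map_realization[of K] openin_orbit_ball[OF E0]
  by (auto simp: quotient_map_def openin_subset)

text \<open>On the set of \<open>t\<close> in one cell that are close to \<open>E0\<close> after
  translation by a fixed \<open>k\<close>, the shift is \<open>k\<close> and the star is a fixed set
  of vertices, so \<open>contract\<close> is given by rational functions with nonzero denominator.
  These open pieces cover the domain.\<close>

lemma continuous_map_contract:
  "continuous_map (prod_topology (subtopology (cell_space K) star_space) (top_of_set {0..1})) X contract"
proof -
  let ?I = "top_of_set {0..1::real}"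
  let ?Y = "prod_topology (subtopology (cell_space K) star_space) ?I"
  let ?B = "\<lambda>(n, x, k). {t \<in> standard_simplex n. step_dist (translate k (step_fun x t)) E0 < r}"
  let ?T = "\<lambda>(n, x, k). ({(n, x)} \<times> ?B (n, x, k)) \<times> {0..1}"
  let ?J = "{(n, x, k). x \<in> simplices K n \<and> k \<in> carrier H}"
  have piece: "{(n, x)} \<times> ?B (n, x, k) \<subseteq> star_space" if "x \<in> simplices K n" "k \<in> carrier H" for n x k
    using that cell_point_orbit_ball by (auto simp: topspace_cell_space)
  show ?thesis
  proof (rule pasting_lemma[where I="?J" and T="?T" and f="\<lambda>_. contract"])
    fix j assume "j \<in> ?J"
    then obtain n x k where j: "j = (n, x, k)" and x: "x \<in> simplices K n" and k: "k \<in> carrier H" by auto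
    have "openin (cell_space K) ({(n, x)} \<times> ?B (n, x, k))"
      using openin_step_ball[OF x k E0] by (intro openin_cell_space_piece[OF x]) simp
    then have "openin (subtopology (cell_space K) star_space) ({(n, x)} \<times> ?B (n, x, k))"
      using piece[OF x k] by (simp add: openin_open_subtopology openin_star_space)
    then show "openin ?Y (?T j)" unfolding j prod.case by (simp add: openin_prod_Times_iff)
    let ?A = "level_set a k n x"
    let ?W = "subtopology ?Y (?T j)"
    have shift: "shift ((n, x), t) = k" "star ((n, x), t) = ?A" "sum t ?A > 0" "?A \<subseteq> {..n}"
      if "t \<in> ?B (n, x, k)" for t
    proof -
      have t: "t \<in> standard_simplex n" "step_dist (translate k (step_fun x t)) E0 < r" using that by auto
      show 1: "shift ((n, x), t) = k" by (rule shift_unique[OF x t(1) k t(2)])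
      show 2: "star ((n, x), t) = ?A" by (simp add: star_def 1)
      have "cell_point K n x t \<in> orbit_ball E0 r" using cell_point_orbit_ball x t k by blast
      then show "sum t ?A > 0" "?A \<subseteq> {..n}" using shift_props[OF x t(1)] 2 by auto
    qed
    have top: "w \<in> topspace ?W \<Longrightarrow> \<exists>t u. w = (((n, x), t), u) \<and> t \<in> ?B (n, x, k) \<and> 0 \<le> u \<and> u \<le> 1" for w
      by (auto simp: j)
    have "continuous_map ?Y (powertop_real UNIV) (\<lambda>w. snd (fst w))"
      using continuous_map_compose[OF continuous_map_fst continuous_map_from_subtopology[OF continuous_map_cell_space_snd]]
      by (simp add: o_def)
    then have t: "continuous_map ?W euclideanreal (\<lambda>w. snd (fst w) i)" for i
      using continuous_map_from_subtopology by (fastforce simp: continuous_map_componentwise_UNIV)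
    have "continuous_map ?Y euclideanreal snd"
      using continuous_map_snd[of "subtopology (cell_space K) star_space" ?I]
      unfolding continuous_map_in_subtopology by blast
    then have u: "continuous_map ?W euclideanreal snd" by (rule continuous_map_from_subtopology)
    have pos: "sum (snd (fst w)) ?A \<noteq> 0" if "w \<in> topspace ?W" for w
      using top[OF that] shift(3) by fastforce
    have fA: "finite ?A" by (simp add: level_set_def)
    have "continuous_map ?W (simplex_topology n) (\<lambda>w. mix (snd w) (snd (fst w)) (face_point ?A (snd (fst w))))"
    proof (rule continuous_map_simplexI)
      fix i
      have c: "continuous_map ?W euclideanreal (\<lambda>w. if i \<in> ?A then snd (fst w) i / sum (snd (fst w)) ?A else 0)"
        using t pos fA by (cases "i \<in> ?A") (auto intro!: continuous_intros)
      show "continuous_map ?W euclideanreal (\<lambda>w. mix (snd w) (snd (fst w)) (face_point ?A (snd (fst w))) i)"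
        unfolding mix_def face_point_def
        by (intro continuous_map_add continuous_map_real_mult continuous_map_diff t u c) simp_all
    next
      fix w assume "w \<in> topspace ?W"
      from top[OF this] show "mix (snd w) (snd (fst w)) (face_point ?A (snd (fst w))) \<in> standard_simplex n"
        using shift(3,4) by (auto intro!: mix_in face_point_in)
    qed
    from continuous_map_compose[OF this continuous_map_cell_point[OF x]]
    have "continuous_map ?W X (\<lambda>w. cell_point K n x (mix (snd w) (snd (fst w)) (face_point ?A (snd (fst w)))))"
      by (simp add: o_def)
    then show "continuous_map ?W X contract"
    proof (rule continuous_map_eq)
      fix w assume "w \<in> topspace ?W"
      from top[OF this] show "cell_point K n x (mix (snd w) (snd (fst w)) (face_point ?A (snd (fst w)))) = contract w"
        using shift(2) by (auto simp: contract_def line_def)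
    qed
  next
    fix w assume "w \<in> topspace ?Y"
    then obtain n x t u where w: "w = (((n, x), t), u)" "x \<in> simplices K n" "t \<in> standard_simplex n"
      "cell_point K n x t \<in> orbit_ball E0 r" "0 \<le> u" "u \<le> 1" by (auto simp: topspace_cell_space)
    then obtain k where "k \<in> carrier H" "step_dist (translate k (step_fun x t)) E0 < r"
      using cell_point_orbit_ball by blast
    then show "\<exists>j. j \<in> ?J \<and> w \<in> ?T j \<and> contract w = contract w"
      using w by (intro exI[of _ "(n, x, k)"]) auto
  qed auto
qed

text \<open>The contraction descends to the realization because the product of a quotient map with
  the locally compact Hausdorff space [0,1] is again a quotient map.\<close>

lemma contraction_exists:
  obtains h where "continuous_map (prod_topology (subtopology X (orbit_ball E0 r)) (top_of_set {0..1})) X h"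
    "\<And>n x t u. x \<in> simplices K n \<Longrightarrow> t \<in> standard_simplex n \<Longrightarrow> cell_point K n x t \<in> orbit_ball E0 r \<Longrightarrow>
       0 \<le> u \<Longrightarrow> u \<le> 1 \<Longrightarrow> h (cell_point K n x t, u) = contract (((n, x), t), u)"
proof -
  let ?I = "top_of_set {0..1::real}"
  have "quotient_map (subtopology (cell_space K) star_space) (subtopology X (orbit_ball E0 r)) cell_map"
    using openin_orbit_ball[OF E0] by (intro quotient_map_restriction[OF quotient_map_realization]) auto
  moreover have "locally_compact_space ?I"
    by (intro compact_imp_locally_compact_space) (simp add: compact_space_subtopology)
  ultimately have q: "quotient_map (prod_topology (subtopology (cell_space K) star_space) ?I)
      (prod_topology (subtopology X (orbit_ball E0 r)) ?I) (\<lambda>(p, u). (cell_map p, u))"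
    by (intro quotient_map_prod_left) (auto simp: Hausdorff_space_subtopology)
  have resp: "contract w = contract w'"
    if "w \<in> topspace (prod_topology (subtopology (cell_space K) star_space) ?I)"
      "w' \<in> topspace (prod_topology (subtopology (cell_space K) star_space) ?I)"
      "(\<lambda>(p, u). (cell_map p, u)) w = (\<lambda>(p, u). (cell_map p, u)) w'" for w w'
  proof -
    obtain p u where w: "w = (p, u)" by fastforce
    obtain p' u' where w': "w' = (p', u')" by fastforce
    have u: "u' = u" "cell_map p = cell_map p'" using that(3) unfolding w w' prod.case prod.inject by simp_all
    have "p \<in> star_space" "p' \<in> star_space" "0 \<le> u" "u \<le> 1" using that(1,2) unfolding w w' by simp_all
    then show ?thesis using contract_respects[of p p' u] u w w' by blast
  qed
  obtain h where h: "continuous_map (prod_topology (subtopology X (orbit_ball E0 r)) ?I) X h"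
    "\<And>w. w \<in> topspace (prod_topology (subtopology (cell_space K) star_space) ?I) \<Longrightarrow>
       h ((\<lambda>(p, u). (cell_map p, u)) w) = contract w"
    by (rule quotient_map_lift_exists[OF q continuous_map_contract], erule (2) resp, rule that)
  show ?thesis
  proof (rule that[OF h(1)])
    fix n x t and u :: real
    assume "x \<in> simplices K n" "t \<in> standard_simplex n" "cell_point K n x t \<in> orbit_ball E0 r" "0 \<le> u" "u \<le> 1"
    then show "h (cell_point K n x t, u) = contract (((n, x), t), u)"
      using h(2)[of "(((n, x), t), u)"] by (simp add: topspace_cell_space)
  qed
qed

text \<open>The line ends in the collapsed face, where the line from a corner \<open>i\<close> to
  the end point is constant. So the track has the class of the line from \<open>t\<close> to corner
  \<open>i\<close>, the inverse of a class known from \<open>line_N\<close>.\<close>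

lemma contract_track:
  assumes "x \<in> simplices K n" "t \<in> standard_simplex n" "cell_point K n x t \<in> orbit_ball E0 r"
  shows "contract (((n, x), t), 1) = x0" "path_class (\<lambda>u. contract (((n, x), t), u)) \<in> N"
proof -
  note s = shift_props[OF assms]
  let ?A = "star ((n, x), t)"
  let ?f = "face_point ?A t"
  have A: "?A = level_set a (shift ((n, x), t)) n x" by (simp add: star_def)
  have f: "?f \<in> standard_simplex n" using face_point_in[OF assms(2) s(4,3)] .
  have "line K n x ?f ?f 1 = x0"
    using s(5) by (intro level_set_line_const[OF assms(1) s(1) f f]) (auto simp: A face_point_def)
  then show "contract (((n, x), t), 1) = x0" by (simp add: contract_def)
  obtain i where i: "i \<in> ?A" using s(5) by blast
  then have i_le: "i \<le> n" using s(4) by auto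
  have "line K n x (corner i) ?f u = x0" if "0 \<le> u" "u \<le> 1" for u
    using s(5) i i_le that
    by (intro level_set_line_const[OF assms(1) s(1) _ f]) (auto simp: A face_point_def corner_def)
  then have "path_homotopic X (line K n x (corner i) ?f) (\<lambda>_. x0)"
    using assms(1) f i_le by (intro path_homotopic_eq pathin_line) auto
  then have "path_class (line K n x (corner i) ?f) = \<one>\<^bsub>P\<^esub>"
    using path_class_homotopic path_class_const[OF x0_topspace] by simp
  then have "path_class (line K n x t ?f) = path_class (line K n x t (corner i))"
    using path_class_line_concat[OF assms(1,2) _ f, of "corner i"] path_class_line_closed[OF assms(1,2), of "corner i"] i_le
    by simp
  also have "\<dots> = inv\<^bsub>P\<^esub> path_class (line K n x (corner i) t)"
    using assms i_le by (intro path_class_line_rev) auto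
  also have "\<dots> \<in> N" using line_N[OF assms(1,2) i_le] subgroup.m_inv_closed[OF subgroup_N] by blast
  finally show "path_class (\<lambda>u. contract (((n, x), t), u)) \<in> N" by (simp add: contract_def)
qed

text \<open>Contracting the whole path fills a square with \<open>p\<close> at the bottom, a
  constant path at the top and tracks at the sides; the tracks have classes in \<open>N\<close>,
  hence so has \<open>p\<close>.\<close>

lemma path_class_orbit_ball:
  assumes p: "pathin X p" and V: "\<And>s. 0 \<le> s \<Longrightarrow> s \<le> 1 \<Longrightarrow> p s \<in> orbit_ball E0 r"
  shows "path_class p \<in> N"
proof -
  let ?I = "top_of_set {0..1::real}"
  obtain h where h: "continuous_map (prod_topology (subtopology X (orbit_ball E0 r)) ?I) X h"
    "\<And>n x t u. x \<in> simplices K n \<Longrightarrow> t \<in> standard_simplex n \<Longrightarrow> cell_point K n x t \<in> orbit_ball E0 r \<Longrightarrow>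
       0 \<le> u \<Longrightarrow> u \<le> 1 \<Longrightarrow> h (cell_point K n x t, u) = contract (((n, x), t), u)"
    by (rule contraction_exists) (rule that)
  let ?F = "\<lambda>z. h (p (fst z), snd z)"
  have "continuous_map ?I (subtopology X (orbit_ball E0 r)) p"
    using p V by (auto simp: pathin_def continuous_map_in_subtopology)
  then have "continuous_map (prod_topology ?I ?I) (prod_topology (subtopology X (orbit_ball E0 r)) ?I) (\<lambda>z. (p (fst z), snd z))"
    by (intro continuous_map_paired[THEN iffD2] conjI continuous_map_snd
        continuous_map_compose[OF continuous_map_fst, unfolded o_def])
  from continuous_map_compose[OF this h(1)]
  have F: "continuous_map (top_of_set ({0..1} \<times> {0..1})) X ?F" by (simp add: o_def)
  have rep: "\<exists>n x t. p s = cell_point K n x t \<and> x \<in> simplices K n \<and> t \<in> standard_simplex n \<and>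
      (\<forall>u\<in>{0..1}. h (p s, u) = contract (((n, x), t), u))" if "0 \<le> s" "s \<le> 1" for s
  proof -
    have "p s \<in> topspace X" using V[OF that] by (simp add: orbit_ball_def)
    then obtain n x t where "x \<in> simplices K n" "t \<in> standard_simplex n" "p s = cell_point K n x t"
      unfolding topspace_realization by blast
    then show ?thesis using h(2)[of x n t] V[OF that] by auto
  qed
  have pc: "path_class q = path_class q'" if "pathin X q" "\<And>u. 0 \<le> u \<Longrightarrow> u \<le> 1 \<Longrightarrow> q u = q' u" for q q'
    using that by (intro path_class_homotopic path_homotopic_eq) auto
  have side: "pathin X (\<lambda>s. ?F (f s))" if "continuous_on {0..1} f" "f \<in> {0..1} \<rightarrow> {0..1} \<times> {0..1}" for f
    using continuous_map_top_of_set_compose[OF F that] by (simp add: pathin_def)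
  have paths: "pathin X (\<lambda>s. h (p s, 0))" "pathin X (\<lambda>s. h (p s, 1))"
    "pathin X (\<lambda>u. h (p 0, u))" "pathin X (\<lambda>u. h (p 1, u))"
    using side[of "\<lambda>s. (s, 0)"] side[of "\<lambda>s. (s, 1)"] side[of "Pair 0"] side[of "Pair 1"]
    by (auto simp: continuous_on_Pair continuous_on_id continuous_on_const)
  have ends: "h (p s, 0) = p s" "h (p s, 1) = x0" if s: "0 \<le> s" "s \<le> 1" for s
  proof -
    obtain n x t where r: "p s = cell_point K n x t" "x \<in> simplices K n" "t \<in> standard_simplex n"
      "\<forall>u\<in>{0..1}. h (p s, u) = contract (((n, x), t), u)" using rep[OF s] by blast
    show "h (p s, 0) = p s" using r by (simp add: contract_def)
    show "h (p s, 1) = x0" using r contract_track(1) V[OF s] by simp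
  qed
  have track: "path_class (\<lambda>u. h (p s, u)) \<in> N" if s: "0 \<le> s" "s \<le> 1" and ps: "pathin X (\<lambda>u. h (p s, u))" for s
  proof -
    obtain n x t where r: "p s = cell_point K n x t" "x \<in> simplices K n" "t \<in> standard_simplex n"
      "\<forall>u\<in>{0..1}. h (p s, u) = contract (((n, x), t), u)" using rep[OF s] by blast
    have "path_class (\<lambda>u. h (p s, u)) = path_class (\<lambda>u. contract (((n, x), t), u))"
      using r(4) by (intro pc[OF ps]) auto
    then show ?thesis using contract_track(2) r V[OF s] by simp
  qed
  have "path_class (\<lambda>s. h (p s, 0)) \<otimes>\<^bsub>P\<^esub> path_class (\<lambda>u. h (p 1, u)) =
      path_class (\<lambda>u. h (p 0, u)) \<otimes>\<^bsub>P\<^esub> path_class (\<lambda>s. h (p s, 1))"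
    using path_class_square[OF F] by simp
  moreover have "path_class (\<lambda>s. h (p s, 0)) = path_class p"
    using pc[OF paths(1)] ends by simp
  moreover have "path_class (\<lambda>s. h (p s, 1)) = \<one>\<^bsub>P\<^esub>"
    using pc[OF paths(2), of "\<lambda>_. x0"] ends path_class_const[OF x0_topspace] by simp
  ultimately have "path_class p \<otimes>\<^bsub>P\<^esub> path_class (\<lambda>u. h (p 1, u)) = path_class (\<lambda>u. h (p 0, u))"
    using path_class_closed[OF paths(3)] by simp
  then have "path_class p = path_class (\<lambda>u. h (p 0, u)) \<otimes>\<^bsub>P\<^esub> inv\<^bsub>P\<^esub> path_class (\<lambda>u. h (p 1, u))"
    using P.inv_solve_right[OF path_class_closed[OF p] path_class_closed[OF paths(3)] path_class_closed[OF paths(4)]]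
    by (simp only:)
  then show ?thesis
    using track[of 0] track[of 1] paths subgroup.m_closed[OF subgroup_N] subgroup.m_inv_closed[OF subgroup_N] by simp
qed

end

text \<open>The interval numbered \<open>i\<close> of the step function has length
  \<open>t i\<close>. A function avoiding the value at vertex \<open>i\<close> would disagree on all
  of it.\<close>

lemma step_value_stable:
  assumes x: "x \<in> simplices K n" and t: "t \<in> standard_simplex n" and i: "t i > 0"
    and F: "F \<in> steps" "step_dist F (step_fun x t) < t i"
  shows "\<exists>s\<in>{0..<1}. F s = \<iota> (vertex G x i)"
proof (rule ccontr)
  assume no: "\<not> (\<exists>s\<in>{0..<1}. F s = \<iota> (vertex G x i))"
  note tt = standard_simplexD[OF t]
  have i_le: "i \<le> n" using tt(3)[of i] i by force
  have sums: "0 \<le> sum t {..<i}" "sum t {..i} \<le> 1" "sum t {..i} = sum t {..<i} + t i"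
    using tt(1) sum_mono2[of "{..n}" "{..i}" t] i_le tt(4) by (auto simp: sum_nonneg lessThan_Suc_atMost[symmetric])
  have "position t s = i" if "s \<in> {sum t {..<i}..<sum t {..i}}" for s
    using that tt(1) by (intro position_eqI) auto
  then have "{sum t {..<i}..<sum t {..i}} \<subseteq> {s \<in> {0..<1}. F s \<noteq> step_fun x t s}"
    using no sums by (auto simp: step_fun_def)
  then have "measure lborel {sum t {..<i}..<sum t {..i}} \<le> step_dist F (step_fun x t)"
    unfolding step_dist_def using steps_neq_sets[OF F(1) step_fun_steps[OF x t]]
    by (intro measure_mono_fmeasurable) auto
  then show False using F(2) sums i by simp
qed

text \<open>By bisection it suffices to consider short pieces of the loop, which lie in one of the
  contractible open sets above.\<close>

lemma loop_class_N:
  assumes p: "loop_in X x0 p"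
  shows "loop_class X x0 p \<in> N"
proof -
  have pX: "pathin X p" using p by (simp add: loop_in_def)
  define q where "q a b = (\<lambda>s::real. p (a + (b - a) * s))" for a b
  have in01: "a + (b - a) * s \<in> {a..b}" if "0 \<le> s" "s \<le> 1" "a \<le> b" for a b s :: real
    using that mult_left_mono[of s 1 "b - a"] by auto
  have q: "pathin X (q a b)" if "0 \<le> a" "a \<le> b" "b \<le> 1" for a b
    unfolding q_def using that in01[of _ a b] by (intro pathin_reparam[OF pX]) (fastforce intro!: continuous_intros)+
  let ?P = "\<lambda>a b. 0 \<le> a \<longrightarrow> a \<le> b \<longrightarrow> b \<le> 1 \<longrightarrow> path_class (q a b) \<in> N"
  have "?P 0 1"
  proof (rule Bolzano[where P="?P"])
    show "(0::real) \<le> 1" by simp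
  next
    fix a b c :: real
    assume P: "?P a b" "?P b c" and ab: "a \<le> b" "b \<le> c"
    show "?P a c"
    proof (intro impI)
      assume ac: "0 \<le> a" "a \<le> c" "c \<le> 1"
      \<comment> \<open>\<open>?f\<close> runs through \<open>[a, b]\<close> in the first half and
        \<open>[b, c]\<close> in the second; it has the same end points as the affine map underlying
        \<open>q a c\<close>.\<close>
      let ?f = "\<lambda>s. if s \<le> 1/2 then a + (b - a) * (2 * s) else b + (c - b) * (2 * s - 1)"
      have half: "2 * s = 1" if "s * 2 = 1" for s :: real using that by simp
      have f: "continuous_on {0..1} ?f"
        by (intro continuous_on_cases_le[where h="\<lambda>x. x"]) (auto simp: half intro!: continuous_intros)
      have f01: "?f \<in> {0..1} \<rightarrow> {0..1}"
      proof
        fix s :: real assume "s \<in> {0..1}"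
        then show "?f s \<in> {0..1}" using in01[of "2 * s" a b] in01[of "2 * s - 1" b c] ab ac by auto
      qed
      have g01: "(\<lambda>s. a + (c - a) * s) \<in> {0..1} \<rightarrow> {0..1}" using in01[of _ a c] ac by fastforce
      have "path_homotopic X (p \<circ> ?f) (p \<circ> (\<lambda>s. a + (c - a) * s))"
        by (intro path_homotopic_reparam[OF pX f f01 _ g01]) (auto intro!: continuous_intros)
      moreover have "p \<circ> ?f = path_concat (q a b) (q b c)" "p \<circ> (\<lambda>s. a + (c - a) * s) = q a c"
        by (simp_all add: path_concat_def q_def fun_eq_iff)
      ultimately have "path_class (q a c) = path_class (path_concat (q a b) (q b c))"
        using path_class_homotopic by simp
      also have "\<dots> = path_class (q a b) \<otimes>\<^bsub>P\<^esub> path_class (q b c)"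
        using q ab ac by (intro path_class_concat) (auto simp: q_def)
      also have "\<dots> \<in> N" using P ab ac subgroup.m_closed[OF subgroup_N] by simp
      finally show "path_class (q a c) \<in> N" .
    qed
  next
    fix s :: real assume s: "0 \<le> s" "s \<le> 1"
    then have "p s \<in> topspace X" using path_image_subset_topspace[OF pX] by auto
    then obtain n x t where x: "x \<in> simplices K n" "t \<in> standard_simplex n" "p s = cell_point K n x t"
      unfolding topspace_realization by blast
    have "\<not> (\<forall>i\<le>n. t i = 0)" using standard_simplexD(4)[OF x(2)] by force
    then obtain i where "t i \<noteq> 0" by blast
    then have i: "t i > 0" using standard_simplexD(1)[OF x(2), of i] by simp
    \<comment> \<open>The bound \<open>t i\<close> preserves the value at vertex \<open>i\<close>,
      by \<open>step_value_stable\<close>; the bound 1/2 makes the shift unique.\<close>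
    define r where "r = min (t i) (1/2)"
    let ?E = "step_fun x t" and ?a = "\<iota> (vertex G x i)"
    note E = step_fun_steps[OF x(1,2)]
    have E_orbit: "?E \<in> orbit (p s)" using step_fun_orbit x by simp
    have r: "r > 0" "r \<le> 1/2" using i by (auto simp: r_def)
    have a: "\<exists>s\<in>{0..<1}. F s = ?a" if "F \<in> steps" "step_dist F ?E < r" for F
      using step_value_stable[OF x(1,2) i that(1)] that(2) by (simp add: r_def)
    obtain d where d: "d > 0" "\<And>s'. s' \<in> {0..1} \<Longrightarrow> \<bar>s - s'\<bar> < d \<Longrightarrow> \<exists>F\<in>orbit (p s'). step_dist F ?E < r"
      using path_orbit_ball[OF pX s E_orbit r(1)] by auto
    have "path_class (q a b) \<in> N" if ab: "a \<le> s \<and> s \<le> b \<and> b - a < d" "0 \<le> a" "a \<le> b" "b \<le> 1" for a b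
    proof (rule path_class_orbit_ball[OF E r(2) a])
      show "pathin X (q a b)" using q ab by blast
      fix u :: real assume u: "0 \<le> u" "u \<le> 1"
      let ?u = "a + (b - a) * u"
      have m: "?u \<in> {a..b}" using in01[OF u ab(3)] .
      then have "?u \<in> {0..1}" "\<bar>s - ?u\<bar> < d" using ab by auto
      then show "q a b u \<in> orbit_ball ?E r"
        using d(2)[of ?u] path_image_subset_topspace[OF pX] by (auto simp: orbit_ball_def q_def)
    qed
    then show "\<exists>d>0. \<forall>a b. a \<le> s \<and> s \<le> b \<and> b - a < d \<longrightarrow> ?P a b" using d(1) by blast
  qed
  then have "path_class (q 0 1) \<in> N" by simp
  moreover have "q 0 1 = p" by (simp add: q_def)
  ultimately show ?thesis using path_class_loop[OF p] by simp
qed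

lemma carrier_P: "carrier P = N"
  using loop_class_N subgroup.subset[OF subgroup_N] by (auto simp: carrier_fundamental_group)

end

section \<open>Groups with two central elements and central squares\<close>

text \<open>Extraspecial groups enter the computation of the colimit through these properties. In
  the symplectic space of \<open>G\<close> modulo its centre, \<open>rich\<close> says that the
  orthogonal complement of any two vectors is nonzero, as it is in dimension at least 4.\<close>

locale two_central = group G for G (structure) +
  fixes z
  assumes z_closed [simp]: "z \<in> carrier G" and z_not_one: "z \<noteq> \<one>"
    and center: "x \<in> carrier G \<Longrightarrow> (\<forall>y\<in>carrier G. x \<otimes> y = y \<otimes> x) \<longleftrightarrow> x \<in> {\<one>, z}"
    and square: "x \<in> carrier G \<Longrightarrow> x \<otimes> x \<in> {\<one>, z}"
    and commutator: "x \<in> carrier G \<Longrightarrow> y \<in> carrier G \<Longrightarrow> x \<otimes> y = y \<otimes> x \<or> x \<otimes> y = z \<otimes> (y \<otimes> x)"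
    and rich: "x \<in> carrier G \<Longrightarrow> y \<in> carrier G \<Longrightarrow>
       \<exists>m\<in>carrier G. m \<notin> {\<one>, z} \<and> m \<otimes> x = x \<otimes> m \<and> m \<otimes> y = y \<otimes> m"
begin

text \<open>The commutator form of \<open>G\<close> modulo its centre, as a truth value instead of
  an element of the field with two elements.\<close>

definition clash :: "'a \<Rightarrow> 'a \<Rightarrow> bool" where
  "clash x y \<longleftrightarrow> x \<otimes> y \<noteq> y \<otimes> x"

lemma clash_sym: "clash x y \<longleftrightarrow> clash y x"
  by (auto simp: clash_def)

lemma clash_self [simp]: "\<not> clash x x"
  by (simp add: clash_def)

lemma z_commute: "x \<in> carrier G \<Longrightarrow> z \<otimes> x = x \<otimes> z"
  using center[of z] by simp

lemma z_square: "z \<otimes> z = \<one>"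
  using square[of z] z_not_one l_cancel_one[of z z] by auto

lemma z_mult_neq: "x \<in> carrier G \<Longrightarrow> z \<otimes> x \<noteq> x"
  using r_cancel_one'[of x z] z_not_one by auto

lemma clash_z: "x \<in> carrier G \<Longrightarrow> y \<in> carrier G \<Longrightarrow> clash x y \<longleftrightarrow> x \<otimes> y = z \<otimes> (y \<otimes> x)"
  using commutator[of x y] z_mult_neq[of "y \<otimes> x"] by (auto simp: clash_def)

text \<open>Bilinearity of the commutator form: moving \<open>x\<close> past \<open>y\<close> and
  then past \<open>w\<close> produces central factors \<open>e y\<close> and \<open>e w\<close>,
  whose product is trivial exactly when they coincide.\<close>

lemma clash_mult_right:
  assumes "x \<in> carrier G" "y \<in> carrier G" "w \<in> carrier G"
  shows "clash x (y \<otimes> w) \<longleftrightarrow> clash x y \<noteq> clash x w"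
proof -
  define e where "e u = (if clash x u then z else \<one>)" for u
  have e: "x \<otimes> u = e u \<otimes> (u \<otimes> x)" "e u \<in> carrier G" if "u \<in> carrier G" for u
    using that assms clash_z[of x u] by (auto simp: e_def clash_def)
  have ec: "e u \<otimes> v = v \<otimes> e u" if "v \<in> carrier G" for u v
    using that z_commute by (auto simp: e_def)
  have "x \<otimes> (y \<otimes> w) = e y \<otimes> (y \<otimes> (x \<otimes> w))"
    using assms e(1)[of y] e(2)[of y] by (metis m_assoc m_closed)
  also have "\<dots> = e y \<otimes> (y \<otimes> (e w \<otimes> (w \<otimes> x)))" using e(1)[of w] assms by simp
  also have "\<dots> = (e y \<otimes> e w) \<otimes> (y \<otimes> w \<otimes> x)"
    using assms e(2) ec[of y w] by (metis m_assoc m_closed)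
  finally have *: "x \<otimes> (y \<otimes> w) = (e y \<otimes> e w) \<otimes> (y \<otimes> w \<otimes> x)" .
  then show ?thesis
    using z_mult_neq[of "y \<otimes> w \<otimes> x"] assms z_square
    by (cases "clash x y"; cases "clash x w") (auto simp: e_def clash_def[of x "y \<otimes> w"])
qed

lemma clash_mult_left:
  "x \<in> carrier G \<Longrightarrow> y \<in> carrier G \<Longrightarrow> w \<in> carrier G \<Longrightarrow> clash (x \<otimes> y) w \<longleftrightarrow> clash x w \<noteq> clash y w"
  using clash_mult_right[of w x y] by (simp add: clash_sym)

lemma clash_one [simp]: "x \<in> carrier G \<Longrightarrow> \<not> clash x \<one>" "x \<in> carrier G \<Longrightarrow> \<not> clash \<one> x"
  by (auto simp: clash_def)

lemma clash_inv [simp]: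
  "x \<in> carrier G \<Longrightarrow> y \<in> carrier G \<Longrightarrow> clash x (inv y) \<longleftrightarrow> clash x y"
  "x \<in> carrier G \<Longrightarrow> y \<in> carrier G \<Longrightarrow> clash (inv y) x \<longleftrightarrow> clash y x"
  using clash_mult_right[of x y "inv y"] clash_mult_left[of y "inv y" x] by auto

lemma clash_exists: "x \<in> carrier G \<Longrightarrow> x \<notin> {\<one>, z} \<Longrightarrow> \<exists>y\<in>carrier G. clash x y"
  using center[of x] by (auto simp: clash_def)

lemma rich_clash:
  assumes "x \<in> carrier G" "y \<in> carrier G"
  shows "\<exists>m\<in>carrier G. m \<notin> {\<one>, z} \<and> \<not> clash x m \<and> \<not> clash y m"
  using rich[OF assms] by (auto simp: clash_def)

lemma clash_pair:
  assumes g: "g \<in> carrier G" and h: "h \<in> carrier G" and gh: "clash g h"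
  shows "\<exists>m\<in>carrier G. \<exists>w\<in>carrier G. clash m w \<and> \<not> clash g m \<and> \<not> clash h m \<and> \<not> clash g w \<and> \<not> clash h w"
proof -
  obtain m where m: "m \<in> carrier G" "m \<notin> {\<one>, z}" "\<not> clash g m" "\<not> clash h m" using rich_clash[OF g h] by blast
  obtain w where w: "w \<in> carrier G" "clash m w" using clash_exists m by blast
  \<comment> \<open>A Gram-Schmidt step: since \<open>g\<close> clashes with \<open>h\<close>, the
    factor \<open>g\<close> changes only the relation of \<open>w\<close> to \<open>h\<close>, and
    the factor \<open>h\<close> only that to \<open>g\<close>; neither affects the relation to
    \<open>m\<close>.\<close>
  define u where "u = w \<otimes> (if clash h w then g else \<one>) \<otimes> (if clash g w then h else \<one>)"
  have "u \<in> carrier G" "clash m u" "\<not> clash g u" "\<not> clash h u"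
    using g h gh m w clash_sym[of m g] clash_sym[of m h] clash_sym[of h g]
    by (auto simp: u_def clash_mult_right)
  then show ?thesis using m by blast
qed

text \<open>Supplies, for each \<open>k\<close>, a noncommuting pair whose defect commutes with the
  image of \<open>k\<close>. A partner \<open>x\<close> of \<open>m\<close> is corrected by a
  partner \<open>l\<close> of \<open>k\<close>; this keeps the clash with \<open>m\<close>, which is
  orthogonal to \<open>k\<close> and \<open>l\<close>.\<close>

lemma clash_pair_commuting:
  assumes k: "k \<in> carrier G"
  shows "\<exists>g\<in>carrier G. \<exists>h\<in>carrier G. clash g h \<and> \<not> clash g k \<and> \<not> clash h k"
proof -
  obtain l where l: "l \<in> carrier G" "k \<notin> {\<one>, z} \<Longrightarrow> clash k l"
    using clash_exists[OF k] by (cases "k \<in> {\<one>, z}") auto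
  obtain m where m: "m \<in> carrier G" "m \<notin> {\<one>, z}" "\<not> clash k m" "\<not> clash l m" using rich_clash[OF k l(1)] by blast
  obtain x where x: "x \<in> carrier G" "clash m x" using clash_exists m by blast
  have kz: "\<not> clash x k" if "k \<in> {\<one>, z}" using that x z_commute by (auto simp: clash_def)
  define y where "y = x \<otimes> (if clash x k then l else \<one>)"
  have "y \<in> carrier G" "clash m y" "\<not> clash y k"
    using k l m x kz clash_sym[of m l] clash_sym[of l k] by (auto simp: y_def clash_mult_right clash_mult_left)
  then show ?thesis using m(1,3) clash_sym[of m k] by blast
qed

text \<open>In the symplectic space \<open>G/Z\<close>, a chain of steps \<open>h \<mapsto> h k\<close> with \<open>k\<close>
  orthogonal to \<open>g\<close> and \<open>h\<close> joins any two \<open>h\<close>, \<open>h'\<close> not orthogonal to \<open>g\<close>. Only the passage from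
  \<open>h\<close> to \<open>h g\<close> needs more than one step; it uses a hyperbolic pair \<open>m\<close>, \<open>w\<close> orthogonal to \<open>g\<close>
  and \<open>h\<close>, which exists in dimension at least 4.\<close>

lemma clash_invariant:
  assumes inv: "\<And>g h k. g \<in> carrier G \<Longrightarrow> h \<in> carrier G \<Longrightarrow> k \<in> carrier G \<Longrightarrow>
      \<not> clash g k \<Longrightarrow> \<not> clash h k \<Longrightarrow> f g (h \<otimes> k) = f g h"
    and g: "g \<in> carrier G" and h: "h \<in> carrier G" and h': "h' \<in> carrier G" and c: "clash g h" "clash g h'"
  shows "f g h' = f g h"
proof -
  have exceptional: "f g (x \<otimes> g) = f g x" if x: "x \<in> carrier G" "clash g x" for x
  proof -
    obtain m w where m: "m \<in> carrier G" "w \<in> carrier G" "clash m w" "\<not> clash g m" "\<not> clash x m" "\<not> clash g w" "\<not> clash x w"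
      using clash_pair[OF g x] by blast
    \<comment> \<open>Three admissible steps, by \<open>m\<close>, \<open>g \<otimes> w\<close> and
      \<open>inv (m \<otimes> w)\<close>. In the second the clash of \<open>x\<close> with
      \<open>g\<close> is offset by that of \<open>m\<close> with \<open>w\<close>.\<close>
    have "f g x = f g (x \<otimes> m)" using inv[OF g x(1) m(1)] m by simp
    also have "\<dots> = f g (x \<otimes> m \<otimes> (g \<otimes> w))"
      using g x m by (intro inv[symmetric]) (auto simp: clash_mult_left clash_mult_right clash_sym[of x g] clash_sym[of m g])
    also have "\<dots> = f g (x \<otimes> m \<otimes> (g \<otimes> w) \<otimes> inv (m \<otimes> w))"
      using g x m by (intro inv[symmetric])
        (auto simp: clash_mult_left clash_mult_right clash_sym[of w m])
    also have "x \<otimes> m \<otimes> (g \<otimes> w) \<otimes> inv (m \<otimes> w) = x \<otimes> g"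
    proof -
      have "m \<otimes> g = g \<otimes> m" using m(4) by (auto simp: clash_def)
      then have "x \<otimes> m \<otimes> (g \<otimes> w) = x \<otimes> g \<otimes> (m \<otimes> w)"
        using g x m by (metis m_assoc m_closed)
      then show ?thesis using g x m by (simp add: m_assoc)
    qed
    finally show ?thesis by simp
  qed
  define k where "k = inv h \<otimes> h'"
  have k: "k \<in> carrier G" "h' = h \<otimes> k" "\<not> clash g k"
    using h h' g c by (auto simp: k_def clash_mult_right simp flip: m_assoc)
  show ?thesis
  proof (cases "clash h k")
    case False
    then show ?thesis using inv[OF g h k(1)] k by simp
  next
    case True
    \<comment> \<open>Both \<open>k\<close> and \<open>g\<close> clash with \<open>h\<close>, so
      \<open>k \<otimes> inv g\<close> does not; the factor \<open>g\<close> left over is the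
      exceptional step.\<close>
    define k' where "k' = k \<otimes> inv g"
    have k': "k' \<in> carrier G" "\<not> clash g k'" "\<not> clash h k'"
      using k g h True c by (auto simp: k'_def clash_mult_right clash_sym[of h g])
    have "h' = h \<otimes> k' \<otimes> g" using k g h by (simp add: k'_def m_assoc)
    then have "f g h' = f g (h \<otimes> k')"
      using exceptional[of "h \<otimes> k'"] k' g h c by (simp add: clash_mult_right)
    then show ?thesis using inv[OF g h k'(1)] k' by simp
  qed
qed

text \<open>The quadratic form of squaring, with the values 0 and 1 that form the carrier of
  \<open>integer_mod_group 2\<close>.\<close>

definition quad :: "'a \<Rightarrow> int" where
  "quad x = (if x \<otimes> x = \<one> then 0 else 1)"

text \<open>Exchanging the inner factors of the square of \<open>x \<otimes> y\<close> costs their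
  commutator, so \<open>clash\<close> is the polar form of \<open>quad\<close>.\<close>

lemma quad_mult:
  assumes x: "x \<in> carrier G" and y: "y \<in> carrier G"
  shows "quad (x \<otimes> y) = (quad x + quad y + (if clash x y then 1 else 0)) mod 2"
proof -
  have "(x \<otimes> y) \<otimes> (x \<otimes> y) = x \<otimes> (y \<otimes> x) \<otimes> y" using x y by (simp add: m_assoc)
  also have "\<dots> = (if clash x y then z else \<one>) \<otimes> ((x \<otimes> x) \<otimes> (y \<otimes> y))"
  proof (cases "clash x y")
    case True
    then have "y \<otimes> x = z \<otimes> (x \<otimes> y)" using clash_z[of y x] x y by (simp add: clash_sym)
    then have "x \<otimes> (y \<otimes> x) \<otimes> y = x \<otimes> z \<otimes> x \<otimes> y \<otimes> y" using x y by (simp add: m_assoc)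
    also have "\<dots> = z \<otimes> (x \<otimes> x \<otimes> (y \<otimes> y))" using x y z_commute[of x, symmetric] by (simp add: m_assoc)
    finally show ?thesis using True by simp
  next
    case False
    then have "y \<otimes> x = x \<otimes> y" by (simp add: clash_def)
    then show ?thesis using x y False by (simp add: m_assoc)
  qed
  finally show ?thesis
    using square[OF x] square[OF y] z_square z_not_one x y by (auto simp: quad_def)
qed

end

text \<open>\<open>C\<close> stands for the colimit: \<open>j_induct\<close> expresses that the
  \<open>j g\<close> generate it, and \<open>j_lift\<close> provides the map that will be the
  isomorphism.\<close>

locale commuting_cover = two_central G z + C: group C
  for G (structure) and z and C (structure) +
  fixes j
  assumes j_closed [simp]: "g \<in> carrier G \<Longrightarrow> j g \<in> carrier C"
    and j_mult: "g \<in> carrier G \<Longrightarrow> h \<in> carrier G \<Longrightarrow> g \<otimes> h = h \<otimes> g \<Longrightarrow> j (g \<otimes> h) = j g \<otimes>\<^bsub>C\<^esub> j h"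
    and j_induct: "w \<in> carrier C \<Longrightarrow> Q \<one>\<^bsub>C\<^esub> \<Longrightarrow>
       (\<And>g w. g \<in> carrier G \<Longrightarrow> w \<in> carrier C \<Longrightarrow> Q w \<Longrightarrow> Q (j g \<otimes>\<^bsub>C\<^esub> w)) \<Longrightarrow> Q w"
    and j_lift: "\<exists>f\<in>hom C (G \<times>\<times> integer_mod_group 2). \<forall>g\<in>carrier G. f (j g) = (g, quad g)"
begin

abbreviation cover_mult (infixl "\<cdot>" 70) where "x \<cdot> y \<equiv> x \<otimes>\<^bsub>C\<^esub> y"

lemma j_mult_clash: "g \<in> carrier G \<Longrightarrow> h \<in> carrier G \<Longrightarrow> \<not> clash g h \<Longrightarrow> j (g \<otimes> h) = j g \<cdot> j h"
  using j_mult[of g h] unfolding clash_def by blast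

lemma j_commute: "g \<in> carrier G \<Longrightarrow> h \<in> carrier G \<Longrightarrow> \<not> clash g h \<Longrightarrow> j g \<cdot> j h = j h \<cdot> j g"
proof -
  assume h: "g \<in> carrier G" "h \<in> carrier G" "\<not> clash g h"
  have "j g \<cdot> j h = j (g \<otimes> h)" using j_mult_clash[OF h] by simp
  also have "g \<otimes> h = h \<otimes> g" using h(3) by (simp add: clash_def)
  also have "j (h \<otimes> g) = j h \<cdot> j g" using j_mult_clash[of h g] h clash_sym[of g h] by simp
  finally show ?thesis .
qed

lemma j_one: "j \<one> = \<one>\<^bsub>C\<^esub>"
  using j_mult[of "\<one>" "\<one>"] C.l_cancel_one[of "j \<one>" "j \<one>"] by simp

text \<open>A factor set measuring how far \<open>j\<close> is from a homomorphism; that its values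
  are central is proved only in \<open>cover_iso\<close>.\<close>

definition defect where
  "defect g h = j g \<cdot> j h \<cdot> inv\<^bsub>C\<^esub> j (g \<otimes> h)"

lemma defect_closed [simp]: "g \<in> carrier G \<Longrightarrow> h \<in> carrier G \<Longrightarrow> defect g h \<in> carrier C"
  by (simp add: defect_def)

lemma defect_mult: "g \<in> carrier G \<Longrightarrow> h \<in> carrier G \<Longrightarrow> j g \<cdot> j h = defect g h \<cdot> j (g \<otimes> h)"
  by (simp add: defect_def C.m_assoc)

lemma defect_eqI:
  "g \<in> carrier G \<Longrightarrow> h \<in> carrier G \<Longrightarrow> c \<in> carrier C \<Longrightarrow> j g \<cdot> j h = c \<cdot> j (g \<otimes> h) \<Longrightarrow> defect g h = c"
  by (simp add: defect_def C.m_assoc)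

text \<open>As \<open>k\<close> commutes with \<open>g\<close>, \<open>h\<close> and their product,
  \<open>j\<close> is multiplicative on each of these pairs and \<open>j k\<close> can be moved
  through the defining expression. The first two claims feed \<open>clash_invariant\<close>, the
  third gives centrality.\<close>

lemma
  assumes g: "g \<in> carrier G" and h: "h \<in> carrier G" and k: "k \<in> carrier G" and c: "\<not> clash g k" "\<not> clash h k"
  shows defect_right: "defect g (h \<otimes> k) = defect g h"
    and defect_left: "defect (g \<otimes> k) h = defect g h"
    and defect_commute: "defect g h \<cdot> j k = j k \<cdot> defect g h"
proof -
  have gh: "\<not> clash (g \<otimes> h) k" using assms by (simp add: clash_mult_left)
  have e: "j (g \<otimes> h \<otimes> k) = j (g \<otimes> h) \<cdot> j k" using j_mult_clash[OF _ k gh] g h by simp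
  have hk: "k \<otimes> h = h \<otimes> k" using c by (simp add: clash_def)
  show "defect g (h \<otimes> k) = defect g h"
  proof (rule defect_eqI)
    have "j g \<cdot> j (h \<otimes> k) = (j g \<cdot> j h) \<cdot> j k"
      using j_mult_clash[OF h k c(2)] assms by (simp add: C.m_assoc)
    also have "\<dots> = defect g h \<cdot> j (g \<otimes> (h \<otimes> k))"
      unfolding defect_mult[OF g h] using e assms by (simp add: C.m_assoc m_assoc)
    finally show "j g \<cdot> j (h \<otimes> k) = defect g h \<cdot> j (g \<otimes> (h \<otimes> k))" .
  qed (use assms in auto)
  show "defect (g \<otimes> k) h = defect g h"
  proof (rule defect_eqI)
    have "j (g \<otimes> k) \<cdot> j h = j g \<cdot> (j k \<cdot> j h)"
      using j_mult_clash[OF g k c(1)] assms by (simp add: C.m_assoc)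
    also have "\<dots> = (j g \<cdot> j h) \<cdot> j k"
      using j_commute[OF h k c(2)] assms by (simp add: C.m_assoc)
    also have "\<dots> = defect g h \<cdot> j (g \<otimes> k \<otimes> h)"
      unfolding defect_mult[OF g h] using e assms hk by (simp add: C.m_assoc m_assoc)
    finally show "j (g \<otimes> k) \<cdot> j h = defect g h \<cdot> j (g \<otimes> k \<otimes> h)" .
  qed (use assms in auto)
  have inv: "inv\<^bsub>C\<^esub> y \<cdot> x = x \<cdot> inv\<^bsub>C\<^esub> y"
    if "x \<in> carrier C" "y \<in> carrier C" "x \<cdot> y = y \<cdot> x" for x y
  proof -
    have "inv\<^bsub>C\<^esub> y \<cdot> x = inv\<^bsub>C\<^esub> y \<cdot> (x \<cdot> y) \<cdot> inv\<^bsub>C\<^esub> y"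
      using that(1,2) by (simp add: C.m_assoc)
    also have "\<dots> = x \<cdot> inv\<^bsub>C\<^esub> y"
      unfolding that(3) using that(1,2) by (simp flip: C.m_assoc)
    finally show ?thesis .
  qed
  have "inv\<^bsub>C\<^esub> j (g \<otimes> h) \<cdot> j k = j k \<cdot> inv\<^bsub>C\<^esub> j (g \<otimes> h)"
    using j_commute[OF _ k gh] g h k by (intro inv) auto
  then have "defect g h \<cdot> j k = j g \<cdot> (j h \<cdot> j k) \<cdot> inv\<^bsub>C\<^esub> j (g \<otimes> h)"
    using assms by (simp add: defect_def C.m_assoc)
  also have "\<dots> = (j g \<cdot> j k) \<cdot> j h \<cdot> inv\<^bsub>C\<^esub> j (g \<otimes> h)"
    using j_commute[OF h k c(2)] assms by (simp add: C.m_assoc)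
  also have "\<dots> = j k \<cdot> defect g h"
    using j_commute[OF g k c(1)] assms by (simp add: defect_def C.m_assoc)
  finally show "defect g h \<cdot> j k = j k \<cdot> defect g h" .
qed

text \<open>Each argument can be changed while the other is fixed, by
  \<open>clash_invariant\<close>. Two pairs are then linked by an element that clashes with both
  first arguments: one of \<open>h\<close>, \<open>h'\<close>, or their product.\<close>

lemma defect_const:
  assumes "g \<in> carrier G" "h \<in> carrier G" "g' \<in> carrier G" "h' \<in> carrier G" "clash g h" "clash g' h'"
  shows "defect g h = defect g' h'"
proof -
  have R: "defect a b' = defect a b" if "a \<in> carrier G" "b \<in> carrier G" "b' \<in> carrier G" "clash a b" "clash a b'" for a b b'
    using clash_invariant[of defect, OF defect_right] that by blast
  have L: "defect a' b = defect a b" if "a \<in> carrier G" "a' \<in> carrier G" "b \<in> carrier G" "clash a b" "clash a' b" for a a' b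
    using clash_invariant[of "\<lambda>b a. defect a b" b a a'] defect_left that clash_sym by blast
  have *: ?thesis if "x \<in> carrier G" "clash g x" "clash g' x" for x
    using R[of g h x] L[of g g' x] R[of g' h' x] assms that by simp
  show ?thesis
  proof (cases "clash g h' \<or> clash g' h")
    case True
    then show ?thesis using *[of h] *[of h'] assms by blast
  next
    case False
    then show ?thesis using *[of "h \<otimes> h'"] assms by (simp add: clash_mult_right)
  qed
qed

theorem cover_iso: "C \<cong> G \<times>\<times> integer_mod_group 2"
proof -
  let ?Z = "integer_mod_group 2"
  let ?D = "G \<times>\<times> ?Z"
  have Z: "carrier ?Z = {0, 1}" by (auto simp: carrier_integer_mod_group)
  have D: "group ?D" by (intro DirProd_group is_group) simp
  obtain a b where ab: "a \<in> carrier G" "b \<in> carrier G" "clash a b"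
    using clash_pair_commuting[OF one_closed] by blast
  define c where "c = defect a b"
  have c: "c \<in> carrier C" using ab by (simp add: c_def)
  have c_eq: "defect g h = c" if "g \<in> carrier G" "h \<in> carrier G" "clash g h" for g h
    unfolding c_def using ab that by (intro defect_const)
  have c_central: "c \<cdot> j k = j k \<cdot> c" if k: "k \<in> carrier G" for k
  proof -
    obtain g h where gh: "g \<in> carrier G" "h \<in> carrier G" "clash g h" "\<not> clash g k" "\<not> clash h k"
      using clash_pair_commuting[OF k] by blast
    show ?thesis using defect_commute[OF gh(1,2) k gh(4,5)] unfolding c_eq[OF gh(1-3)] .
  qed
  have mult: "j g \<cdot> j h = (if clash g h then c else \<one>\<^bsub>C\<^esub>) \<cdot> j (g \<otimes> h)"
    if "g \<in> carrier G" "h \<in> carrier G" for g h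
    using that defect_mult[of g h] c_eq[of g h] j_mult_clash[of g h] by auto
  \<comment> \<open>The product of \<open>j a\<close>, \<open>j a\<close> and \<open>j b\<close> is
    evaluated in two ways: \<open>a\<close> clashes with \<open>b\<close> and with
    \<open>a \<otimes> b\<close>, giving two factors \<open>c\<close>, whereas
    \<open>a \<otimes> a\<close> commutes with \<open>b\<close> and gives none.\<close>
  have c2: "c \<cdot> c = \<one>\<^bsub>C\<^esub>"
  proof -
    have aa: "a \<otimes> a \<in> carrier G" "\<not> clash (a \<otimes> a) b" using ab by (auto simp: clash_mult_left)
    have aab: "clash a (a \<otimes> b)" using ab by (simp add: clash_mult_right)
    have "j a \<cdot> (j a \<cdot> j b) = j a \<cdot> (c \<cdot> j (a \<otimes> b))" using mult[of a b] ab by simp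
    also have "\<dots> = c \<cdot> (j a \<cdot> j (a \<otimes> b))"
      using c_central[OF ab(1)] ab c by (simp flip: C.m_assoc)
    also have "\<dots> = c \<cdot> (c \<cdot> j (a \<otimes> (a \<otimes> b)))" using mult[of a "a \<otimes> b"] aab ab by simp
    also have "a \<otimes> (a \<otimes> b) = a \<otimes> a \<otimes> b" using ab by (simp add: m_assoc)
    also have "j (a \<otimes> a \<otimes> b) = j a \<cdot> j a \<cdot> j b"
      using j_mult_clash[OF aa(1) ab(2) aa(2)] j_mult_clash[OF ab(1) ab(1)] by simp
    finally have "\<one>\<^bsub>C\<^esub> \<cdot> (j a \<cdot> j a \<cdot> j b) = c \<cdot> c \<cdot> (j a \<cdot> j a \<cdot> j b)"
      using ab c by (simp add: C.m_assoc)
    then have "\<one>\<^bsub>C\<^esub> = c \<cdot> c" using ab c by simp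
    then show ?thesis by simp
  qed
  \<comment> \<open>Because \<open>c\<close> is central with square one, products of generators
    collapse to a single \<open>j g\<close> and at most one \<open>c\<close>; so \<open>C\<close>
    has at most two elements over each \<open>g\<close>.\<close>
  have form: "\<exists>g\<in>carrier G. \<exists>e\<in>{\<one>\<^bsub>C\<^esub>, c}. w = e \<cdot> j g" if "w \<in> carrier C" for w
    using that
  proof (rule j_induct)
    show "\<exists>g\<in>carrier G. \<exists>e\<in>{\<one>\<^bsub>C\<^esub>, c}. \<one>\<^bsub>C\<^esub> = e \<cdot> j g" using j_one by (intro bexI[of _ "\<one>"]) auto
  next
    fix g w assume g: "g \<in> carrier G" and "w \<in> carrier C" "\<exists>g\<in>carrier G. \<exists>e\<in>{\<one>\<^bsub>C\<^esub>, c}. w = e \<cdot> j g"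
    then obtain h e where h: "h \<in> carrier G" "e \<in> {\<one>\<^bsub>C\<^esub>, c}" "w = e \<cdot> j h" by blast
    let ?d = "if clash g h then c else \<one>\<^bsub>C\<^esub>"
    have e: "e \<in> carrier C" "?d \<in> carrier C" "j g \<cdot> e = e \<cdot> j g" using h c c_central[OF g] g by auto
    have "j g \<cdot> w = e \<cdot> (j g \<cdot> j h)" using e g h by (simp flip: C.m_assoc)
    also have "\<dots> = e \<cdot> ?d \<cdot> j (g \<otimes> h)" using mult[OF g h(1)] e g h by (simp add: C.m_assoc)
    finally show "\<exists>g'\<in>carrier G. \<exists>e\<in>{\<one>\<^bsub>C\<^esub>, c}. j g \<cdot> w = e \<cdot> j g'"
      using g h c c2 by (intro bexI[of _ "g \<otimes> h"] bexI[of _ "e \<cdot> ?d"]) auto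
  qed
  obtain f where f: "f \<in> hom C ?D" "\<And>g. g \<in> carrier G \<Longrightarrow> f (j g) = (g, quad g)" using j_lift by blast
  interpret f: group_hom C ?D f
    using f D by (simp add: group_hom_def group_hom_axioms_def C.is_group)
  \<comment> \<open>Comparing the images of \<open>j a \<cdot> j b\<close> and
    \<open>c \<cdot> j (a \<otimes> b)\<close>: the second coordinate of \<open>f c\<close> is the
    polar form of \<open>quad\<close> at a clashing pair, hence 1.\<close>
  have fc: "f c = (\<one>, 1)"
  proof -
    have "f c \<otimes>\<^bsub>?D\<^esub> f (j (a \<otimes> b)) = f (j a) \<otimes>\<^bsub>?D\<^esub> f (j b)"
      using mult[of a b] ab c by (simp flip: f.hom_mult)
    moreover obtain u v where uv: "f c = (u, v)" by fastforce
    moreover have "f c \<in> carrier ?D" using c by (rule f.hom_closed)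
    ultimately have "u \<otimes> (a \<otimes> b) = a \<otimes> b" "(v + quad (a \<otimes> b)) mod 2 = (quad a + quad b) mod 2"
      "u \<in> carrier G" "v \<in> {0, 1}"
      using f(2) ab by (auto simp: DirProd_def mult_integer_mod_group carrier_integer_mod_group)
    moreover have "u = \<one>" using calculation(1,3) ab by simp
    moreover have "v = 1"
      using calculation(2,4) quad_mult[OF ab(1,2)] ab(3) by (auto simp: quad_def split: if_splits)
    ultimately show ?thesis using uv by simp
  qed
  have fe: "f (c \<cdot> j g) = (g, (1 + quad g) mod 2)" if "g \<in> carrier G" for g
    using that c fc f(2) by (simp add: f.hom_mult mult_DirProd mult_integer_mod_group)
  have "f w = \<one>\<^bsub>?D\<^esub> \<Longrightarrow> w = \<one>\<^bsub>C\<^esub>" if "w \<in> carrier C" for w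
    using form[OF that] fe f(2) j_one by (auto simp: quad_def split: if_splits)
  then have "inj_on f (carrier C)" using f.inj_iff_trivial_ker f.hom_one by (auto simp: kernel_def)
  moreover have "f ` carrier C = carrier ?D"
  proof
    show "f ` carrier C \<subseteq> carrier ?D" using f.hom_closed by blast
    show "carrier ?D \<subseteq> f ` carrier C"
    proof
      fix y assume "y \<in> carrier ?D"
      then obtain g e where y: "y = (g, e)" "g \<in> carrier G" "e \<in> {0, 1}"
        by (auto simp: Z)
      then have "y = f (j g) \<or> y = f (c \<cdot> j g)"
        using f(2) fe by (auto simp: quad_def)
      then show "y \<in> f ` carrier C" using C.m_closed[OF c j_closed[OF y(2)]] j_closed[OF y(2)] by blast
    qed
  qed
  ultimately have "f \<in> iso C ?D" using f(1) by (simp add: iso_def bij_betw_def)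
  then show ?thesis by (auto simp: is_iso_def)
qed

end

text \<open>Only \<open>rich\<close> is not read off the extension directly; it follows by counting.
  If the common centraliser of \<open>x\<close> and \<open>y\<close> were central, the map sending
  \<open>w\<close> to its commutation behaviour with \<open>x\<close> and \<open>y\<close> would
  have four fibres of at most two elements, so the order would be at most 8, not at least
  32.\<close>

lemma two_central_extraspecial:
  fixes G (structure)
  assumes n: "n \<ge> 2" and ex: "extraspecial_2_group n G"
  obtains z where "two_central G z"
proof -
  let ?Z = "integer_mod_group 2" and ?E = "product_group {..<2 * n} (\<lambda>_. integer_mod_group 2)"
  obtain \<iota> \<pi> where G: "group G" and i: "\<iota> \<in> mon ?Z G" and p: "\<pi> \<in> epi G ?E"
    and k: "\<iota> ` carrier ?Z = kernel G ?E \<pi>" and c: "\<iota> ` carrier ?Z = group_center G"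
    using ex by (auto simp: extraspecial_2_group_def)
  interpret group_hom G ?E \<pi>
    using G p by (auto simp: group_hom_def group_hom_axioms_def epi_def intro!: product_group)
  define z where "z = \<iota> 1"
  have Z: "carrier ?Z = {0, 1}" by (auto simp: carrier_integer_mod_group)
  have "\<iota> 0 = \<one>"
    using i Group.hom_one[of \<iota> ?Z G] G by (simp add: mon_def)
  then have ker: "kernel G ?E \<pi> = {\<one>, z}" and cen: "group_center G = {\<one>, z}"
    using k c Z by (auto simp: z_def)
  have z_closed: "z \<in> carrier G" using cen by (auto simp: group_center_def)
  have z_one: "z \<noteq> \<one>"
    using i \<open>\<iota> 0 = \<one>\<close> Z by (auto simp: mon_def z_def inj_on_def)
  have zc: "z \<otimes> x = x \<otimes> z" if "x \<in> carrier G" for x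
    using cen that by (auto simp: group_center_def)
  have E_square: "v \<otimes>\<^bsub>?E\<^esub> v = \<one>\<^bsub>?E\<^esub>" if "v \<in> carrier ?E" for v
    using that by (auto simp: PiE_iff Z mult_integer_mod_group intro!: ext) 
  have E_comm: "v \<otimes>\<^bsub>?E\<^esub> w = w \<otimes>\<^bsub>?E\<^esub> v" for v w
    by (auto simp: mult_integer_mod_group add.commute)
  have in_ker: "x \<in> {\<one>, z}" if "x \<in> carrier G" "\<pi> x = \<one>\<^bsub>?E\<^esub>" for x
    using that ker by (auto simp: kernel_def)
  have square: "x \<otimes> x \<in> {\<one>, z}" if "x \<in> carrier G" for x
    using that E_square[of "\<pi> x"] by (intro in_ker) (simp_all del: product_group carrier_product_group)
  have commutator: "x \<otimes> y = y \<otimes> x \<or> x \<otimes> y = z \<otimes> (y \<otimes> x)"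
    if xy: "x \<in> carrier G" "y \<in> carrier G" for x y
  proof -
    let ?u = "(x \<otimes> y) \<otimes> inv (y \<otimes> x)"
    have "\<pi> (x \<otimes> y) = \<pi> (y \<otimes> x)" using xy E_comm by (simp only: hom_mult)
    then have "\<pi> ?u = \<pi> (y \<otimes> x) \<otimes>\<^bsub>?E\<^esub> inv\<^bsub>?E\<^esub> \<pi> (y \<otimes> x)"
      using xy by (simp only: hom_mult[of "x \<otimes> y"] hom_inv G.inv_closed G.m_closed)
    also have "\<dots> = \<one>\<^bsub>?E\<^esub>" using xy by (intro H.r_inv hom_closed G.m_closed)
    finally have "\<pi> ?u = \<one>\<^bsub>?E\<^esub>" .
    then have "?u \<in> {\<one>, z}" using xy by (intro in_ker) auto
    moreover have "x \<otimes> y = ?u \<otimes> (y \<otimes> x)" using xy by (simp add: G.m_assoc)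
    ultimately show ?thesis using xy by (metis G.l_one G.m_closed insert_iff singletonD)
  qed
  have rich: "\<exists>m\<in>carrier G. m \<notin> {\<one>, z} \<and> m \<otimes> x = x \<otimes> m \<and> m \<otimes> y = y \<otimes> m"
    if xy: "x \<in> carrier G" "y \<in> carrier G" for x y
  proof (rule ccontr)
    assume no: "\<not> ?thesis"
    define e where "e a w = (w \<otimes> a = a \<otimes> w)" for a w
    have trivial: "w \<in> carrier G \<Longrightarrow> e x w \<Longrightarrow> e y w \<Longrightarrow> w \<in> {\<one>, z}" for w
      using no by (auto simp: e_def)
    have e_div: "e a (inv v \<otimes> w)"
      if h: "a \<in> carrier G" "v \<in> carrier G" "w \<in> carrier G" "e a v = e a w" for a v w
    proof -
      \<comment> \<open>\<open>v\<close> and \<open>w\<close> have the same commutator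
        \<open>s\<close> with \<open>a\<close>, which therefore cancels in the quotient
        \<open>inv v \<otimes> w\<close>.\<close>
      have "\<exists>s\<in>{\<one>, z}. v \<otimes> a = s \<otimes> (a \<otimes> v) \<and> w \<otimes> a = s \<otimes> (a \<otimes> w)"
        using h commutator[OF h(2,1)] commutator[OF h(3,1)] by (cases "e a v") (auto simp: e_def)
      then obtain s where s: "s \<in> {\<one>, z}" "v \<otimes> a = s \<otimes> (a \<otimes> v)" "w \<otimes> a = s \<otimes> (a \<otimes> w)"
        by blast
      have sc: "s \<in> carrier G" using s(1) z_closed by auto
      have "v \<otimes> (inv v \<otimes> w \<otimes> a) = s \<otimes> (a \<otimes> w)"
        using h s(3) by (simp flip: G.m_assoc)
      also have "\<dots> = s \<otimes> (a \<otimes> v) \<otimes> (inv v \<otimes> w)"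
        using h sc G.inv_solve_left[of v w w] by (simp add: G.m_assoc) (simp flip: G.m_assoc)
      also have "\<dots> = v \<otimes> (a \<otimes> (inv v \<otimes> w))"
        unfolding s(2)[symmetric] using h by (simp add: G.m_assoc)
      finally show ?thesis unfolding e_def using h by simp
    qed
    have small: "inv v \<otimes> w \<in> {\<one>, z}"
      if "v \<in> carrier G" "w \<in> carrier G" "e x v = e x w" "e y v = e y w" for v w
      using that xy by (intro trivial e_div) auto
    let ?F = "\<lambda>b. {w \<in> carrier G. (e x w, e y w) = b}"
    have fib: "card (?F b) \<le> 2" for b
    proof (cases "?F b = {}")
      case True
      show ?thesis unfolding True by simp
    next
      case False
      then obtain v where v: "v \<in> ?F b" by blast
      have "?F b \<subseteq> (\<lambda>u. v \<otimes> u) ` {\<one>, z}"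
      proof
        fix w assume w: "w \<in> ?F b"
        then have "inv v \<otimes> w \<in> {\<one>, z}" using v by (intro small) auto
        moreover have "w = v \<otimes> (inv v \<otimes> w)" using v w by (simp flip: G.m_assoc)
        ultimately show "w \<in> (\<lambda>u. v \<otimes> u) ` {\<one>, z}" by blast
      qed
      then have "card (?F b) \<le> card ((\<lambda>u. v \<otimes> u) ` {\<one>, z})" by (intro card_mono) auto
      also have "\<dots> \<le> card {\<one>, z}" by (rule card_image_le) simp
      also have "\<dots> \<le> 2" by (simp add: card_insert_if)
      finally show ?thesis .
    qed
    have "carrier G = (\<Union>b\<in>UNIV. ?F b)" by auto
    then have "card (carrier G) \<le> (\<Sum>b\<in>(UNIV :: (bool \<times> bool) set). card (?F b))"
      using card_UN_le[of "UNIV :: (bool \<times> bool) set" ?F] by simp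
    also have "\<dots> \<le> (\<Sum>b\<in>(UNIV :: (bool \<times> bool) set). 2)" by (intro sum_mono fib)
    also have "\<dots> = 8" by (simp add: card_cartesian_product flip: UNIV_Times_UNIV)
    finally have "order G \<le> 8" by (simp add: order_def)
    moreover have "(2::nat) ^ (2 * 2 + 1) \<le> 2 ^ (2 * n + 1)" using n by (intro power_increasing) auto
    ultimately show False using order_extraspecial_2_group[OF ex] by simp
  qed
  have "two_central G z"
  proof (unfold_locales)
    show "(\<forall>y\<in>carrier G. x \<otimes> y = y \<otimes> x) \<longleftrightarrow> x \<in> {\<one>, z}" if "x \<in> carrier G" for x
      using cen that by (auto simp: group_center_def)
  qed (use z_closed z_one square commutator rich in auto)
  then show ?thesis by (rule that)
qed

section \<open>The fundamental group as a colimit\<close>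

lemma (in group) generate_commute:
  assumes S: "S \<subseteq> carrier G" and c: "c \<in> carrier G" "\<And>s. s \<in> S \<Longrightarrow> s \<otimes> c = c \<otimes> s" and x: "x \<in> generate G S"
  shows "x \<otimes> c = c \<otimes> x"
  using x
proof (induction rule: generate.induct)
  case (inv h)
  have "inv h \<otimes> c = inv h \<otimes> (c \<otimes> h) \<otimes> inv h" using inv S c(1) by (auto simp: m_assoc)
  also have "\<dots> = c \<otimes> inv h"
    unfolding c(2)[OF inv, symmetric] using inv S c(1) by (auto simp flip: m_assoc)
  finally show ?case .
next
  case (eng h1 h2)
  then have "h1 \<in> carrier G" "h2 \<in> carrier G" using generate_in_carrier[OF S] by blast+
  then show ?case using eng c(1) by (metis m_assoc)
qed (use c in auto)

lemma (in group) generate_abelian: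
  assumes S: "S \<subseteq> carrier G" and c: "\<And>s t. s \<in> S \<Longrightarrow> t \<in> S \<Longrightarrow> s \<otimes> t = t \<otimes> s"
  shows "generate G S \<in> abelian_subgroups G"
proof -
  have "x \<otimes> y = y \<otimes> x" if "x \<in> generate G S" "y \<in> generate G S" for x y
  proof -
    have "s \<otimes> x = x \<otimes> s" if "s \<in> S" for s
      using generate_commute[OF S, of s x] S c that \<open>x \<in> generate G S\<close> by auto
    then show ?thesis
      using generate_commute[OF S, of x y] that generate_in_carrier[OF S] by auto
  qed
  then have "comm_group (G\<lparr>carrier := generate G S\<rparr>)"
    using subgroup_imp_group[OF generate_is_subgroup[OF S]]
    by (intro group.group_comm_groupI) auto
  then show ?thesis using generate_is_subgroup[OF S] by (simp add: abelian_subgroups_def)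
qed

context group begin

abbreviation incl where
  "incl A \<equiv> colimit_inj (abelian_subgroups G) (\<subseteq>) (\<lambda>A. G\<lparr>carrier := A\<rparr>) (\<lambda>A B. id) A"

interpretation D: group_diagram "abelian_subgroups G" "(\<subseteq>)" "\<lambda>A. G\<lparr>carrier := A\<rparr>" "\<lambda>A B. id"
  by (rule group_diagram_abelian_subgroups)

text \<open>The cyclic subgroup is the smallest choice; by \<open>incl_eq_gen\<close> every abelian
  subgroup containing \<open>g\<close> gives the same element.\<close>

definition colimit_gen :: "'a \<Rightarrow> ('a set \<times> 'a) list set" where
  "colimit_gen g = incl (generate G {g}) g"

lemma group_abelian_colimit: "group (abelian_colimit G)"
  unfolding abelian_colimit_def by (rule D.group_group_colimit)

lemma cyclic_abelian: "g \<in> carrier G \<Longrightarrow> generate G {g} \<in> abelian_subgroups G"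
  by (rule generate_abelian) auto

lemma incl_hom: "A \<in> abelian_subgroups G \<Longrightarrow> incl A \<in> hom (G\<lparr>carrier := A\<rparr>) (abelian_colimit G)"
  unfolding abelian_colimit_def by (rule D.colimit_inj_hom)

lemma abelian_subgroups_carrier: "A \<in> abelian_subgroups G \<Longrightarrow> x \<in> A \<Longrightarrow> x \<in> carrier G"
  by (auto simp: abelian_subgroups_def dest: subgroup.subset)

lemma incl_eq_gen:
  assumes A: "A \<in> abelian_subgroups G" and g: "g \<in> A"
  shows "incl A g = colimit_gen g"
proof -
  have "generate G {g} \<subseteq> A"
    using A g by (intro generate_subgroup_incl) (auto simp: abelian_subgroups_def)
  then show ?thesis
    using D.colimit_inj_compat[of "generate G {g}" A g] A cyclic_abelian[OF abelian_subgroups_carrier[OF A g]]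
    by (simp add: colimit_gen_def generate.incl)
qed

lemma colimit_gen_closed: "g \<in> carrier G \<Longrightarrow> colimit_gen g \<in> carrier (abelian_colimit G)"
  unfolding colimit_gen_def using hom_in_carrier[OF incl_hom[OF cyclic_abelian], of g g] by (simp add: generate.incl)

text \<open>Two commuting elements generate an abelian subgroup, in which the product can be formed
  before passing to the colimit.\<close>

lemma colimit_gen_mult:
  assumes "g \<in> carrier G" "h \<in> carrier G" "g \<otimes> h = h \<otimes> g"
  shows "colimit_gen (g \<otimes> h) = colimit_gen g \<otimes>\<^bsub>abelian_colimit G\<^esub> colimit_gen h"
proof -
  let ?A = "generate G {g, h}"
  have A: "?A \<in> abelian_subgroups G" using assms by (intro generate_abelian) auto
  have m: "g \<in> ?A" "h \<in> ?A" "g \<otimes> h \<in> ?A" by (auto intro: generate.intros)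
  then show ?thesis using hom_mult[OF incl_hom[OF A], of g h] by (simp add: incl_eq_gen[OF A])
qed

lemma colimit_induct:
  assumes w: "w \<in> carrier (abelian_colimit G)" and one: "Q \<one>\<^bsub>abelian_colimit G\<^esub>"
    and step: "\<And>g w. g \<in> carrier G \<Longrightarrow> w \<in> carrier (abelian_colimit G) \<Longrightarrow> Q w
       \<Longrightarrow> Q (colimit_gen g \<otimes>\<^bsub>abelian_colimit G\<^esub> w)"
  shows "Q w"
proof -
  obtain u where u: "u \<in> D.words" "w = D.R `` {u}" using w unfolding abelian_colimit_def D.carrier_C by blast
  have "Q (D.R `` {u})" using u(1)
  proof (induction u rule: list.induct)
    case Nil
    show ?case using one unfolding abelian_colimit_def D.one_C .
  next
    case (Cons a u)
    obtain A x where a: "a = (A, x)" by fastforce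
    have A: "A \<in> abelian_subgroups G" "x \<in> A" and u: "u \<in> D.words" using Cons.prems a by auto
    have gen: "D.R `` {[a]} = colimit_gen x" using incl_eq_gen[OF A] unfolding colimit_inj_def a .
    have eq: "D.R `` {a # u} = colimit_gen x \<otimes>\<^bsub>abelian_colimit G\<^esub> D.R `` {u}"
      using D.mult_C[of "[a]" u] unfolding gen abelian_colimit_def by (simp only: append_Cons append_Nil)
    show ?case unfolding eq
      by (rule step[OF abelian_subgroups_carrier[OF A] D.class_in_C[OF u, folded abelian_colimit_def] Cons.IH[OF u]])
  qed
  then show ?thesis unfolding u(2) .
qed

text \<open>A map that is multiplicative on commuting pairs is a homomorphism on each abelian
  subgroup, and its restrictions agree on smaller subgroups, so the universal property
  applies.\<close>

lemma colimit_lift: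
  fixes L :: "('c, 'd) monoid_scheme"
  assumes L: "group L" and f: "\<And>g. g \<in> carrier G \<Longrightarrow> f g \<in> carrier L"
    and mult: "\<And>g h. g \<in> carrier G \<Longrightarrow> h \<in> carrier G \<Longrightarrow> g \<otimes> h = h \<otimes> g \<Longrightarrow> f (g \<otimes> h) = f g \<otimes>\<^bsub>L\<^esub> f h"
  shows "\<exists>\<phi>\<in>hom (abelian_colimit G) L. \<forall>g\<in>carrier G. \<phi> (colimit_gen g) = f g"
proof -
  have "f \<in> hom (G\<lparr>carrier := A\<rparr>) L" if A: "A \<in> abelian_subgroups G" for A
  proof (rule homI)
    fix x y assume xy: "x \<in> carrier (G\<lparr>carrier := A\<rparr>)" "y \<in> carrier (G\<lparr>carrier := A\<rparr>)"
    have "comm_group (G\<lparr>carrier := A\<rparr>)" using A by (simp add: abelian_subgroups_def)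
    from comm_monoid.m_comm[OF comm_group.axioms(1)[OF this] xy] have "x \<otimes> y = y \<otimes> x" by simp
    then show "f (x \<otimes>\<^bsub>G\<lparr>carrier := A\<rparr>\<^esub> y) = f x \<otimes>\<^bsub>L\<^esub> f y"
      using mult xy abelian_subgroups_carrier[OF A] by simp
  qed (use f abelian_subgroups_carrier[OF A] in simp)
  then obtain \<phi> where "\<phi> \<in> hom (abelian_colimit G) L"
    "\<forall>A\<in>abelian_subgroups G. \<forall>x\<in>A. \<phi> (incl A x) = f x"
    using D.group_colimit_universal[OF L, of "\<lambda>_. f"] unfolding abelian_colimit_def by auto
  then show ?thesis
    using cyclic_abelian unfolding colimit_gen_def by (intro bexI[of _ \<phi>]) (auto simp: generate.incl)
qed

text \<open>The identity of \<open>G\<close> extends to the colimit and is a left inverse.\<close>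

lemma colimit_gen_inj: "inj_on colimit_gen (carrier G)"
proof -
  obtain \<phi> where "\<forall>g\<in>carrier G. \<phi> (colimit_gen g) = g"
    using colimit_lift[OF is_group, of "\<lambda>g. g"] by auto
  then show ?thesis by (intro inj_on_inverseI) auto
qed

end

section \<open>Comparison of the fundamental group with the colimit\<close>

lemma (in commuting_map) monodromy_hom:
  "\<exists>\<phi>\<in>hom P H. \<forall>g\<in>carrier G. \<phi> (edge_class g) = \<iota> g"
proof -
  define \<phi> where "\<phi> w = (THE k. \<exists>p. loop_in X x0 p \<and> w = loop_class X x0 p \<and> monodromy p k)" for w
  have \<phi>: "\<phi> (loop_class X x0 p) = k" if p: "loop_in X x0 p" "monodromy p k" for p k
    unfolding \<phi>_def
  proof (rule the_equality)
    fix l assume "\<exists>q. loop_in X x0 q \<and> loop_class X x0 p = loop_class X x0 q \<and> monodromy q l"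
    then obtain q where q: "loop_in X x0 q" "path_homotopic X p q" "monodromy q l"
      using loop_class_eq_iff[OF p(1)] by blast
    then have "monodromy p l" using monodromy_homotopic[OF q(2)] p(1) by (simp add: loop_in_def)
    then show "l = k" using monodromy_unique p(2) by blast
  qed (use p in blast)
  have "\<phi> \<in> hom P H"
  proof (rule homI)
    fix x assume "x \<in> carrier P"
    then obtain p where p: "loop_in X x0 p" "x = loop_class X x0 p" unfolding carrier_fundamental_group by blast
    obtain k where k: "monodromy p k" using monodromy_exists p by blast
    then show "\<phi> x \<in> carrier H" using \<phi>[OF p(1) k] p by (simp add: monodromy_def)
  next
    fix x y assume "x \<in> carrier P" "y \<in> carrier P"
    then obtain p q where p: "loop_in X x0 p" "x = loop_class X x0 p" and q: "loop_in X x0 q" "y = loop_class X x0 q"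
      unfolding carrier_fundamental_group by blast
    obtain k l where k: "monodromy p k" "monodromy q l" using monodromy_exists p q by blast
    have "monodromy (path_concat p q) (k \<cdot> l)"
      using p q by (intro monodromy_concat k) (simp add: loop_in_def)
    then show "\<phi> (x \<otimes>\<^bsub>P\<^esub> y) = \<phi> x \<cdot> \<phi> y"
      using \<phi>[OF loop_in_concat[OF p(1) q(1)]] \<phi>[OF p(1) k(1)] \<phi>[OF q(1) k(2)] p q
      by (simp add: mult_fundamental_group)
  qed
  then show ?thesis using \<phi>[OF edge_loop monodromy_edge] by (auto simp: edge_class_def)
qed

text \<open>Monodromy \<phi> after \<psi> fixes the generators of the colimit, so \<psi> is
  injective; its image contains all edge classes, which generate by
  \<open>carrier_P\<close>.\<close>

theorem fundamental_group_B2: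
  fixes G :: "('a, 'b) monoid_scheme"
  assumes "group G"
  shows "fundamental_group (B2 G) (B2_point G) \<cong> abelian_colimit G"
proof -
  interpret G: group G by fact
  let ?C = "abelian_colimit G"
  interpret commuting_map G ?C "G.colimit_gen"
    using G.group_abelian_colimit G.colimit_gen_closed G.colimit_gen_mult G.colimit_gen_inj
    by (intro commuting_map.intro commuting_map_axioms.intro) auto
  obtain \<phi> where phi: "\<phi> \<in> hom P ?C" "\<And>g. g \<in> carrier G \<Longrightarrow> \<phi> (edge_class g) = G.colimit_gen g"
    using monodromy_hom by blast
  obtain \<psi> where psi: "\<psi> \<in> hom ?C P" "\<And>g. g \<in> carrier G \<Longrightarrow> \<psi> (G.colimit_gen g) = edge_class g"
    using G.colimit_lift[OF P.is_group edge_class_closed edge_class_mult] by blast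
  interpret phi: group_hom P ?C \<phi>
    using phi by (simp add: group_hom_def group_hom_axioms_def P.is_group H.is_group)
  interpret psi: group_hom ?C P \<psi>
    using psi by (simp add: group_hom_def group_hom_axioms_def P.is_group H.is_group)
  have left_inv: "\<phi> (\<psi> w) = w" if "w \<in> carrier ?C" for w
    using that
  proof (rule G.colimit_induct)
    fix g w assume "g \<in> carrier G" "w \<in> carrier ?C" "\<phi> (\<psi> w) = w"
    then show "\<phi> (\<psi> (G.colimit_gen g \<otimes>\<^bsub>?C\<^esub> w)) = G.colimit_gen g \<otimes>\<^bsub>?C\<^esub> w"
      using phi psi G.colimit_gen_closed edge_class_closed by simp
  qed simp
  have "N \<subseteq> \<psi> ` carrier ?C"
  proof (rule P.generate_subgroup_incl)
    show "edge_class ` carrier G \<subseteq> \<psi> ` carrier ?C"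
      using psi(2) G.colimit_gen_closed by (metis (no_types, lifting) image_eqI image_subsetI)
    show "subgroup (\<psi> ` carrier ?C) P" by (rule psi.img_is_subgroup)
  qed
  then have "\<psi> ` carrier ?C = carrier P" using carrier_P by auto
  moreover have "inj_on \<psi> (carrier ?C)" using left_inv by (rule inj_on_inverseI)
  ultimately have "\<psi> \<in> iso ?C P" using psi(1) by (simp add: iso_def bij_betw_def)
  then have "?C \<cong> P" by (auto simp: is_iso_def)
  then have "P \<cong> ?C" by (rule H.iso_sym)
  then show ?thesis by (simp add: B2_def B2_point_def)
qed

theorem abelian_colimit_extraspecial:
  assumes "n \<ge> 2" "extraspecial_2_group n G"
  shows "abelian_colimit G \<cong> G \<times>\<times> integer_mod_group 2"
proof -
  obtain z where "two_central G z" using two_central_extraspecial[OF assms] .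
  then interpret two_central G z .
  have Z: "carrier (integer_mod_group 2) = {0, 1}" by (auto simp: carrier_integer_mod_group)
  have "\<exists>f\<in>hom (abelian_colimit G) (G \<times>\<times> integer_mod_group 2). \<forall>g\<in>carrier G. f (colimit_gen g) = (g, quad g)"
  proof (rule colimit_lift)
    show "group (G \<times>\<times> integer_mod_group 2)" by (intro DirProd_group is_group) simp
    show "(g, quad g) \<in> carrier (G \<times>\<times> integer_mod_group 2)" if "g \<in> carrier G" for g
      using that by (auto simp: Z quad_def)
    show "(g \<otimes>\<^bsub>G\<^esub> h, quad (g \<otimes>\<^bsub>G\<^esub> h)) = (g, quad g) \<otimes>\<^bsub>G \<times>\<times> integer_mod_group 2\<^esub> (h, quad h)"
      if "g \<in> carrier G" "h \<in> carrier G" "g \<otimes>\<^bsub>G\<^esub> h = h \<otimes>\<^bsub>G\<^esub> g" for g h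
      using quad_mult[OF that(1,2)] that(3) by (simp add: mult_DirProd mult_integer_mod_group clash_def)
  qed
  then interpret commuting_cover G z "abelian_colimit G" colimit_gen
    using colimit_gen_closed colimit_gen_mult colimit_induct group_abelian_colimit
    by (intro commuting_cover.intro commuting_cover_axioms.intro two_central_axioms) blast+
  show ?thesis by (rule cover_iso)
qed

theorem theorem1p3:
  fixes G :: "('a, 'b) monoid_scheme" and n :: nat
  assumes "n \<ge> 2" and "extraspecial_2_group n G"
  shows "fundamental_group (B2 G) (B2_point G) \<cong> abelian_colimit G \<and>
         abelian_colimit G \<cong> G \<times>\<times> integer_mod_group 2"
proof
  have "group G" using assms(2) by (simp add: extraspecial_2_group_def)
  then show "fundamental_group (B2 G) (B2_point G) \<cong> abelian_colimit G" by (rule fundamental_group_B2)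
  show "abelian_colimit G \<cong> G \<times>\<times> integer_mod_group 2" by (rule abelian_colimit_extraspecial[OF assms])
qed

end
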